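(* Let $X$ be a compact metric space, $T\colon X\to X$ a continuous map, and suppose $(X,T)$ is uniquely ergodic with unique $T$-invariant Borel probability measure $\mu$. Then $$\lim_{N\to\infty}\frac1N\sum_{n=1}^N f\big(T^{\Omega(mn+r)}x\big)=\int f\,d\mu$$ for every $x\in X$, $f\in C(X)$, $m\in\mathbb{N}$, and $r\in\{0,1,\ldots,m-1\}$.
   Context: $\mathbb{N}=\{1,2,3,\ldots\}$. $\Omega(n)$ denotes the number of prime factors of $n$ counted with multiplicities. $C(X)$ is the space of continuous complex-valued functions on $X$. $(X,T)$ is uniquely ergodic if there is exactly one Borel probability measure $\mu$ on $X$ with $\mu(T^{-1}A)=\mu(A)$ for all Borel $A\subset X$. *)

theory Defs
  imports "HOL-Probability.Probability" "HOL-Computational_Algebra.Primes"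
begin

definition big_Omega :: "nat \<Rightarrow> nat" where
  "big_Omega n = size (prime_factorization n)"

text \<open>
  A compact metric space is rendered as a compact set \<open>X\<close> in a metric space type. The trace
  on \<open>X\<close> of the ambient Borel algebra is the Borel algebra of the subspace \<open>X\<close>; maps are only
  relevant on \<open>X\<close>, so the preimage of \<open>A\<close> under \<open>T : X \<rightarrow> X\<close> is \<open>T -` A \<inter> X\<close>.
\<close>

definition invariant_borel_prob ::
    "'a::topological_space set \<Rightarrow> ('a \<Rightarrow> 'a) \<Rightarrow> 'a measure \<Rightarrow> bool" where
  "invariant_borel_prob X T \<mu> \<longleftrightarrow>
     sets \<mu> = sets (restrict_space borel X) \<and>
     prob_space \<mu> \<and>
     (\<forall>A\<in>sets \<mu>. emeasure \<mu> (T -` A \<inter> X) = emeasure \<mu> A)"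

definition uniquely_ergodic :: "'a::topological_space set \<Rightarrow> ('a \<Rightarrow> 'a) \<Rightarrow> bool" where
  "uniquely_ergodic X T \<longleftrightarrow> (\<exists>!\<mu>. invariant_borel_prob X T \<mu>)"

end

theory Submission
  imports Defs "HOL-Number_Theory.Number_Theory" "HOL-Complex_Analysis.Complex_Analysis"
    "HOL-Real_Asymp.Real_Asymp"
begin

text \<open>
  Fix \<open>x\<close> and write \<open>a k = g (T\<^sup>k x)\<close>. By unique ergodicity and the Riesz representation theorem it
  suffices that the averages of \<open>a (\<Omega> n + 1) - a (\<Omega> n)\<close> over \<open>n \<equiv> r (mod m)\<close> tend to \<open>0\<close>: every limit
  functional of the orbit averages is then represented by a \<open>T\<close>-invariant measure.

  By the dual Turan--Kubilius inequality, the average of a bounded \<open>f\<close> over \<open>n \<le> N\<close> is close to the average of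
  \<open>n \<mapsto> f (p n)\<close> over \<open>n \<le> N / p\<close>, for all primes \<open>p\<close> outside a set of bounded logarithmic size. A prime
  factor \<open>p \<equiv> 1 (mod m)\<close> preserves the residue class and raises \<open>\<Omega>\<close> by one. Comparing the effect of a product
  \<open>q\<^sub>1 q\<^sub>2\<close> of two primes on \<open>a (\<Omega> n)\<close> with that of a single prime \<open>p \<approx> q\<^sub>1 q\<^sub>2\<close> on \<open>a (\<Omega> n + 1)\<close> gives the claim.
  Such primes exist outside the exceptional sets because primes \<open>p \<equiv> 1 (mod m)\<close> have positive
  logarithmic density in every multiplicative window; this follows from the nonvanishing of
  Dirichlet \<open>L\<close>-functions on \<open>Re s = 1\<close> by a Tauberian argument with the Fejer kernel.
\<close>

section \<open>Invariant measures from limit functionals\<close>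

text \<open>Write F_k(N) for the sum of a(\<Omega>(n) + k) over n \<le> N in the class r. A single
  prime only relates F_0(N) to F_1 at the smaller scale N / q, which says nothing about F_1(N). Two
  descents to the same scale do: up to a small multiple of N, F_0(N) is q1 q2 F_2(N / (q1 q2)) and
  F_1(N) is p F_2(N / p), and these agree once p / (q1 q2) is near 1. The obstacle is that the
  exceptional primes depend on N and, for q2, also on N / q1, so no fixed triple of primes works. A
  finite stock of candidates is therefore fixed before N; it only has to exceed the exceptional sets
  in its sum of 1 / p. Since p / (q1 q2) must be arbitrarily close to 1, primes are wanted in
  multiplicative windows of every fixed ratio above 1. This is why nonvanishing enters on the whole
  line Re s = 1 and not just at s = 1. In return, a lower bound of order 1 / s for the primes with
  ln p between s and s + d suffices, because consecutive cells then add up to a divergent harmonic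
  series.\<close>

locale mean_functional =
  fixes X :: "'a::metric_space set" and L :: "('a \<Rightarrow> real) \<Rightarrow> real"
  assumes compact_X: "compact X"
    and add: "continuous_on X g \<Longrightarrow> continuous_on X h \<Longrightarrow> L (\<lambda>x. g x + h x) = L g + L h"
    and scale: "continuous_on X g \<Longrightarrow> L (\<lambda>x. c * g x) = c * L g"
    and nonneg: "continuous_on X g \<Longrightarrow> (\<And>x. x \<in> X \<Longrightarrow> 0 \<le> g x) \<Longrightarrow> 0 \<le> L g"
    and one: "L (\<lambda>x. 1) = 1"
begin

lemma const: "L (\<lambda>x. c) = c"
  using scale[of "\<lambda>x. 1" c] one by simp

lemma uminus: "continuous_on X g \<Longrightarrow> L (\<lambda>x. - g x) = - L g"
  using scale[of g "-1"] by simp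

lemma mono:
  assumes "continuous_on X g" "continuous_on X h" "\<And>x. x \<in> X \<Longrightarrow> g x \<le> h x"
  shows "L g \<le> L h"
proof -
  have "0 \<le> L (\<lambda>x. h x + - g x)" using assms by (intro nonneg continuous_intros) auto
  also have "\<dots> = L h - L g" using assms by (subst add) (auto intro!: continuous_intros simp: uminus)
  finally show ?thesis by simp
qed

lemma sum: "finite I \<Longrightarrow> (\<And>i. i \<in> I \<Longrightarrow> continuous_on X (g i)) \<Longrightarrow> L (\<lambda>x. \<Sum>i\<in>I. g i x) = (\<Sum>i\<in>I. L (g i))"
proof (induction I rule: finite_induct)
  case (insert i I)
  then have "continuous_on X (\<lambda>x. \<Sum>i\<in>I. g i x)" by (intro continuous_intros) auto
  then show ?case using insert by (simp add: add)
qed (simp add: const)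

section \<open>Outer measure and Caratheodory measurability\<close>

text \<open>Vanishing off \<open>U\<close> replaces compact support inside \<open>U\<close>;
  \<open>trim\<close> recovers the latter at a small cost in \<open>L\<close>.\<close>

definition bumps :: "'a set \<Rightarrow> ('a \<Rightarrow> real) set" where
  "bumps U = {g. continuous_on X g \<and> (\<forall>x\<in>X. 0 \<le> g x \<and> g x \<le> 1) \<and> (\<forall>x\<in>X - U. g x = 0)}"

definition cap :: "'a set \<Rightarrow> ennreal" where
  "cap U = (SUP g\<in>bumps U. ennreal (L g))"

definition outer :: "'a set \<Rightarrow> ennreal" where
  "outer A = (INF U\<in>{U. open U \<and> A \<subseteq> U}. cap U)"

lemma zero_bump: "(\<lambda>x. 0) \<in> bumps U"
  by (simp add: bumps_def)

lemma bumps_nonempty: "bumps U \<noteq> {}"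
  using zero_bump by blast

lemma bump_le_cap: "g \<in> bumps U \<Longrightarrow> ennreal (L g) \<le> cap U"
  unfolding cap_def by (rule SUP_upper)

lemma bump_L: 
  assumes "g \<in> bumps U" shows "0 \<le> L g" "L g \<le> 1"
proof -
  show "0 \<le> L g" using assms by (intro nonneg) (auto simp: bumps_def)
  have "L g \<le> L (\<lambda>x. 1)" using assms by (intro mono) (auto simp: bumps_def)
  then show "L g \<le> 1" by (simp add: one)
qed

lemma cap_mono: "X \<inter> U \<subseteq> V \<Longrightarrow> cap U \<le> cap V"
  unfolding cap_def by (intro SUP_subset_mono) (auto simp: bumps_def)

lemma cap_le_1: "cap U \<le> 1"
  unfolding cap_def by (intro SUP_least) (use bump_L in auto)

lemma outer_open: "open U \<Longrightarrow> outer (X \<inter> U) = cap U"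
  unfolding outer_def
  by (intro antisym INF_lower INF_greatest) (auto intro: cap_mono)

lemma outer_mono: "A \<subseteq> B \<Longrightarrow> outer A \<le> outer B"
  unfolding outer_def by (intro INF_superset_mono) auto

lemma outer_le_cap: "open U \<Longrightarrow> A \<subseteq> U \<Longrightarrow> outer A \<le> cap U"
  unfolding outer_def by (intro INF_lower) auto

lemma outer_le_1: "outer A \<le> 1"
  using outer_le_cap[of UNIV A] cap_le_1[of UNIV] by simp

lemma outer_empty: "outer {} = 0"
proof -
  have "cap {} \<le> 0" unfolding cap_def
  proof (intro SUP_least)
    fix g assume g: "g \<in> bumps {}"
    then have "L g \<le> L (\<lambda>x. 0)" by (intro mono) (auto simp: bumps_def)
    then show "ennreal (L g) \<le> 0" by (simp add: const ennreal_neg)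
  qed
  then show ?thesis using outer_le_cap[of "{}" "{}"] by simp
qed

lemma outer_X: "outer X = 1"
proof -
  have "ennreal (L (\<lambda>x. 1)) \<le> cap UNIV" by (intro bump_le_cap) (simp add: bumps_def)
  then have "1 \<le> cap UNIV" by (simp add: one)
  then show ?thesis using outer_open[of UNIV] cap_le_1[of UNIV] by simp
qed

text \<open>Cutting off at level \<open>e\<close> costs at most \<open>e\<close>, because
  \<open>L (\<lambda>x. 1) = 1\<close>, and confines the bump to the compact set where
  \<open>g \<ge> e\<close>, which lies in \<open>U\<close>.\<close>

lemma trim:
  assumes g: "g \<in> bumps U" and e: "e > 0"
  shows "(\<lambda>x. max 0 (g x - e)) \<in> bumps U" "L g - e \<le> L (\<lambda>x. max 0 (g x - e))"
proof -
  have c: "continuous_on X g" using g by (simp add: bumps_def)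
  show "(\<lambda>x. max 0 (g x - e)) \<in> bumps U" using g e
    by (force simp: bumps_def intro!: continuous_intros)
  have "L g - e = L (\<lambda>x. g x + - e)" using add[OF c, of "\<lambda>x. -e"] by (simp add: const)
  also have "\<dots> \<le> L (\<lambda>x. max 0 (g x - e))" using c by (intro mono continuous_intros) auto
  finally show "L g - e \<le> L (\<lambda>x. max 0 (g x - e))" .
qed

lemma compact_superlevel:
  assumes "continuous_on X g" shows "compact {x\<in>X. (e::real) \<le> g x}"
proof -
  have "closed {x\<in>X. e \<le> g x}"
    using continuous_on_closed_Collect_le[OF continuous_on_const assms compact_imp_closed[OF compact_X]]
    by simp
  then have "compact (X \<inter> {x\<in>X. e \<le> g x})" by (intro compact_Int_closed compact_X)
  moreover have "X \<inter> {x\<in>X. e \<le> g x} = {x\<in>X. e \<le> g x}" by auto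
  ultimately show ?thesis by simp
qed

text \<open>The trimmed bump lives on a compact set, which finitely many \<open>U i\<close> cover; a
  partition of unity splits it into bumps of these sets.\<close>

lemma cap_UN:
  fixes U :: "nat \<Rightarrow> 'a set"
  assumes U: "\<And>i. open (U i)"
  shows "cap (\<Union>i. U i) \<le> (\<Sum>i. cap (U i))"
  unfolding cap_def[of "\<Union>i. U i"]
proof (rule SUP_least, rule ennreal_le_epsilon)
  fix g e assume g: "g \<in> bumps (\<Union>i. U i)" and e: "(e::real) > 0"
  define t where "t = (\<lambda>x. max 0 (g x - e))"
  have gc: "continuous_on X g" using g by (simp add: bumps_def)
  have t: "t \<in> bumps (\<Union>i. U i)" "L g - e \<le> L t" using trim[OF g e] by (auto simp: t_def)
  have K: "{x\<in>X. e \<le> g x} \<subseteq> (\<Union>i\<in>UNIV. U i)" using g e by (force simp: bumps_def)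
  obtain I where I: "finite I" "{x\<in>X. e \<le> g x} \<subseteq> (\<Union>i\<in>I. U i)"
    using compactE_image[OF compact_superlevel[OF gc] U K] by metis
  \<comment> \<open>\<open>infdist\<close> to the empty set is 0, so \<open>U i = UNIV\<close> gets
    a positive value of its own.\<close>
  define h where "h i x = (if U i = UNIV then 1 else infdist x (- U i))" for i x
  have h0: "h i x \<ge> 0" for i x by (simp add: h_def infdist_nonneg)
  have hpos: "h i x > 0" if "x \<in> U i" for i x
  proof (cases "U i = UNIV")
    case False
    then have "infdist x (- U i) \<noteq> 0"
      using that U[of i] in_closed_iff_infdist_zero[of "- U i" x] by auto
    then show ?thesis using False infdist_nonneg[of x "- U i"] by (simp add: h_def)
  qed (simp add: h_def)
  have hz: "h i x = 0" if "x \<notin> U i" for i x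
    using that by (auto simp: h_def)
  have hc: "continuous_on X (h i)" for i
    unfolding h_def by (cases "U i = UNIV") (auto intro!: continuous_intros)
  \<comment> \<open>The second summand makes \<open>D\<close> positive on all of \<open>X\<close>,
    hence the quotients continuous. It vanishes where \<open>t\<close> is nonzero, so the pieces
    still add up to \<open>t\<close>.\<close>
  define D where "D x = (\<Sum>i\<in>I. h i x) + max 0 (e - g x)" for x
  have D: "D x > 0" if x: "x \<in> X" for x
  proof (cases "e \<le> g x")
    case True
    then obtain i where i: "i \<in> I" "x \<in> U i" using I(2) x by blast
    have "(\<Sum>i\<in>I. h i x) > 0" using I(1) i hpos[OF i(2)] h0 by (intro sum_pos2) auto
    then show ?thesis by (simp add: D_def add_pos_nonneg)
  next
    case False
    then show ?thesis using h0 by (auto simp: D_def intro!: add_nonneg_pos sum_nonneg)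
  qed
  have Dc: "continuous_on X D" unfolding D_def using gc hc by (intro continuous_intros)
  define f where "f i x = t x * h i x / D x" for i x
  have tc: "continuous_on X t" using t by (simp add: bumps_def)
  have fc: "continuous_on X (f i)" for i
    unfolding f_def using tc hc Dc D by (intro continuous_intros) (auto simp: less_imp_neq[symmetric])
  have fsum: "(\<Sum>i\<in>I. f i x) = t x" if "x \<in> X" for x
  proof (cases "e < g x")
    case True
    then have "D x = (\<Sum>i\<in>I. h i x)" by (simp add: D_def)
    then show ?thesis using D[OF that] by (simp add: f_def flip: sum_divide_distrib sum_distrib_left)
  qed (simp add: f_def t_def)
  have f0: "f i x \<ge> 0" if "x \<in> X" for i x
    using D[OF that] h0[of i x] by (simp add: f_def t_def)
  have fb: "f i \<in> bumps (U i)" if "i \<in> I" for i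
  proof -
    have "f i x \<le> 1" if x: "x \<in> X" for x
    proof -
      have "f i x \<le> (\<Sum>i\<in>I. f i x)" using f0[OF x] I(1) \<open>i \<in> I\<close> by (intro member_le_sum) auto
      also have "\<dots> \<le> 1" using fsum[OF x] t(1) x by (auto simp: bumps_def)
      finally show ?thesis .
    qed
    then show ?thesis using fc f0 hz by (auto simp: bumps_def f_def)
  qed
  have "L t \<le> L (\<lambda>x. \<Sum>i\<in>I. f i x)" using fsum tc fc by (intro mono continuous_intros) auto
  also have "\<dots> = (\<Sum>i\<in>I. L (f i))" using I fc by (intro sum) auto
  finally have "ennreal (L t) \<le> ennreal (\<Sum>i\<in>I. L (f i))" by (rule ennreal_leI)
  also have "\<dots> = (\<Sum>i\<in>I. ennreal (L (f i)))" using fb bump_L by (subst sum_ennreal) auto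
  also have "\<dots> \<le> (\<Sum>i\<in>I. cap (U i))" using fb by (intro sum_mono bump_le_cap)
  also have "\<dots> \<le> (\<Sum>i. cap (U i))" using I(1) by (intro sum_le_suminf) auto
  finally have le: "ennreal (L t) \<le> (\<Sum>i. cap (U i))" .
  have "ennreal (L g) \<le> ennreal (L t + e)" using t(2) by (intro ennreal_leI) simp
  also have "\<dots> = ennreal (L t) + ennreal e" using bump_L[OF t(1)] e by (simp add: ennreal_plus)
  also have "\<dots> \<le> (\<Sum>i. cap (U i)) + ennreal e" by (intro add_right_mono le)
  finally show "ennreal (L g) \<le> (\<Sum>i. cap (U i)) + ennreal e" .
qed

lemma outer_UN: "outer (\<Union>i. A i) \<le> (\<Sum>i. outer (A i))" for A :: "nat \<Rightarrow> 'a set"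
proof (rule ennreal_le_epsilon)
  fix e :: real assume e: "e > 0"
  have "\<exists>U. open U \<and> A i \<subseteq> U \<and> cap U \<le> outer (A i) + ennreal (e * (1/2) ^ Suc i)" for i
  proof -
    have "outer (A i) < \<infinity>" using outer_le_1[of "A i"] by (rule le_less_trans) simp
    then have "outer (A i) + 0 < outer (A i) + ennreal (e * (1/2) ^ Suc i)"
      using e by (subst ennreal_add_left_cancel_less) auto
    then have "outer (A i) < outer (A i) + ennreal (e * (1/2) ^ Suc i)" by simp
    then show ?thesis unfolding outer_def[of "A i"] by (subst (asm) INF_less_iff) (auto simp: less_imp_le)
  qed
  then obtain U where U: "\<And>i. open (U i)" "\<And>i. A i \<subseteq> U i"
    "\<And>i. cap (U i) \<le> outer (A i) + ennreal (e * (1/2) ^ Suc i)" by metis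
  have "outer (\<Union>i. A i) \<le> cap (\<Union>i. U i)" using U by (intro outer_le_cap) auto
  also have "\<dots> \<le> (\<Sum>i. cap (U i))" using U by (intro cap_UN)
  also have "\<dots> \<le> (\<Sum>i. outer (A i) + ennreal (e * (1/2) ^ Suc i))" using U by (intro suminf_le) auto
  also have "\<dots> = (\<Sum>i. outer (A i)) + (\<Sum>i. ennreal (e * (1/2) ^ Suc i))" by (rule suminf_add[symmetric]) auto
  also have "(\<Sum>i. ennreal (e * (1/2) ^ Suc i)) = ennreal e"
  proof (rule suminf_ennreal_eq)
    show "(\<lambda>i. e * (1/2) ^ Suc i) sums e" using sums_mult[OF power_half_series, of e] by simp
  qed (use e in auto)
  finally show "outer (\<Union>i. A i) \<le> (\<Sum>i. outer (A i)) + ennreal e" .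
qed

lemma outer_measure: "outer_measure_space (Pow X) outer"
  unfolding outer_measure_space_def positive_def increasing_def countably_subadditive_def
  using outer_empty outer_mono outer_UN by auto

text \<open>A nearly optimal bump inside \<open>V \<inter> U\<close> and one living off its support
  add up to a bump of \<open>V\<close>; this is superadditivity. The other direction is
  subadditivity.\<close>

lemma open_caratheodory:
  assumes U: "open U" and A: "A \<subseteq> X"
  shows "outer (A \<inter> (X \<inter> U)) + outer (A - X \<inter> U) = outer A"
proof (rule antisym)
  show "outer (A \<inter> (X \<inter> U)) + outer (A - X \<inter> U) \<le> outer A"
    unfolding outer_def[of A]
  proof (rule INF_greatest)
    fix V assume "V \<in> {V. open V \<and> A \<subseteq> V}"
    then have V: "open V" "A \<subseteq> V" by auto
    have "outer (A \<inter> (X \<inter> U)) + outer (A - X \<inter> U) \<le> cap (V \<inter> U) + outer (A - X \<inter> U)"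
      using U V by (intro add_right_mono outer_le_cap) auto
    also have "\<dots> = (SUP g\<in>bumps (V \<inter> U). ennreal (L g) + outer (A - X \<inter> U))"
      unfolding cap_def by (rule ennreal_SUP_add_left[symmetric, OF bumps_nonempty]) 
    also have "\<dots> \<le> cap V"
    proof (rule SUP_least, rule ennreal_le_epsilon)
      fix g e assume g: "g \<in> bumps (V \<inter> U)" and e: "(e::real) > 0"
      define t where "t = (\<lambda>x. max 0 (g x - e))"
      have t: "t \<in> bumps (V \<inter> U)" "L g - e \<le> L t" using trim[OF g e] by (auto simp: t_def)
      \<comment> \<open>Removing the compact set that carries \<open>t\<close> leaves an open set
        still containing \<open>A - X \<inter> U\<close>, and bumps of \<open>W\<close> vanish
        wherever \<open>t\<close> does not.\<close>
      define W where "W = V - {x\<in>X. e \<le> g x}"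
      have gc: "continuous_on X g" using g by (simp add: bumps_def)
      have W: "open W" unfolding W_def
        using V compact_imp_closed[OF compact_superlevel[OF gc]] by (intro open_Diff) auto
      have "A - X \<inter> U \<subseteq> W" using V A g e by (force simp: W_def bumps_def)
      then have "ennreal (L t) + outer (A - X \<inter> U) \<le> ennreal (L t) + cap W"
        using W by (intro add_left_mono outer_le_cap)
      also have "\<dots> = (SUP h\<in>bumps W. ennreal (L t) + ennreal (L h))"
        unfolding cap_def by (rule ennreal_SUP_add_right[OF bumps_nonempty])
      also have "\<dots> \<le> cap V"
      proof (rule SUP_least)
        fix h assume h: "h \<in> bumps W"
        have "t x = 0 \<or> h x = 0" if "x \<in> X" for x
          using h that by (cases "e \<le> g x") (auto simp: bumps_def W_def t_def)
        then have "(\<lambda>x. t x + h x) \<in> bumps V"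
          using h t(1) by (fastforce simp: bumps_def W_def intro!: continuous_intros)
        from bump_le_cap[OF this] show "ennreal (L t) + ennreal (L h) \<le> cap V"
          using bump_L[OF h] bump_L[OF t(1)] h t(1)
          by (subst (asm) add) (auto simp: bumps_def ennreal_plus)
      qed
      finally have le: "ennreal (L t) + outer (A - X \<inter> U) \<le> cap V" .
      have "ennreal (L g) \<le> ennreal (L t + e)" using t(2) by (intro ennreal_leI) simp
      then have "ennreal (L g) \<le> ennreal (L t) + ennreal e"
        using bump_L[OF t(1)] e by (simp add: ennreal_plus)
      then have "ennreal (L g) + outer (A - X \<inter> U) \<le> ennreal (L t) + ennreal e + outer (A - X \<inter> U)"
        by (rule add_right_mono)
      also have "\<dots> = (ennreal (L t) + outer (A - X \<inter> U)) + ennreal e" by (simp add: add_ac)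
      also have "\<dots> \<le> cap V + ennreal e" by (intro add_right_mono le)
      finally show "ennreal (L g) + outer (A - X \<inter> U) \<le> cap V + ennreal e" .
    qed
    finally show "outer (A \<inter> (X \<inter> U)) + outer (A - X \<inter> U) \<le> cap V" .
  qed
next
  define B where "B i = (if i = 0 then A \<inter> (X \<inter> U) else if i = 1 then A - X \<inter> U else {})" for i :: nat
  have "A = (\<Union>i. B i)" by (auto simp: B_def split: if_splits)
  then have "outer A \<le> (\<Sum>i. outer (B i))" using outer_UN[of B] by simp
  also have "\<dots> = (\<Sum>i<2. outer (B i))" by (rule suminf_finite) (auto simp: B_def outer_empty)
  also have "\<dots> = outer (A \<inter> (X \<inter> U)) + outer (A - X \<inter> U)" by (simp add: B_def eval_nat_numeral)
  finally show "outer A \<le> outer (A \<inter> (X \<inter> U)) + outer (A - X \<inter> U)" .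
qed

section \<open>The representing measure and its integral\<close>

definition rep_measure :: "'a measure" where
  "rep_measure = measure_of X (sets (restrict_space borel X)) outer"

lemma sets_rep_measure: "sets rep_measure = sets (restrict_space borel X)"
  and emeasure_rep_measure: "A \<in> sets (restrict_space borel X) \<Longrightarrow> emeasure rep_measure A = outer A"
proof -
  let ?M = "sets (restrict_space borel X)"
  interpret P: sigma_algebra X "Pow X" by (rule sigma_algebra_Pow)
  have ms: "measure_space X (lambda_system X (Pow X) outer) outer"
    by (rule P.caratheodory_lemma[OF outer_measure])
  then interpret S: sigma_algebra X "lambda_system X (Pow X) outer" by (simp add: measure_space_def)
  have sa: "sigma_algebra X ?M"
    using sets.sigma_algebra_axioms[of "restrict_space borel X"] by (simp add: space_restrict_space)
  \<comment> \<open>The Caratheodory sets form a sigma algebra, so it is enough that it contains the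
    open sets.\<close>
  have bor: "X \<inter> A \<in> lambda_system X (Pow X) outer" if "A \<in> sets borel" for A
  proof -
    have "A \<in> sigma_sets UNIV {S. open S}" using that by (simp add: borel_def)
    then show ?thesis
    proof (induction rule: sigma_sets.induct)
      case (Basic a)
      then show ?case using open_caratheodory[of a] by (auto simp: P.lambda_system_eq)
    next
      case Empty
      then show ?case by simp
    next
      case (Compl a)
      have "X \<inter> (UNIV - a) = X - X \<inter> a" by auto
      then show ?case using S.compl_sets[OF Compl.IH] by simp
    next
      case (Union a)
      have "X \<inter> (\<Union>i. a i) = (\<Union>i. X \<inter> a i)" by auto
      then show ?case using S.countable_UN[of "\<lambda>i. X \<inter> a i" UNIV] Union.IH by auto
    qed
  qed
  have "?M \<subseteq> lambda_system X (Pow X) outer"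
    using bor by (auto simp: sets_restrict_space)
  from measure_down[OF ms sa this] have *: "measure_space X ?M outer" .
  show "sets rep_measure = ?M"
    unfolding rep_measure_def using sa by (simp add: sigma_algebra.sets_measure_of_eq)
  show "A \<in> ?M \<Longrightarrow> emeasure rep_measure A = outer A"
    unfolding rep_measure_def
    using * by (intro emeasure_measure_of_sigma) (auto simp: measure_space_def)
qed

lemma space_rep_measure: "space rep_measure = X"
  using sets_eq_imp_space_eq[OF sets_rep_measure] by (simp add: space_restrict_space)

lemma prob_space_rep_measure: "prob_space rep_measure"
proof
  have "X \<in> sets (restrict_space borel X)"
    by (metis sets.top space_restrict_space Int_UNIV_right space_borel)
  then show "emeasure rep_measure (space rep_measure) = 1"
    by (simp add: space_rep_measure emeasure_rep_measure outer_X)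
qed

lemma measurable_rep: "continuous_on X g \<Longrightarrow> g \<in> borel_measurable rep_measure" for g :: "'a \<Rightarrow> real"
  using borel_measurable_continuous_on_restrict[of X g] measurable_cong_sets[OF sets_rep_measure refl]
  by blast

lemma bounded_cont: 
  assumes "continuous_on X g" obtains B :: real where "B > 0" "\<And>x. x \<in> X \<Longrightarrow> \<bar>g x\<bar> \<le> B"
proof -
  have "bounded (g ` X)" using compact_continuous_image[OF assms compact_X] by (rule compact_imp_bounded)
  then obtain B where "B > 0" "\<forall>x\<in>g ` X. norm x \<le> B" unfolding bounded_pos by blast
  then show ?thesis using that by auto
qed

lemma integrable_rep:
  fixes g :: "'a \<Rightarrow> real"
  assumes "continuous_on X g" shows "integrable rep_measure g"
proof -
  interpret prob_space rep_measure by (rule prob_space_rep_measure)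
  obtain B where B: "\<And>x. x \<in> X \<Longrightarrow> \<bar>g x\<bar> \<le> B" using bounded_cont[OF assms] by blast
  show ?thesis
    by (rule integrable_const_bound[of _ B]) (auto simp: space_rep_measure B measurable_rep assms intro!: AE_I2)
qed

text \<open>The k-th summand is the part of \<open>y\<close> between the levels k and k + 1; applied
  to \<open>n * g\<close> these layers link \<open>L\<close> to the measure.\<close>

lemma sum_clip: "0 \<le> y \<Longrightarrow> y \<le> real n \<Longrightarrow> (\<Sum>k<n. min (max (y - real k) 0) 1) = y"
proof (induction n arbitrary: y)
  case (Suc n)
  show ?case
  proof (cases "y \<le> real n")
    case True
    then show ?thesis using Suc by simp
  next
    case False
    have "(\<Sum>k<n. min (max (y - real k) 0) 1) = (\<Sum>k<n. 1)"
      using False by (intro sum.cong) auto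
    then show ?thesis using False Suc.prems by simp
  qed
qed simp

lemma sum_indicator_le: "0 \<le> y \<Longrightarrow> (\<Sum>k<n. if real k < y then 1 else 0) \<le> y + 1"
proof (induction n)
  case (Suc n)
  show ?case
  proof (cases "real n < y")
    case True
    have "(\<Sum>k<Suc n. if real k < y then 1 else 0) \<le> (\<Sum>k<Suc n. 1 :: real)" by (intro sum_mono) auto
    then show ?thesis using True by simp
  qed (use Suc in simp)
qed simp

text \<open>Layer cake: \<open>n * g\<close> is cut into \<open>n\<close> layers, each a bump of an
  open superlevel set, so \<open>L\<close> of a layer is at most the measure of that set. The
  indicators of these sets sum to at most \<open>n * g + 1\<close>, and the excess disappears on
  division by \<open>n\<close>.\<close>

lemma L_le_integral:
  assumes g: "continuous_on X g" "\<And>x. x \<in> X \<Longrightarrow> 0 \<le> g x \<and> g x \<le> 1"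
  shows "L g \<le> integral\<^sup>L rep_measure g"
proof -
  interpret prob_space rep_measure by (rule prob_space_rep_measure)
  have main: "L g \<le> integral\<^sup>L rep_measure g + 1 / real n" if n: "n > 0" for n :: nat
  proof -
    define f where "f k x = min (max (real n * g x - real k) 0) 1" for k x
    define E where "E k = {x\<in>X. real k < real n * g x}" for k
    have fc: "continuous_on X (f k)" for k unfolding f_def using g(1) by (intro continuous_intros)
    have LE: "L (f k) \<le> prob (E k)" and Em: "E k \<in> sets rep_measure" for k
    proof -
      have "openin (top_of_set X) (X \<inter> (\<lambda>x. real n * g x) -` {real k<..})"
        using g(1) by (intro continuous_openin_preimage_gen continuous_intros) auto
      moreover have "X \<inter> (\<lambda>x. real n * g x) -` {real k<..} = E k" by (auto simp: E_def)
      ultimately obtain U where U: "open U" "E k = X \<inter> U" by (auto simp: openin_open)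
      show m: "E k \<in> sets rep_measure"
        using U by (auto simp: sets_rep_measure sets_restrict_space)
      have "f k \<in> bumps U" using U(2) fc by (auto simp: bumps_def f_def E_def max_def not_less)
      then have "ennreal (L (f k)) \<le> emeasure rep_measure (E k)"
        using bump_le_cap U m by (simp add: emeasure_rep_measure flip: sets_rep_measure) (simp add: outer_open)
      then show "L (f k) \<le> prob (E k)" by (simp add: emeasure_eq_measure)
    qed
    have "real n * L g = L (\<lambda>x. real n * g x)" using g(1) by (simp add: scale)
    also have "\<dots> \<le> L (\<lambda>x. \<Sum>k<n. f k x)"
      using g fc sum_clip by (intro mono continuous_intros) (auto simp: f_def mult_left_le)
    also have "\<dots> = (\<Sum>k<n. L (f k))" using fc by (intro sum) auto
    also have "\<dots> \<le> (\<Sum>k<n. prob (E k))" by (intro sum_mono LE)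
    also have "\<dots> = (\<Sum>k<n. integral\<^sup>L rep_measure (indicator (E k)))"
      using Em by simp
    also have "\<dots> = integral\<^sup>L rep_measure (\<lambda>x. \<Sum>k<n. indicator (E k) x)"
      using Em by (subst Bochner_Integration.integral_sum) (auto simp: emeasure_eq_measure)
    also have "\<dots> \<le> integral\<^sup>L rep_measure (\<lambda>x. real n * g x + 1)"
    proof (rule integral_mono)
      show "integrable rep_measure (\<lambda>x. \<Sum>k<n. indicator (E k) x :: real)"
        using Em by (intro Bochner_Integration.integrable_sum) (auto simp: emeasure_eq_measure)
      show "integrable rep_measure (\<lambda>x. real n * g x + 1)" using integrable_rep[OF g(1)] by simp
    next
      fix x assume "x \<in> space rep_measure"
      then have x: "x \<in> X" by (simp add: space_rep_measure)
      then have "(\<Sum>k<n. indicator (E k) x) = (\<Sum>k<n. if real k < real n * g x then 1 else 0 :: real)"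
        by (intro sum.cong) (auto simp: E_def)
      then show "(\<Sum>k<n. indicator (E k) x) \<le> real n * g x + 1"
        using sum_indicator_le[of "real n * g x" n] g(2)[OF x] by simp
    qed
    also have "\<dots> = real n * integral\<^sup>L rep_measure g + 1"
      using integrable_rep[OF g(1)] by (simp add: prob_space)
    finally show ?thesis using n by (simp add: field_simps)
  qed
  show ?thesis
  proof (rule field_le_epsilon)
    fix e :: real assume "e > 0"
    then obtain n :: nat where n: "n > 0" "1 / real n < e" using real_arch_inverse[of e] by (auto simp: inverse_eq_divide)
    show "L g \<le> integral\<^sup>L rep_measure g + e" using main[OF n(1)] n(2) by linarith
  qed
qed

theorem integral_rep_measure:
  assumes g: "continuous_on X g"
  shows "integral\<^sup>L rep_measure g = L g"
proof -
  interpret prob_space rep_measure by (rule prob_space_rep_measure)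
  have le: "L g \<le> integral\<^sup>L rep_measure g" if g: "continuous_on X g" for g
  proof -
    obtain B where B: "B > 0" "\<And>x. x \<in> X \<Longrightarrow> \<bar>g x\<bar> \<le> B" using bounded_cont[OF g] by blast
    \<comment> \<open>\<open>h\<close> moves \<open>g\<close> into the range from 0 to 1 demanded by
      \<open>L_le_integral\<close>; the reverse inequality will come from
      \<open>- g\<close>.\<close>
    define h where "h x = 1 / (2 * B) * g x + 1 / 2" for x
    have hc: "continuous_on X h" unfolding h_def using g by (intro continuous_intros)
    have gc: "continuous_on X (\<lambda>x. 1 / (2 * B) * g x)" using g by (intro continuous_intros)
    have "L h \<le> integral\<^sup>L rep_measure h"
    proof (rule L_le_integral[OF hc])
      fix x assume "x \<in> X"
      then have "\<bar>g x\<bar> \<le> B" by (rule B)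
      then show "0 \<le> h x \<and> h x \<le> 1" using B(1) by (simp add: h_def field_simps abs_le_iff)
    qed
    also have "\<dots> = 1 / (2 * B) * integral\<^sup>L rep_measure g + 1 / 2"
      using integrable_rep[OF g] unfolding h_def by (simp add: prob_space)
    also have "L h = 1 / (2 * B) * L g + 1 / 2"
      unfolding h_def using gc by (subst add) (auto simp: const scale[OF g, of "1 / (2 * B)", simplified])
    finally show ?thesis using B(1) by (simp add: field_simps)
  qed
  have "L (\<lambda>x. - g x) \<le> integral\<^sup>L rep_measure (\<lambda>x. - g x)" using g by (intro le continuous_intros)
  then have "integral\<^sup>L rep_measure g \<le> L g" using g by (simp add: uminus)
  then show ?thesis using le[OF g] by simp
qed

end

section \<open>Unique ergodicity and limits of averages\<close>

text \<open>Indicators of closed sets are limits of continuous functions of the distance, so the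
  integrals determine the measure on closed sets, an intersection-stable generator.\<close>

lemma prob_measure_eqI:
  fixes X :: "'a::metric_space set"
  assumes X: "compact X" and "prob_space M" "prob_space M'"
    and sets: "sets M = sets (restrict_space borel X)" "sets M' = sets (restrict_space borel X)"
    and eq: "\<And>g :: 'a \<Rightarrow> real. continuous_on X g \<Longrightarrow> integral\<^sup>L M g = integral\<^sup>L M' g"
  shows "M = M'"
proof -
  interpret M: prob_space M by fact
  interpret M': prob_space M' by fact
  have sp: "space M = X" "space M' = X"
    using sets_eq_imp_space_eq[OF sets(1)] sets_eq_imp_space_eq[OF sets(2)] by (auto simp: space_restrict_space)
  have Xb: "X \<in> sets borel" using compact_imp_closed[OF X] by simp
  have gen: "sets (restrict_space borel X) = sigma_sets X ((\<inter>) X ` Collect closed)"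
  proof -
    have b: "sets (borel :: 'a measure) = sigma_sets UNIV (Collect closed)" by (simp add: borel_eq_closed)
    show ?thesis unfolding sets_restrict_space
      using sigma_sets_Int[of X UNIV "Collect closed"] Xb b by simp
  qed
  have cl: "emeasure M K = emeasure M' K" if K: "closed K" "K \<subseteq> X" for K
  \<comment> \<open>\<open>infdist x {} = 0\<close> would make the approximations constantly 1, so
    the empty set is treated apart.\<close>
  proof (cases "K = {}")
    case False
    define \<phi> where "\<phi> n x = max 0 (1 - real n * infdist x K)" for n x
    have c: "continuous_on X (\<phi> n)" for n unfolding \<phi>_def by (intro continuous_intros)
    have lim: "(\<lambda>n. integral\<^sup>L N (\<phi> n)) \<longlonglongrightarrow> measure N K"
      if "prob_space N" "sets N = sets (restrict_space borel X)" for N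
    proof -
      interpret N: prob_space N by fact
      have spN: "space N = X" using sets_eq_imp_space_eq[OF that(2)] by (auto simp: space_restrict_space)
      have KN: "K \<in> sets N" using K that(2) by (auto simp: sets_restrict_space intro!: image_eqI[of _ _ K])
      have "(\<lambda>n. integral\<^sup>L N (\<phi> n)) \<longlonglongrightarrow> integral\<^sup>L N (indicator K)"
      proof (rule integral_dominated_convergence[where w = "\<lambda>_. 1"])
        show "AE x in N. (\<lambda>n. \<phi> n x) \<longlonglongrightarrow> indicator K x"
        proof (rule AE_I2)
          fix x
          show "(\<lambda>n. \<phi> n x) \<longlonglongrightarrow> indicator K x"
          proof (cases "x \<in> K")
            case True
            then show ?thesis by (simp add: \<phi>_def)
          next
            case False2: False
            then have pos: "infdist x K > 0"
              using in_closed_iff_infdist_zero[OF K(1) False] infdist_nonneg[of x K] by force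
            obtain n0 :: nat where n0: "1 / infdist x K < real n0" using reals_Archimedean2 by blast
            have "\<forall>\<^sub>F n in sequentially. \<phi> n x = 0"
              using eventually_ge_at_top[of n0]
            proof eventually_elim
              case (elim n)
              then have "1 / infdist x K < real n" using n0 by linarith
              then have "1 < real n * infdist x K" using pos by (simp add: field_simps)
              then show ?case by (simp add: \<phi>_def)
            qed
            then show ?thesis using False2 by (simp add: tendsto_eventually)
          qed
        qed
        show "\<phi> n \<in> borel_measurable N" for n
          using borel_measurable_continuous_on_restrict[OF c] measurable_cong_sets[OF that(2) refl] by blast
        show "AE x in N. norm (\<phi> n x) \<le> 1" for n
          by (rule AE_I2) (simp add: \<phi>_def infdist_nonneg)
      qed (use KN in auto)
      then show ?thesis using KN by simp
    qed
    have "measure M K = measure M' K"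
      using LIMSEQ_unique[OF lim[OF assms(2) sets(1)]] lim[OF assms(3) sets(2)] eq[OF c] by simp
    then show ?thesis by (simp add: M.emeasure_eq_measure M'.emeasure_eq_measure)
  qed simp
  show ?thesis
  proof (rule measure_eqI_generator_eq[where E = "(\<inter>) X ` Collect closed" and \<Omega> = X and A = "\<lambda>_. X"])
    show "Int_stable ((\<inter>) X ` Collect closed)"
      proof (rule Int_stableI)
      fix a b assume "a \<in> (\<inter>) X ` Collect closed" "b \<in> (\<inter>) X ` Collect closed"
      then obtain C D where "closed C" "closed D" "a = X \<inter> C" "b = X \<inter> D" by auto
      then have "closed (C \<inter> D)" "a \<inter> b = X \<inter> (C \<inter> D)" by auto
      then show "a \<inter> b \<in> (\<inter>) X ` Collect closed" by blast
    qed
    show "(\<inter>) X ` Collect closed \<subseteq> Pow X" by auto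
    show "emeasure M K = emeasure M' K" if "K \<in> (\<inter>) X ` Collect closed" for K
      using that compact_imp_closed[OF X] by (intro cl) auto
    show "range (\<lambda>_::nat. X) \<subseteq> (\<inter>) X ` Collect closed" by (auto intro!: image_eqI[of _ _ UNIV])
  qed (use gen sets M.emeasure_space_1 sp in auto)
qed

text \<open>If the averages stayed away from the integral for infinitely many \<open>N\<close>, a
  limit functional along a filter living on these \<open>N\<close> would be
  \<open>T\<close>-invariant and hence integration against \<open>\<mu>\<close>, a contradiction.
  Compactness of a product of intervals supplies the limit for all test functions at once.\<close>

lemma uniquely_ergodic_average:
  fixes X :: "'a::metric_space set" and y :: "nat \<Rightarrow> 'a" and g :: "'a \<Rightarrow> real"
  assumes X: "compact X" and T: "T ` X \<subseteq> X" "continuous_on X T"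
    and ue: "uniquely_ergodic X T" "invariant_borel_prob X T \<mu>"
    and y: "\<And>n. y n \<in> X"
    and inv: "\<And>g :: 'a \<Rightarrow> real. continuous_on X g \<Longrightarrow>
        (\<lambda>N. (\<Sum>n=1..N. g (T (y n)) - g (y n)) / real N) \<longlonglongrightarrow> 0"
    and g: "continuous_on X g"
  shows "(\<lambda>N. (\<Sum>n=1..N. g (y n)) / real N) \<longlonglongrightarrow> integral\<^sup>L \<mu> g"
proof (rule ccontr)
  assume "\<not> ?thesis"
  then obtain e where e: "e > 0"
    "\<not> (\<forall>\<^sub>F N in sequentially. dist ((\<Sum>n=1..N. g (y n)) / real N) (integral\<^sup>L \<mu> g) < e)"
    by (auto simp: tendsto_iff)
  define S where "S = {N. N > 0 \<and> dist ((\<Sum>n=1..N. g (y n)) / real N) (integral\<^sup>L \<mu> g) \<ge> e}"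
  define F where "F = inf sequentially (principal S)"
  have "F \<noteq> bot"
  proof
    assume "F = bot"
    then have "\<forall>\<^sub>F N in sequentially. N \<notin> S" by (simp add: F_def trivial_limit_def eventually_inf_principal)
    then have "\<forall>\<^sub>F N in sequentially. dist ((\<Sum>n=1..N. g (y n)) / real N) (integral\<^sup>L \<mu> g) < e"
      using eventually_gt_at_top[of 0] by eventually_elim (auto simp: S_def)
    with e(2) show False by blast
  qed
  have FS: "\<forall>\<^sub>F N in F. N \<in> S" by (simp add: F_def eventually_inf_principal)
  have Fseq: "F \<le> sequentially" by (simp add: F_def)
  \<comment> \<open>The value 0 at discontinuous \<open>h\<close> keeps \<open>avg N\<close> inside
    a product of compact intervals indexed by all functions.\<close>
  define avg where "avg N h = (if continuous_on X h then (\<Sum>n=1..N. h (y n)) / real N else 0)"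
    for N and h :: "'a \<Rightarrow> real"
  have "\<exists>B. continuous_on X h \<longrightarrow> (\<forall>x\<in>X. \<bar>h x\<bar> \<le> B)" for h :: "'a \<Rightarrow> real"
  proof (cases "continuous_on X h")
    case True
    then have "bounded (h ` X)" using compact_continuous_image X compact_imp_bounded by blast
    then show ?thesis by (auto simp: bounded_iff)
  qed simp
  then obtain B where B: "\<And>h x. continuous_on X h \<Longrightarrow> x \<in> X \<Longrightarrow> \<bar>h x\<bar> \<le> (B h :: real)" by metis
  define K where "K = PiE UNIV (\<lambda>h. {-\<bar>B h\<bar>..\<bar>B h\<bar>})"
  have "compactin (product_topology (\<lambda>_. euclidean) UNIV) K"
    unfolding K_def by (subst compactin_PiE) (simp add: compactin_euclidean_iff)
  then have K: "compact K" by (simp add: euclidean_product_topology compactin_euclidean_iff)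
  have avgK: "avg N \<in> K" for N
  proof -
    have "\<bar>avg N h\<bar> \<le> \<bar>B h\<bar>" for h
    proof (cases "continuous_on X h \<and> N > 0")
      case True
      have "\<bar>\<Sum>n=1..N. h (y n)\<bar> \<le> (\<Sum>n=1..N. \<bar>B h\<bar>)"
        using B[of h] True y by (intro order_trans[OF sum_abs] sum_mono) (meson abs_ge_self order_trans)
      then show ?thesis using True by (simp add: avg_def field_simps)
    qed (auto simp: avg_def)
    then have "avg N h \<in> {-\<bar>B h\<bar>..\<bar>B h\<bar>}" for h by (simp add: abs_le_iff minus_le_iff)
    then show ?thesis unfolding K_def by blast
  qed
  have "filtermap avg F \<noteq> bot" using \<open>F \<noteq> bot\<close> by (simp add: filtermap_bot_iff)
  moreover have "\<forall>\<^sub>F h in filtermap avg F. h \<in> K" by (simp add: eventually_filtermap avgK)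
  ultimately obtain L where L: "inf (nhds L) (filtermap avg F) \<noteq> bot"
    using K unfolding compact_filter by blast
  \<comment> \<open>A cluster point of the image filter becomes a filter \<open>G\<close>, finer
    than \<open>F\<close>, along which \<open>avg\<close> really converges to \<open>L\<close>; in
    such a product subsequences need not suffice.\<close>
  define G where "G = inf (filtercomap avg (nhds L)) F"
  have G: "G \<noteq> bot"
  proof
    assume "G = bot"
    then obtain P Q where P: "eventually P (filtercomap avg (nhds L))" and Q: "eventually Q F" and PQ: "\<And>x. P x \<and> Q x \<Longrightarrow> False"
      by (auto simp: G_def trivial_limit_def eventually_inf)
    from P obtain P' where P': "eventually P' (nhds L)" "\<And>x. P' (avg x) \<Longrightarrow> P x"
      by (auto simp: eventually_filtercomap)
    have "eventually (\<lambda>h. \<not> P' h) (filtermap avg F)"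
      unfolding eventually_filtermap using Q by eventually_elim (use PQ P' in blast)
    then have "eventually (\<lambda>_. False) (inf (nhds L) (filtermap avg F))"
      unfolding eventually_inf using P'(1) by (intro exI[of _ P'] exI[of _ "\<lambda>h. \<not> P' h"]) auto
    then show False using L by (simp add: trivial_limit_def)
  qed
  have GS: "\<forall>\<^sub>F N in G. N \<in> S" using FS by (rule filter_leD[rotated]) (simp add: G_def)
  have Gseq: "G \<le> sequentially" using Fseq by (simp add: G_def le_infI2)
  have lim: "((\<lambda>N. avg N h) \<longlongrightarrow> L h) G" for h
  proof -
    have "filterlim avg (nhds L) G"
      by (rule filterlim_mono[OF filterlim_filtercomap order_refl]) (simp add: G_def)
    then have "(avg \<longlongrightarrow> L) G" .
    from continuous_on_tendsto_compose[OF continuous_on_product_coordinates[of h] this]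
    show ?thesis by simp
  qed
  interpret mean_functional X L
  proof
    fix h h' :: "'a \<Rightarrow> real" assume h: "continuous_on X h" "continuous_on X h'"
    have "((\<lambda>N. avg N h + avg N h') \<longlongrightarrow> L h + L h') G" by (intro tendsto_add lim)
    moreover have "avg N h + avg N h' = avg N (\<lambda>x. h x + h' x)" for N
      using h continuous_on_add[OF h] by (simp add: avg_def sum.distrib add_divide_distrib)
    ultimately show "L (\<lambda>x. h x + h' x) = L h + L h'"
      using tendsto_unique[OF G lim] by simp
  next
    fix h :: "'a \<Rightarrow> real" and c assume h: "continuous_on X h"
    have "((\<lambda>N. c * avg N h) \<longlongrightarrow> c * L h) G" by (intro tendsto_mult tendsto_const lim)
    moreover have "c * avg N h = avg N (\<lambda>x. c * h x)" for N
      using h continuous_on_mult[OF continuous_on_const h, of c] by (simp add: avg_def sum_distrib_left)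
    ultimately show "L (\<lambda>x. c * h x) = c * L h"
      using tendsto_unique[OF G lim] by simp
  next
    fix h :: "'a \<Rightarrow> real" assume h: "continuous_on X h" "\<And>x. x \<in> X \<Longrightarrow> 0 \<le> h x"
    show "0 \<le> L h"
      by (rule tendsto_lowerbound[OF lim _ G])
         (auto simp: avg_def h y intro!: always_eventually divide_nonneg_nonneg sum_nonneg)
  next
    have "\<forall>\<^sub>F N in G. avg N (\<lambda>x. 1) = 1"
      using GS by eventually_elim (auto simp: avg_def S_def)
    then have "((\<lambda>N. avg N (\<lambda>x. 1)) \<longlongrightarrow> 1) G" by (rule tendsto_eventually)
    then show "L (\<lambda>x. 1) = 1" using tendsto_unique[OF G lim] by blast
  qed (rule X)
  have LT: "L (\<lambda>x. h (T x)) = L h" if h: "continuous_on X h" for h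
  proof -
    have hT: "continuous_on X (\<lambda>x. h (T x))"
      using continuous_on_compose2[OF h T(2) T(1)] .
    have "((\<lambda>N. avg N (\<lambda>x. h (T x)) - avg N h) \<longlongrightarrow> L (\<lambda>x. h (T x)) - L h) G" by (intro tendsto_diff lim)
    moreover have "avg N (\<lambda>x. h (T x)) - avg N h = (\<Sum>n=1..N. h (T (y n)) - h (y n)) / real N" for N
      using h hT by (simp add: avg_def sum_subtractf diff_divide_distrib)
    ultimately have "((\<lambda>N. (\<Sum>n=1..N. h (T (y n)) - h (y n)) / real N) \<longlongrightarrow> L (\<lambda>x. h (T x)) - L h) G" by simp
    moreover have "((\<lambda>N. (\<Sum>n=1..N. h (T (y n)) - h (y n)) / real N) \<longlongrightarrow> 0) G"
      by (rule tendsto_mono[OF Gseq inv[OF h]])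
    ultimately show ?thesis using tendsto_unique[OF G] by fastforce
  qed
  have Tm: "T \<in> measurable rep_measure rep_measure"
  proof -
    have "T \<in> restrict_space borel X \<rightarrow>\<^sub>M restrict_space borel X"
      using T by (intro measurable_restrict_space2 borel_measurable_continuous_on_restrict) (auto simp: space_restrict_space)
    then show ?thesis using measurable_cong_sets[OF sets_rep_measure sets_rep_measure] by blast
  qed
  have "distr rep_measure rep_measure T = rep_measure"
  proof (rule prob_measure_eqI[OF X])
    show "prob_space (distr rep_measure rep_measure T)"
      by (rule prob_space.prob_space_distr[OF prob_space_rep_measure Tm])
    fix h :: "'a \<Rightarrow> real" assume h: "continuous_on X h"
    have hT: "continuous_on X (\<lambda>x. h (T x))"
      using continuous_on_compose2[OF h T(2) T(1)] .
    have "integral\<^sup>L (distr rep_measure rep_measure T) h = integral\<^sup>L rep_measure (\<lambda>x. h (T x))"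
      by (rule integral_distr[OF Tm measurable_rep[OF h]])
    then show "integral\<^sup>L (distr rep_measure rep_measure T) h = integral\<^sup>L rep_measure h"
      using LT[OF h] by (simp add: integral_rep_measure h hT)
  qed (simp_all add: sets_rep_measure prob_space_rep_measure)
  then have "invariant_borel_prob X T rep_measure"
    unfolding invariant_borel_prob_def
    using sets_rep_measure prob_space_rep_measure emeasure_distr[OF Tm] by (metis space_rep_measure)
  then have "rep_measure = \<mu>" using ue unfolding uniquely_ergodic_def by blast
  then have "L g = integral\<^sup>L \<mu> g" using integral_rep_measure[OF g] by simp
  then have "\<forall>\<^sub>F N in G. dist (avg N g) (integral\<^sup>L \<mu> g) < e"
    using lim[of g] e(1) by (auto simp: tendsto_iff)
  then have "\<forall>\<^sub>F N in G. False"
    using GS by eventually_elim (use g in \<open>auto simp: S_def avg_def\<close>)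
  then show False using G by (simp add: trivial_limit_def)
qed

section \<open>The dual Turan--Kubilius inequality\<close>

lemma card_dvd_atLeastAtMost:
  fixes d N :: nat
  assumes "d > 0"
  shows "card {n\<in>{1..N}. d dvd n} = N div d"
proof -
  have "bij_betw (\<lambda>k. d * k) {1..N div d} {n\<in>{1..N}. d dvd n}"
  proof (rule bij_betwI[where g = "\<lambda>n. n div d"])
    show "(\<lambda>k. d * k) \<in> {1..N div d} \<rightarrow> {n\<in>{1..N}. d dvd n}"
      using assms by (auto simp: less_eq_div_iff_mult_less_eq ac_simps Suc_le_eq)
    show "(\<lambda>n. n div d) \<in> {n\<in>{1..N}. d dvd n} \<rightarrow> {1..N div d}"
      using assms by (auto simp: div_le_mono Suc_le_eq div_greater_zero_iff dest: dvd_imp_le)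
  qed (use assms in auto)
  from bij_betw_same_card[OF this] show ?thesis by simp
qed

lemma sum_multiples:
  fixes f :: "nat \<Rightarrow> real"
  assumes "p > 0"
  shows "(\<Sum>n=1..N. if p dvd n then f n else 0) = (\<Sum>n=1..N div p. f (p * n))"
proof -
  have "(\<Sum>n=1..N div p. f (p * n)) = (\<Sum>n\<in>{n\<in>{1..N}. p dvd n}. f n)"
  proof (rule sum.reindex_bij_witness[where i = "\<lambda>n. n div p" and j = "\<lambda>k. p * k"])
  qed (use assms in \<open>auto simp: less_eq_div_iff_mult_less_eq mult.commute Suc_le_eq div_le_mono dvd_def\<close>)
  also have "\<dots> = (\<Sum>n=1..N. if p dvd n then f n else 0)"
    using sum.inter_filter[of "{1..N}" f "\<lambda>n. p dvd n"] by simp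
  finally show ?thesis by simp
qed

lemma floor_div_bounds:
  fixes N d :: nat
  assumes "d > 0"
  shows "real (N div d) \<le> real N / real d" "real (N div d) \<ge> real N / real d - 1"
proof -
  show "real (N div d) \<le> real N / real d" by (rule of_nat_div_le_of_nat)
  have "N < d * (N div d) + d" using mult_div_mod_eq[of d N] mod_less_divisor[OF assms, of N] by linarith
  then have "real N < real (d * (N div d) + d)" by (simp only: of_nat_less_iff)
  then show "real (N div d) \<ge> real N / real d - 1" using assms by (simp add: field_simps)
qed

text \<open>The indicator of \<open>p dvd n\<close> centred at its mean, with the sign that matches
  the difference in the dual inequality.\<close>

definition dvd_dev :: "nat \<Rightarrow> nat \<Rightarrow> real" where
  "dvd_dev p n = 1 / real p - (if p dvd n then 1 else 0)"

text \<open>Near orthogonality: for \<open>p \<noteq> q\<close> the four main terms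
  \<open>N / (p * q)\<close> cancel, and only rounding errors between \<open>-1\<close> and
  \<open>1 / p + 1 / q\<close> survive.\<close>

lemma sum_dvd_dev_mult:
  fixes p q N :: nat
  assumes "prime p" "prime q"
  shows "\<bar>\<Sum>n=1..N. dvd_dev p n * dvd_dev q n\<bar> \<le> (if p = q then real N / real p else 2)"
proof -
  have pq: "p > 0" "q > 0" "p \<ge> 2" "q \<ge> 2" using assms by (auto simp: prime_gt_0_nat prime_ge_2_nat)
  have cnt: "(\<Sum>n=1..N. if d dvd n then 1 else 0 :: real) = real (N div d)" if "d > 0" for d
    using card_dvd_atLeastAtMost[OF that, of N]
    by (subst sum.inter_filter[symmetric]) auto
  have eq: "(\<Sum>n=1..N. dvd_dev p n * dvd_dev q n) =
     real N / (real p * real q) - real (N div q) / real p - real (N div p) / real q +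
     (\<Sum>n=1..N. if p dvd n \<and> q dvd n then 1 else 0)"
  proof -
    have "(\<Sum>n=1..N. dvd_dev p n * dvd_dev q n) =
      (\<Sum>n=1..N. 1 / (real p * real q) - (if q dvd n then 1 else 0) / real p
         - (if p dvd n then 1 else 0) / real q + (if p dvd n \<and> q dvd n then 1 else 0))"
      by (intro sum.cong refl) (auto simp: dvd_dev_def algebra_simps)
    also have "\<dots> = real N / (real p * real q)
       - (\<Sum>n=1..N. if q dvd n then 1 else 0) / real p
       - (\<Sum>n=1..N. if p dvd n then 1 else 0) / real q
       + (\<Sum>n=1..N. if p dvd n \<and> q dvd n then 1 else 0)"
      by (simp add: sum.distrib sum_subtractf sum_divide_distrib)
    finally show ?thesis using cnt pq by simp
  qed
  show ?thesis
  proof (cases "p = q")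
    case True
    have "(\<Sum>n=1..N. dvd_dev p n * dvd_dev q n) =
       real N / (real p * real p) + real (N div p) * (1 - 2 / real p)"
      using eq cnt[of p] pq True by (simp add: algebra_simps)
    also have "\<dots> \<le> real N / (real p * real p) + (real N / real p) * (1 - 2 / real p)"
      using pq by (intro add_left_mono mult_right_mono floor_div_bounds) auto
    also have "\<dots> \<le> real N / real p"
      using pq by (simp add: field_simps)
    finally show ?thesis using True by (simp add: sum_nonneg)
  next
    case False
    have cop: "coprime p q" using assms False by (simp add: primes_coprime)
    have "(\<Sum>n=1..N. if p dvd n \<and> q dvd n then 1 else 0 :: real) = real (N div (p * q))"
    proof -
      have "p dvd n \<and> q dvd n \<longleftrightarrow> p * q dvd n" for n
        using cop by (meson divides_mult dvd_mult_left dvd_mult_right)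
      then show ?thesis using cnt[of "p * q"] pq by simp
    qed
    then have eq': "(\<Sum>n=1..N. dvd_dev p n * dvd_dev q n) =
     real N / (real p * real q) - real (N div q) / real p - real (N div p) / real q + real (N div (p * q))"
      using eq by simp
    have "real N / (real p * real q) - (real N / real q) / real p - (real N / real p) / real q
        + (real N / real (p * q) - 1) \<le> (\<Sum>n=1..N. dvd_dev p n * dvd_dev q n)"
      unfolding eq' using pq by (intro add_mono diff_mono divide_right_mono floor_div_bounds) auto
    then have lower: "- 1 \<le> (\<Sum>n=1..N. dvd_dev p n * dvd_dev q n)"
      using pq by (simp add: field_simps)
    note eq'
    also have "real N / (real p * real q) - real (N div q) / real p - real (N div p) / real q + real (N div (p * q))
      \<le> real N / (real p * real q) - (real N / real q - 1) / real p
        - (real N / real p - 1) / real q + real N / real (p * q)"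
      using pq by (intro add_mono diff_mono divide_right_mono floor_div_bounds) auto
    also have "\<dots> = 1 / real p + 1 / real q" using pq by (simp add: field_simps)
    also have "\<dots> \<le> 1 + 1" using pq by (intro add_mono) simp_all
    finally show ?thesis using False lower by auto
  qed
qed

text \<open>Duality: exchanging the sums turns the left side into the correlation of
  \<open>f\<close> with \<open>g\<close>, a combination of the \<open>dvd_dev p\<close>.
  Cauchy-Schwarz and near orthogonality bound it: the diagonal gives the sum of
  \<open>1 / p\<close>, the rounding errors of all pairs give the second term.\<close>

lemma turan_kubilius_dual:
  fixes f \<sigma> :: "nat \<Rightarrow> real" and B :: "nat set"
  assumes B: "finite B" "\<And>p. p \<in> B \<Longrightarrow> prime p"
    and f: "\<And>n. \<bar>f n\<bar> \<le> 1" and \<sigma>: "\<And>p. \<bar>\<sigma> p\<bar> \<le> 1" and N: "N > 0"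
  shows "(\<Sum>p\<in>B. \<sigma> p / real p * ((\<Sum>n=1..N. f n) - real p * (\<Sum>n=1..N div p. f (p * n))) / real N)\<^sup>2
           \<le> (\<Sum>p\<in>B. 1 / real p) + 2 * (real (card B))\<^sup>2 / real N"
proof -
  have pos: "p > 0" if "p \<in> B" for p using B(2)[OF that] by (simp add: prime_gt_0_nat)
  define g where "g n = (\<Sum>p\<in>B. \<sigma> p * dvd_dev p n)" for n
  have "(\<Sum>p\<in>B. \<sigma> p / real p * ((\<Sum>n=1..N. f n) - real p * (\<Sum>n=1..N div p. f (p * n))) / real N)
      = (\<Sum>p\<in>B. (\<Sum>n=1..N. f n * (\<sigma> p * dvd_dev p n)) / real N)"
  proof (intro sum.cong refl arg_cong[where f = "\<lambda>x. x / real N"])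
    fix p assume p: "p \<in> B"
    have "(\<Sum>n=1..N. f n * (\<sigma> p * dvd_dev p n)) =
        (\<Sum>n=1..N. \<sigma> p / real p * f n - \<sigma> p * (if p dvd n then f n else 0))"
      by (intro sum.cong refl) (auto simp: dvd_dev_def algebra_simps)
    also have "\<dots> = \<sigma> p / real p * (\<Sum>n=1..N. f n) - \<sigma> p * (\<Sum>n=1..N div p. f (p * n))"
      using sum_multiples[OF pos[OF p], where N = N and f = f]
      by (simp only: sum_subtractf sum_distrib_left[symmetric])
    finally show "\<sigma> p / real p * ((\<Sum>n=1..N. f n) - real p * (\<Sum>n=1..N div p. f (p * n)))
        = (\<Sum>n=1..N. f n * (\<sigma> p * dvd_dev p n))"
      using pos[OF p] by (simp add: field_simps)
  qed
  also have "\<dots> = (\<Sum>n=1..N. f n * g n) / real N"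
    unfolding g_def sum_divide_distrib[symmetric] sum_distrib_left by (subst sum.swap) simp
  finally have eq: "(\<Sum>p\<in>B. \<sigma> p / real p * ((\<Sum>n=1..N. f n) - real p * (\<Sum>n=1..N div p. f (p * n))) / real N)
      = (\<Sum>n=1..N. f n * g n) / real N" .
  have "(\<Sum>n=1..N. f n * g n)\<^sup>2 \<le> (\<Sum>n=1..N. (f n)\<^sup>2) * (\<Sum>n=1..N. (g n)\<^sup>2)"
    by (rule Cauchy_Schwarz_ineq_sum)
  also have "\<dots> \<le> real N * (\<Sum>n=1..N. (g n)\<^sup>2)"
  proof (rule mult_right_mono)
    have "(\<Sum>n=1..N. (f n)\<^sup>2) \<le> (\<Sum>n=1..N. 1)"
      using f by (intro sum_mono) (simp add: abs_square_le_1)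
    then show "(\<Sum>n=1..N. (f n)\<^sup>2) \<le> real N" by simp
  qed (simp add: sum_nonneg)
  finally have CS: "(\<Sum>n=1..N. f n * g n)\<^sup>2 \<le> real N * (\<Sum>n=1..N. (g n)\<^sup>2)" .
  have "(\<Sum>n=1..N. (g n)\<^sup>2) \<le> real N * (\<Sum>p\<in>B. 1 / real p) + 2 * (real (card B))\<^sup>2"
  proof -
    have "(\<Sum>n=1..N. (g n)\<^sup>2) = (\<Sum>n=1..N. \<Sum>p\<in>B. \<Sum>q\<in>B. \<sigma> p * \<sigma> q * (dvd_dev p n * dvd_dev q n))"
      by (simp add: g_def power2_eq_square sum_product mult_ac)
    also have "\<dots> = (\<Sum>p\<in>B. \<Sum>q\<in>B. \<sigma> p * \<sigma> q * (\<Sum>n=1..N. dvd_dev p n * dvd_dev q n))"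
      unfolding sum_distrib_left by (subst sum.swap, rule sum.cong[OF refl], rule sum.swap)
    also have "\<dots> \<le> (\<Sum>p\<in>B. \<Sum>q\<in>B. (if p = q then real N / real p else 0) + 2)"
    proof (intro sum_mono)
      fix p q assume pq: "p \<in> B" "q \<in> B"
      show "\<sigma> p * \<sigma> q * (\<Sum>n=1..N. dvd_dev p n * dvd_dev q n) \<le> (if p = q then real N / real p else 0) + 2"
      proof -
        have "\<sigma> p * \<sigma> q * (\<Sum>n=1..N. dvd_dev p n * dvd_dev q n)
            \<le> \<bar>\<sigma> p\<bar> * \<bar>\<sigma> q\<bar> * \<bar>\<Sum>n=1..N. dvd_dev p n * dvd_dev q n\<bar>"
          by (metis abs_ge_self abs_mult)
        also have "\<dots> \<le> 1 * 1 * \<bar>\<Sum>n=1..N. dvd_dev p n * dvd_dev q n\<bar>"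
          using \<sigma> by (intro mult_mono mult_nonneg_nonneg) auto
        also have "\<dots> \<le> (if p = q then real N / real p else 0) + 2"
          using sum_dvd_dev_mult[OF B(2)[OF pq(1)] B(2)[OF pq(2)], where N = N] by (auto split: if_splits)
        finally show ?thesis .
      qed
    qed
    also have "\<dots> = real N * (\<Sum>p\<in>B. 1 / real p) + 2 * (real (card B))\<^sup>2"
      using B(1) by (simp add: sum.distrib power2_eq_square sum_distrib_left)
    finally show ?thesis .
  qed
  from order_trans[OF CS mult_left_mono[OF this]] have "(\<Sum>n=1..N. f n * g n)\<^sup>2 \<le> real N * (real N * (\<Sum>p\<in>B. 1 / real p) + 2 * (real (card B))\<^sup>2)"
    by simp
  then have "((\<Sum>n=1..N. f n * g n) / real N)\<^sup>2 \<le>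
     real N * (real N * (\<Sum>p\<in>B. 1 / real p) + 2 * (real (card B))\<^sup>2) / (real N)\<^sup>2"
    by (simp add: power_divide divide_right_mono)
  also have "\<dots> = (\<Sum>p\<in>B. 1 / real p) + 2 * (real (card B))\<^sup>2 / real N"
    using N by (simp add: field_simps power2_eq_square)
  finally show ?thesis by (simp only: eq)
qed

text \<open>With \<open>\<sigma>\<close> the sign of the deviation, the logarithmic size
  \<open>L\<close> of the exceptional set satisfies \<open>(\<eta> * L)\<^sup>2 \<le> L + 1\<close>.
  This forces a bound independent of \<open>N\<close> and \<open>P\<close>.\<close>

lemma turan_kubilius_exceptional:
  fixes f :: "nat \<Rightarrow> real" and P :: "nat set"
  defines "u \<equiv> (\<lambda>N p. \<bar>(\<Sum>n=1..N. f n) - real p * (\<Sum>n=1..N div p. f (p * n))\<bar>)"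
  assumes P: "finite P" "\<And>p. p \<in> P \<Longrightarrow> prime p"
    and f: "\<And>n. \<bar>f n\<bar> \<le> 1" and \<eta>: "0 < \<eta>" "\<eta> \<le> 1"
    and N: "N > 0" "N \<ge> 2 * (card P)\<^sup>2"
  shows "(\<Sum>p\<in>{p\<in>P. u N p \<ge> \<eta> * real N}. 1 / real p) \<le> 2 / \<eta>\<^sup>2"
proof -
  define D where "D p = (\<Sum>n=1..N. f n) - real p * (\<Sum>n=1..N div p. f (p * n))" for p
  define B where "B = {p\<in>P. u N p \<ge> \<eta> * real N}"
  define L where "L = (\<Sum>p\<in>B. 1 / real p)"
  have B: "finite B" "\<And>p. p \<in> B \<Longrightarrow> prime p" using P by (auto simp: B_def)
  have L0: "L \<ge> 0" by (simp add: L_def sum_nonneg)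
  have "2 * (card B)\<^sup>2 \<le> 2 * (card P)\<^sup>2"
    using P(1) by (intro mult_left_mono power_mono card_mono) (auto simp: B_def)
  then have "real (2 * (card B)\<^sup>2) \<le> real N" using N(2) by linarith
  then have small: "2 * (real (card B))\<^sup>2 / real N \<le> 1" using N(1) by simp
  have "\<eta> * L \<le> (\<Sum>p\<in>B. sgn (D p) / real p * D p / real N)"
    unfolding L_def sum_distrib_left
  proof (intro sum_mono)
    fix p assume p: "p \<in> B"
    have "\<eta> * real N \<le> \<bar>D p\<bar>" using p by (simp add: B_def u_def D_def)
    also have "\<bar>D p\<bar> = sgn (D p) * D p" by (simp add: abs_sgn mult.commute)
    finally show "\<eta> * (1 / real p) \<le> sgn (D p) / real p * D p / real N"
      using N(1) B(2)[OF p] by (simp add: field_simps prime_gt_0_nat)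
  qed
  then have "(\<eta> * L)\<^sup>2 \<le> (\<Sum>p\<in>B. sgn (D p) / real p * D p / real N)\<^sup>2"
    using L0 \<eta> by (intro power_mono) auto
  also have "\<dots> \<le> L + 2 * (real (card B))\<^sup>2 / real N"
    unfolding D_def L_def
    by (rule turan_kubilius_dual[OF B f _ N(1)]) (simp_all add: sgn_real_def)
  also have "\<dots> \<le> L + 1" using small by simp
  finally have *: "(\<eta> * L)\<^sup>2 \<le> L + 1" .
  have "L \<le> 2 / \<eta>\<^sup>2"
  proof (cases "L \<le> 1")
    case True
    have "\<eta>\<^sup>2 \<le> 1" using \<eta> by (simp add: abs_square_le_1)
    then have "1 \<le> 2 / \<eta>\<^sup>2" using \<eta> by (simp add: field_simps)
    then show ?thesis using True by linarith
  next
    case False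
    have "(\<eta>\<^sup>2 * L) * L = (\<eta> * L)\<^sup>2" by (simp add: power2_eq_square mult_ac)
    then have "(\<eta>\<^sup>2 * L) * L \<le> 2 * L" using * False by linarith
    then have "\<eta>\<^sup>2 * L \<le> 2" by (rule mult_right_le_imp_le) (use False in linarith)
    then show ?thesis using \<eta> by (simp add: field_simps)
  qed
  then show ?thesis by (simp add: L_def B_def)
qed

section \<open>Shifting the number of prime factors\<close>

definition log_cell :: "nat \<Rightarrow> real \<Rightarrow> real \<Rightarrow> nat set" where
  "log_cell m s d = {p. prime p \<and> [p = 1] (mod m) \<and> s < ln (real p) \<and> ln (real p) \<le> s + d}"

text \<open>\<open>1 / s\<close> is the order that the prime number theorem predicts for a window of
  fixed length in \<open>ln p\<close>.\<close>

definition primes_dense :: "nat \<Rightarrow> bool" where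
  "primes_dense m \<longleftrightarrow> (\<forall>d>0. \<exists>c>0. \<exists>s0>0. \<forall>s\<ge>s0. c / s \<le> (\<Sum>p\<in>log_cell m s d. 1 / real p))"

lemma finite_log_cell: "finite (log_cell m s d)"
proof -
  have "log_cell m s d \<subseteq> {..nat \<lfloor>exp (s + d)\<rfloor>}"
  proof
    fix p assume p: "p \<in> log_cell m s d"
    then have "p > 0" "ln (real p) \<le> s + d" by (auto simp: log_cell_def prime_gt_0_nat)
    then have "real p \<le> exp (s + d)" by (metis exp_le_cancel_iff exp_ln of_nat_0_less_iff)
    then show "p \<in> {..nat \<lfloor>exp (s + d)\<rfloor>}" by (simp add: le_nat_floor)
  qed
  then show ?thesis by (rule finite_subset) simp
qed

text \<open>Two families of disjoint cells cannot both be exhausted by exceptional sets of bounded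
  logarithmic size, because the harmonic series diverges.\<close>
lemma avoid_exceptional:
  assumes dense: "primes_dense m" and d: "d > 0" and C: "C > 0" "A \<ge> 0"
  obtains J J' :: nat where
    "\<And>a B1 B2. 0 \<le> a \<Longrightarrow> a \<le> A \<Longrightarrow>
      (\<Sum>p\<in>B1 \<inter> (\<Union>j\<in>{J..<J'}. log_cell m (real j * d) d). 1 / real p) \<le> C \<Longrightarrow>
      (\<Sum>p\<in>B2 \<inter> (\<Union>j\<in>{J..<J'}. log_cell m (a + real j * d + d) d). 1 / real p) \<le> C \<Longrightarrow>
      \<exists>j\<in>{J..<J'}. \<not> log_cell m (real j * d) d \<subseteq> B1 \<and> \<not> log_cell m (a + real j * d + d) d \<subseteq> B2"
proof -
  obtain c s0 where c: "c > 0" "s0 > 0" and lower: "\<And>s. s \<ge> s0 \<Longrightarrow> c / s \<le> (\<Sum>p\<in>log_cell m s d. 1 / real p)"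
    using dense d unfolding primes_dense_def by meson
  define J where "J = nat \<lceil>s0 / d\<rceil> + 1"
  have Js: "s0 \<le> real j * d" and j1: "j \<ge> 1" if "j \<ge> J" for j
  proof -
    have "s0 / d \<le> real J" unfolding J_def by linarith
    also have "\<dots> \<le> real j" using that by simp
    finally show "s0 \<le> real j * d" using d by (simp add: field_simps)
    show "j \<ge> 1" using that by (simp add: J_def)
  qed
  \<comment> \<open>For \<open>j \<ge> 1\<close> every left endpoint that occurs is at most
    \<open>(A + 2 * d) * j\<close>, so the cell of index \<open>j\<close> in either family has mass
    at least \<open>b / j\<close>.\<close>
  define b where "b = c / (A + 2 * d)"
  have b: "b > 0" using c C d by (simp add: b_def)
  have "\<not> summable (\<lambda>n. 1 / real n)"
    using not_summable_harmonic[where 'a = real] by (simp add: inverse_eq_divide)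
  then have "\<not> summable (\<lambda>n. 1 / real (n + J))"
    using summable_iff_shift[of "\<lambda>n. 1 / real n" J] by blast
  then have "\<not> (\<forall>n. (\<Sum>i<n. 1 / real (i + J)) \<le> (2 * C + 1) / b)"
    using bounded_imp_summable[of "\<lambda>n. 1 / real (n + J)" "(2 * C + 1) / b"]
    by (auto simp: lessThan_Suc_atMost[symmetric] simp del: sum.lessThan_Suc)
  then obtain n where n: "(\<Sum>i<n. 1 / real (i + J)) > (2 * C + 1) / b" by (auto simp: not_le)
  define J' where "J' = J + n"
  have "(\<Sum>i<n. 1 / real (i + J)) = (\<Sum>j\<in>{J..<J'}. 1 / real j)"
    by (rule sum.reindex_bij_witness[where i = "\<lambda>j. j - J" and j = "\<lambda>i. i + J"]) (auto simp: J'_def)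
  \<comment> \<open>More mass than two exceptional sets of size \<open>C\<close> can absorb.\<close>
  then have big: "(\<Sum>j\<in>{J..<J'}. b / real j) > 2 * C"
  proof -
    assume "(\<Sum>i<n. 1 / real (i + J)) = (\<Sum>j\<in>{J..<J'}. 1 / real j)"
    then have "(2 * C + 1) / b < (\<Sum>j\<in>{J..<J'}. 1 / real j)" using n by simp
    then have "2 * C + 1 < b * (\<Sum>j\<in>{J..<J'}. 1 / real j)" using b by (simp add: field_simps)
    then show ?thesis by (simp add: sum_distrib_left)
  qed
  have disj: "j = j'" if "p \<in> log_cell m (a + real j * d) d" "p \<in> log_cell m (a + real j' * d) d" for a j j' p
  proof -
    have "a + real j * d < a + real j' * d + d" "a + real j' * d < a + real j * d + d"
      using that by (auto simp: log_cell_def)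
    then have "real j * d < (real j' + 1) * d" "real j' * d < (real j + 1) * d" by (auto simp: algebra_simps)
    then have "real j < real j' + 1" "real j' < real j + 1" using d by auto
    then show ?thesis by linarith
  qed
  show ?thesis
  \<comment> \<open>\<open>J\<close> and \<open>J'\<close> are fixed before \<open>a\<close>,
    \<open>B1\<close> and \<open>B2\<close>, which in the application depend on
    \<open>N\<close>.\<close>
  proof (rule that[of J J'])
    fix a B1 B2
    assume a: "0 \<le> a" "a \<le> A"
      and B1: "(\<Sum>p\<in>B1 \<inter> (\<Union>j\<in>{J..<J'}. log_cell m (real j * d) d). 1 / real p) \<le> C"
      and B2: "(\<Sum>p\<in>B2 \<inter> (\<Union>j\<in>{J..<J'}. log_cell m (a + real j * d + d) d). 1 / real p) \<le> C"
    define J1 where "J1 = {j\<in>{J..<J'}. log_cell m (real j * d) d \<subseteq> B1}"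
    define J2 where "J2 = {j\<in>{J..<J'}. log_cell m (a + real j * d + d) d \<subseteq> B2}"
    \<comment> \<open>Cells swallowed by an exceptional set are disjoint, so their masses add up to
      at most its size.\<close>
    have est: "(\<Sum>j\<in>I. b / real j) \<le> C"
      if I: "I \<subseteq> {J..<J'}" and sub: "\<And>j. j \<in> I \<Longrightarrow> log_cell m (t + real j * d) d \<subseteq> B"
        and le: "(\<Sum>p\<in>B \<inter> (\<Union>j\<in>{J..<J'}. log_cell m (t + real j * d) d). 1 / real p) \<le> C"
        and t: "0 \<le> t" "t \<le> A + d" for I B t
    proof -
      have fI: "finite I" using I finite_subset by blast
      have "(\<Sum>j\<in>I. b / real j) \<le> (\<Sum>j\<in>I. \<Sum>p\<in>log_cell m (t + real j * d) d. 1 / real p)"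
      proof (rule sum_mono)
        fix j assume "j \<in> I"
        then have j: "j \<ge> J" using I by auto
        have "t + real j * d \<le> (A + 2 * d) * real j"
        proof -
          have "A + d \<le> (A + d) * real j" using j1[OF j] C d by (simp add: mult_le_cancel_left1)
          then show ?thesis using t by (simp add: algebra_simps)
        qed
        moreover have "t + real j * d > 0" using Js[OF j] t c by linarith
        ultimately have "c / ((A + 2 * d) * real j) \<le> c / (t + real j * d)"
          using c by (intro divide_left_mono) (auto intro!: mult_pos_pos)
        also have "\<dots> \<le> (\<Sum>p\<in>log_cell m (t + real j * d) d. 1 / real p)"
          using Js[OF j] t by (intro lower) linarith
        finally show "b / real j \<le> (\<Sum>p\<in>log_cell m (t + real j * d) d. 1 / real p)" by (simp add: b_def)
      qed
      also have "\<dots> = (\<Sum>p\<in>(\<Union>j\<in>I. log_cell m (t + real j * d) d). 1 / real p)"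
        using disj by (intro sum.UNION_disjoint[symmetric] fI ballI finite_log_cell) blast
      also have "\<dots> \<le> (\<Sum>p\<in>B \<inter> (\<Union>j\<in>{J..<J'}. log_cell m (t + real j * d) d). 1 / real p)"
        using sub I by (intro sum_mono2) (auto simp: finite_log_cell)
      also note le
      finally show ?thesis .
    qed
    have "(\<Sum>j\<in>J1. b / real j) \<le> C"
      using B1 d C by (intro est[where B = B1 and t = 0]) (auto simp: J1_def)
    moreover have "(\<Sum>j\<in>J2. b / real j) \<le> C"
      using B2 d C a by (intro est[where B = B2 and t = "a + d"]) (auto simp: J2_def add_ac)
    moreover have "(\<Sum>j\<in>J1 \<union> J2. b / real j) \<le> (\<Sum>j\<in>J1. b / real j) + (\<Sum>j\<in>J2. b / real j)"
      using b by (subst sum.union_inter[symmetric]) (auto simp: J1_def J2_def intro!: sum_nonneg)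
    ultimately have "J1 \<union> J2 \<noteq> {J..<J'}" using big by force
    then show "\<exists>j\<in>{J..<J'}. \<not> log_cell m (real j * d) d \<subseteq> B1 \<and> \<not> log_cell m (a + real j * d + d) d \<subseteq> B2"
      by (auto simp: J1_def J2_def)
  qed
qed

section \<open>Sums over a residue class\<close>

text \<open>The shift \<open>k\<close> counts the prime factors pulled out so far, so that
  multiplication by a prime becomes \<open>Suc k\<close>.\<close>

definition prog_sum :: "nat \<Rightarrow> nat \<Rightarrow> (nat \<Rightarrow> real) \<Rightarrow> nat \<Rightarrow> nat \<Rightarrow> real" where
  "prog_sum m r a k N = (\<Sum>n=1..N. if [n = r] (mod m) then a (big_Omega n + k) else 0)"

lemma big_Omega_prime_mult:
  assumes "prime p" "n > 0"
  shows "big_Omega (p * n) = Suc (big_Omega n)"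
  using assms prime_factorization_mult[of p n]
  by (simp add: big_Omega_def prime_factorization_prime prime_gt_0_nat)

lemma prog_sum_prime:
  assumes p: "prime p" "[p = 1] (mod m)"
  shows "(\<Sum>n=1..N. if [p * n = r] (mod m) then a (big_Omega (p * n) + k) else 0) = prog_sum m r a (Suc k) N"
  unfolding prog_sum_def
proof (rule sum.cong[OF refl])
  fix n assume "n \<in> {1..N}"
  moreover have "[p * n = 1 * n] (mod m)" using p(2) by (rule cong_scalar_right)
  then have "[p * n = r] (mod m) \<longleftrightarrow> [n = r] (mod m)" by (auto simp: cong_def)
  ultimately show "(if [p * n = r] (mod m) then a (big_Omega (p * n) + k) else 0) =
      (if [n = r] (mod m) then a (big_Omega n + Suc k) else 0)"
    using big_Omega_prime_mult[OF p(1), of n] by simp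
qed

lemma prog_sum_bound:
  assumes "\<And>n. \<bar>a n\<bar> \<le> 1" 
  shows "\<bar>prog_sum m r a k N\<bar> \<le> real N"
proof -
  have "\<bar>prog_sum m r a k N\<bar> \<le> (\<Sum>n=1..N. 1)"
    unfolding prog_sum_def using assms by (intro order_trans[OF sum_abs] sum_mono) auto
  then show ?thesis by simp
qed

lemma prog_sum_diff:
  assumes "\<And>n. \<bar>a n\<bar> \<le> 1" "M \<le> N"
  shows "\<bar>prog_sum m r a k N - prog_sum m r a k M\<bar> \<le> real N - real M"
proof -
  have "{1..N} = {1..M} \<union> {M<..N}" "{1..M} \<inter> {M<..N} = {}" using assms(2) by auto
  then have "prog_sum m r a k N - prog_sum m r a k M =
      (\<Sum>n\<in>{M<..N}. if [n = r] (mod m) then a (big_Omega n + k) else 0)"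
    unfolding prog_sum_def by (simp add: sum.union_disjoint)
  also have "\<bar>\<dots>\<bar> \<le> (\<Sum>n\<in>{M<..N}. 1)"
    using assms by (intro order_trans[OF sum_abs] sum_mono) auto
  finally show ?thesis using assms(2) by (simp add: of_nat_diff)
qed

lemma prog_sum_exceptional:
  fixes P :: "nat set"
  assumes P: "finite P" "\<And>p. p \<in> P \<Longrightarrow> prime p" "\<And>p. p \<in> P \<Longrightarrow> [p = 1] (mod m)"
    and a: "\<And>n. \<bar>a n\<bar> \<le> 1" and \<eta>: "0 < \<eta>" "\<eta> \<le> 1"
    and N: "N > 0" "N \<ge> 2 * (card P)\<^sup>2"
  shows "(\<Sum>p\<in>{p. \<bar>prog_sum m r a k N - real p * prog_sum m r a (Suc k) (N div p)\<bar> \<ge> \<eta> * real N} \<inter> P.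
           1 / real p) \<le> 2 / \<eta>\<^sup>2"
proof -
  define f where "f n = (if [n = r] (mod m) then a (big_Omega n + k) else 0)" for n
  have "{p. \<bar>prog_sum m r a k N - real p * prog_sum m r a (Suc k) (N div p)\<bar> \<ge> \<eta> * real N} \<inter> P
    = {p\<in>P. \<bar>(\<Sum>n=1..N. f n) - real p * (\<Sum>n=1..N div p. f (p * n))\<bar> \<ge> \<eta> * real N}"
    using prog_sum_prime[OF P(2) P(3), where r = r and a = a and k = k] by (auto simp: f_def prog_sum_def)
  then show ?thesis
    using turan_kubilius_exceptional[OF P(1,2) _ \<eta> N, of f] a by (simp add: f_def)
qed

text \<open>The chain is \<open>F 0 N\<close>, \<open>q1 * F 1 M\<close>,
  \<open>Q * F 2 (N div Q)\<close>, \<open>p * F 2 (N div p)\<close>, \<open>F 1 N\<close>; passing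
  from \<open>Q = q1 * q2\<close> to \<open>p\<close> is cheap because \<open>p / Q\<close> lies
  between 1 and \<open>1 + \<eta>\<close>. The stock \<open>P1\<close> for \<open>q1\<close> comes
  first, since the cells for \<open>p\<close> are shifted by \<open>ln q1\<close> and the range of
  this shift must be known.\<close>

lemma prog_sum_shift:
  assumes dense: "primes_dense m" and a: "\<And>n. \<bar>a n\<bar> \<le> 1"
  shows "(\<lambda>N. (prog_sum m r a 0 N - prog_sum m r a 1 N) / real N) \<longlonglongrightarrow> 0"
proof (rule LIMSEQ_I)
  fix \<epsilon> :: real assume \<epsilon>: "\<epsilon> > 0"
  \<comment> \<open>Five comparisons cost \<open>\<eta> * N\<close> each and rounding costs
    \<open>Z\<close>; with an eighth of \<open>\<epsilon> * N\<close> for each of the six, the total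
    stays below \<open>\<epsilon> * N\<close>.\<close>
  define \<eta> where "\<eta> = min 1 (\<epsilon> / 8)"
  have \<eta>: "0 < \<eta>" "\<eta> \<le> 1" "\<eta> \<le> \<epsilon> / 8" using \<epsilon> by (auto simp: \<eta>_def)
  \<comment> \<open>The cells of \<open>q2\<close> and of \<open>p\<close>, the latter one step
    further, have width \<open>d\<close>, so \<open>ln p - ln Q\<close> lies between 0 and
    \<open>2 * d\<close>.\<close>
  define d where "d = ln (1 + \<eta>) / 2"
  have d: "d > 0" using \<eta> by (simp add: d_def)
  have exp_d: "exp (2 * d) = 1 + \<eta>" using \<eta> by (simp add: d_def)
  define C where "C = 2 / \<eta>\<^sup>2"
  have C: "C > 0" using \<eta> by (simp add: C_def)
  define bad where "bad k N = {p. \<bar>prog_sum m r a k N - real p * prog_sum m r a (Suc k) (N div p)\<bar> \<ge> \<eta> * real N}" for k N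
  \<comment> \<open>For \<open>q1\<close> a single family of cells is wanted: this instance will be
    applied with \<open>a = 0\<close> and an empty second exceptional set.\<close>
  obtain J0 J0' where J0: "\<And>a B1 B2. 0 \<le> a \<Longrightarrow> a \<le> 0 \<Longrightarrow>
      (\<Sum>p\<in>B1 \<inter> (\<Union>j\<in>{J0..<J0'}. log_cell m (real j * d) d). 1 / real p) \<le> C \<Longrightarrow>
      (\<Sum>p\<in>B2 \<inter> (\<Union>j\<in>{J0..<J0'}. log_cell m (a + real j * d + d) d). 1 / real p) \<le> C \<Longrightarrow>
      \<exists>j\<in>{J0..<J0'}. \<not> log_cell m (real j * d) d \<subseteq> B1 \<and> \<not> log_cell m (a + real j * d + d) d \<subseteq> B2"
    using avoid_exceptional[OF dense d C order_refl] by metis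
  define P1 where "P1 = (\<Union>j\<in>{J0..<J0'}. log_cell m (real j * d) d)"
  have P1: "finite P1" "\<And>p. p \<in> P1 \<Longrightarrow> prime p" "\<And>p. p \<in> P1 \<Longrightarrow> [p = 1] (mod m)"
    by (auto simp: P1_def finite_log_cell) (auto simp: log_cell_def)
  define A where "A = Max (insert 0 (ln ` real ` P1))"
  have A: "A \<ge> 0" "\<And>p. p \<in> P1 \<Longrightarrow> ln (real p) \<le> A" using P1(1) by (auto simp: A_def)
  obtain J J' where J: "\<And>a B1 B2. 0 \<le> a \<Longrightarrow> a \<le> A \<Longrightarrow>
      (\<Sum>p\<in>B1 \<inter> (\<Union>j\<in>{J..<J'}. log_cell m (real j * d) d). 1 / real p) \<le> C \<Longrightarrow>
      (\<Sum>p\<in>B2 \<inter> (\<Union>j\<in>{J..<J'}. log_cell m (a + real j * d + d) d). 1 / real p) \<le> C \<Longrightarrow>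
      \<exists>j\<in>{J..<J'}. \<not> log_cell m (real j * d) d \<subseteq> B1 \<and> \<not> log_cell m (a + real j * d + d) d \<subseteq> B2"
    using avoid_exceptional[OF dense d C A(1)] by metis
  define P2 where "P2 = (\<Union>j\<in>{J..<J'}. log_cell m (real j * d) d)"
  define P3 where "P3 t = (\<Union>j\<in>{J..<J'}. log_cell m (t + real j * d + d) d)" for t
  have P2: "finite P2" "\<And>p. p \<in> P2 \<Longrightarrow> prime p" "\<And>p. p \<in> P2 \<Longrightarrow> [p = 1] (mod m)"
    by (auto simp: P2_def finite_log_cell) (auto simp: log_cell_def)
  have P3: "finite (P3 t)" "\<And>p. p \<in> P3 t \<Longrightarrow> prime p" "\<And>p. p \<in> P3 t \<Longrightarrow> [p = 1] (mod m)" for t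
    by (auto simp: P3_def finite_log_cell) (auto simp: log_cell_def)
  define P4 where "P4 = P1 \<union> P2 \<union> (\<Union>q\<in>P1. P3 (ln (real q)))"
  have P4: "finite P4" using P1(1) P2(1) P3(1) by (auto simp: P4_def)
  define Z where "Z = Max (insert 1 P4)"
  have Z: "Z \<ge> 1" "\<And>p. p \<in> P4 \<Longrightarrow> p \<le> Z" using P4 by (auto simp: Z_def)
  \<comment> \<open>The first summand makes every \<open>M \<ge> N div Z\<close> large enough for
    the bound on exceptional sets, the second makes \<open>Z\<close> at most
    \<open>\<epsilon> / 8 * N\<close>.\<close>
  define N0 where "N0 = (2 * (card P4)\<^sup>2 + 1) * Z + nat \<lceil>8 * real Z / \<epsilon>\<rceil> + 1"
  show "\<exists>no. \<forall>N\<ge>no. norm ((prog_sum m r a 0 N - prog_sum m r a 1 N) / real N - 0) < \<epsilon>"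
  proof (intro exI allI impI)
    fix N assume N: "N0 \<le> N"
    have NZ: "(2 * (card P4)\<^sup>2 + 1) * Z \<le> N" using N by (simp add: N0_def)
    have N0: "N > 0" using N by (simp add: N0_def)
    have NZ2: "real Z \<le> \<epsilon> / 8 * real N"
    proof -
      have "8 * real Z / \<epsilon> \<le> real N0" unfolding N0_def by linarith
      also have "\<dots> \<le> real N" using N by simp
      finally show ?thesis using \<epsilon> by (simp add: field_simps)
    qed
    have large: "M > 0 \<and> M \<ge> 2 * (card Q)\<^sup>2" if "Q \<subseteq> P4" "M \<ge> N div Z" for Q M
    proof -
      have "2 * (card P4)\<^sup>2 + 1 \<le> N div Z" using NZ Z(1) by (simp add: less_eq_div_iff_mult_less_eq)
      moreover have "2 * (card Q)\<^sup>2 \<le> 2 * (card P4)\<^sup>2"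
        using that P4 by (intro mult_left_mono power_mono card_mono) auto
      ultimately show ?thesis using that(2) by linarith
    qed
    have bad: "(\<Sum>p\<in>bad k M \<inter> Q. 1 / real p) \<le> C"
      if "Q \<subseteq> P4" "M \<ge> N div Z" "\<And>p. p \<in> Q \<Longrightarrow> prime p" "\<And>p. p \<in> Q \<Longrightarrow> [p = 1] (mod m)" for Q M k
      unfolding bad_def C_def
      using large[OF that(1,2)] finite_subset[OF that(1) P4] that(3,4) a \<eta>
      by (intro prog_sum_exceptional) auto
    have NN: "N div Z \<le> N" by simp
    have "(\<Sum>p\<in>bad 0 N \<inter> P1. 1 / real p) \<le> C"
      using P1 by (intro bad NN) (auto simp: P4_def)
    then have "\<exists>j\<in>{J0..<J0'}. \<not> log_cell m (real j * d) d \<subseteq> bad 0 N \<and> \<not> log_cell m (0 + real j * d + d) d \<subseteq> {}"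
      unfolding P1_def using C by (intro J0) auto
    then obtain q1 where q1: "q1 \<in> P1" "q1 \<notin> bad 0 N" by (auto simp: P1_def)
    have q1pos: "q1 > 0" using P1(2)[OF q1(1)] by (simp add: prime_gt_0_nat)
    \<comment> \<open>The exceptional set for \<open>q2\<close> is that of \<open>M\<close>, so
      \<open>q1\<close> has to be picked before \<open>q2\<close> and \<open>p\<close>.\<close>
    define M where "M = N div q1"
    have q1Z: "q1 \<le> Z" using q1 by (intro Z) (auto simp: P4_def)
    have MZ: "M \<ge> N div Z" using q1Z q1pos by (simp add: M_def div_le_mono2)
    have "(\<Sum>p\<in>bad 1 M \<inter> P2. 1 / real p) \<le> C"
      using P2 by (intro bad MZ) (auto simp: P4_def)
    moreover have "(\<Sum>p\<in>bad 1 N \<inter> P3 (ln (real q1)). 1 / real p) \<le> C"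
      using P3 q1(1) by (intro bad NN) (auto simp: P4_def)
    ultimately have "\<exists>j\<in>{J..<J'}. \<not> log_cell m (real j * d) d \<subseteq> bad 1 M
         \<and> \<not> log_cell m (ln (real q1) + real j * d + d) d \<subseteq> bad 1 N"
      unfolding P2_def P3_def using A(2)[OF q1(1)] q1pos by (intro J) auto
    then obtain j q2 p where j: "j \<in> {J..<J'}"
      and q2: "q2 \<in> log_cell m (real j * d) d" "q2 \<notin> bad 1 M"
      and p: "p \<in> log_cell m (ln (real q1) + real j * d + d) d" "p \<notin> bad 1 N"
      by blast
    have pos: "q2 > 0" "p > 0" using q2(1) p(1) by (auto simp: log_cell_def prime_gt_0_nat)
    have "p \<in> P4" using p(1) j q1(1) by (auto simp: P4_def P3_def)
    then have pZ: "p \<le> Z" by (rule Z)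
    define Q where "Q = q1 * q2"
    have Qpos: "Q > 0" using pos q1pos by (simp add: Q_def)
    have lnQ: "ln (real Q) = ln (real q1) + ln (real q2)"
      using pos q1pos by (simp add: Q_def ln_mult)
    have Qp: "ln (real Q) \<le> ln (real p)" "ln (real p) \<le> ln (real Q) + 2 * d"
      using p(1) q2(1) lnQ by (auto simp: log_cell_def)
    have Qp1: "Q \<le> p" using Qp(1) Qpos pos by simp
    have Qp2: "real p \<le> real Q * (1 + \<eta>)"
    proof -
      have "real p = exp (ln (real p))" using pos by simp
      also have "\<dots> \<le> exp (ln (real Q) + 2 * d)" using Qp(2) by simp
      also have "\<dots> = real Q * (1 + \<eta>)" using Qpos exp_d by (simp add: exp_add)
      finally show ?thesis .
    qed
    define F where "F = prog_sum m r a"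
    have F2: "2 = Suc (Suc 0)" by simp
    have e1: "\<bar>F 0 N - real q1 * F 1 M\<bar> \<le> \<eta> * real N"
      using q1(2) by (auto simp: bad_def F_def M_def)
    have e2: "\<bar>F 1 M - real q2 * F 2 (N div Q)\<bar> \<le> \<eta> * real M"
      using q2(2) by (auto simp: bad_def F_def M_def F2 Q_def div_mult2_eq)
    have e3: "\<bar>F 1 N - real p * F 2 (N div p)\<bar> \<le> \<eta> * real N"
      using p(2) by (auto simp: bad_def F_def F2)
    have e2': "\<bar>real q1 * F 1 M - real Q * F 2 (N div Q)\<bar> \<le> \<eta> * real N"
    proof -
      have "\<bar>real q1 * F 1 M - real Q * F 2 (N div Q)\<bar> = real q1 * \<bar>F 1 M - real q2 * F 2 (N div Q)\<bar>"
        by (simp add: Q_def abs_mult flip: right_diff_distrib mult.assoc)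
           (metis abs_mult abs_of_nat mult.assoc right_diff_distrib)
      also have "\<dots> \<le> real q1 * (\<eta> * real M)" using e2 by (intro mult_left_mono) auto
      also have "\<dots> = \<eta> * (real q1 * real M)" by simp
      also have "\<dots> \<le> \<eta> * real N"
        using \<eta> by (intro mult_left_mono) (simp_all add: M_def flip: of_nat_mult)
      finally show ?thesis .
    qed
    have NQ: "real (N div Q) \<le> real N / real Q" by (rule floor_div_bounds[OF Qpos])
    have Np: "real N / real p - 1 \<le> real (N div p)" by (rule floor_div_bounds[OF pos(2)])
    have e4: "\<bar>real Q * F 2 (N div Q) - real p * F 2 (N div Q)\<bar> \<le> \<eta> * real N"
    proof -
      have "\<bar>real Q * F 2 (N div Q) - real p * F 2 (N div Q)\<bar> = (real p - real Q) * \<bar>F 2 (N div Q)\<bar>"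
        using Qp1 by (simp add: abs_mult flip: left_diff_distrib)
      also have "\<dots> \<le> (\<eta> * real Q) * (real N / real Q)"
        using Qp1 Qp2 \<eta> prog_sum_bound[where a = a and m = m and r = r and k = 2 and N = "N div Q", OF a] NQ
        by (intro mult_mono) (auto simp: F_def algebra_simps)
      also have "\<dots> = \<eta> * real N" using Qpos by simp
      finally show ?thesis .
    qed
    \<comment> \<open>There are few integers between \<open>N div p\<close> and
      \<open>N div Q\<close>; their count has a rounding error of at most 1, multiplied here by
      \<open>p \<le> Z\<close>.\<close>
    have e5: "\<bar>real p * F 2 (N div Q) - real p * F 2 (N div p)\<bar> \<le> \<eta> * real N + real Z"
    proof -
      have "\<bar>real p * F 2 (N div Q) - real p * F 2 (N div p)\<bar> = real p * \<bar>F 2 (N div Q) - F 2 (N div p)\<bar>"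
        by (simp add: abs_mult flip: right_diff_distrib)
      also have "\<dots> \<le> real p * (real (N div Q) - real (N div p))"
        unfolding F_def using Qp1 Qpos
        by (intro mult_left_mono prog_sum_diff a div_le_mono2) auto
      also have "\<dots> \<le> real p * (real N / real Q - real N / real p + 1)"
        using NQ Np by (intro mult_left_mono) auto
      also have "\<dots> = real N * ((real p - real Q) / real Q) + real p"
        using Qpos pos by (simp add: field_simps)
      also have "\<dots> \<le> real N * \<eta> + real Z"
        using Qp2 Qpos pZ by (intro add_mono mult_left_mono) (auto simp: field_simps)
      finally show ?thesis by (simp add: mult.commute)
    qed
    have "\<bar>F 0 N - F 1 N\<bar> \<le> 5 * (\<eta> * real N) + real Z"
      using e1 e2' e3 e4 e5 by linarith
    also have "\<dots> \<le> 5 * (\<epsilon> / 8 * real N) + \<epsilon> / 8 * real N"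
      using NZ2 \<eta>(3) by (intro add_mono mult_left_mono mult_right_mono) auto
    also have "\<dots> < \<epsilon> * real N" using N0 \<epsilon> by simp
    finally show "norm ((prog_sum m r a 0 N - prog_sum m r a 1 N) / real N - 0) < \<epsilon>"
      using N0 by (simp add: F_def field_simps)
  qed
qed

section \<open>Dirichlet characters\<close>

definition unit_fun :: "nat \<Rightarrow> (nat \<Rightarrow> complex) \<Rightarrow> bool" where
  "unit_fun m f \<longleftrightarrow> (\<forall>a b. [a = b] (mod m) \<longrightarrow> f a = f b) \<and> (\<forall>n. \<not> coprime n m \<longrightarrow> f n = 0)"

definition dchar :: "nat \<Rightarrow> (nat \<Rightarrow> complex) \<Rightarrow> bool" where
  "dchar m \<psi> \<longleftrightarrow> unit_fun m \<psi> \<and> \<psi> 1 = 1 \<and> (\<forall>a b. \<psi> (a * b) = \<psi> a * \<psi> b)"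

definition principal_char :: "nat \<Rightarrow> nat \<Rightarrow> complex" where
  "principal_char m n = (if coprime n m then 1 else 0)"

lemma unit_fun_cong: "unit_fun m f \<Longrightarrow> [a = b] (mod m) \<Longrightarrow> f a = f b"
  by (simp add: unit_fun_def)

lemma unit_fun_0: "unit_fun m f \<Longrightarrow> \<not> coprime n m \<Longrightarrow> f n = 0"
  by (simp add: unit_fun_def)

lemma dcharD:
  assumes "dchar m \<psi>"
  shows "unit_fun m \<psi>" "\<psi> 1 = 1" "\<psi> (a * b) = \<psi> a * \<psi> b"
  using assms by (auto simp: dchar_def)

lemma dchar_power: "dchar m \<psi> \<Longrightarrow> \<psi> (a ^ k) = \<psi> a ^ k"
  by (induction k) (auto simp: dchar_def)

lemma coprime_cong_iff: "[a = b] (mod m) \<Longrightarrow> coprime a m \<longleftrightarrow> coprime b m" for a b m :: nat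
  by (metis cong_gcd_eq cong_sym coprime_iff_gcd_eq_1 gcd.commute)

lemma dchar_principal: "dchar m (principal_char m)"
  by (auto simp: dchar_def unit_fun_def principal_char_def coprime_cong_iff)

lemma norm_dchar:
  assumes "dchar m \<psi>" "m > 0" "coprime n m"
  shows "norm (\<psi> n) = 1"
proof -
  have "\<psi> n ^ totient m = \<psi> (n ^ totient m)" using dchar_power[OF assms(1)] by simp
  also have "\<dots> = 1"
    using unit_fun_cong[OF dcharD(1)[OF assms(1)] euler_theorem[OF assms(3)]] dcharD(2)[OF assms(1)] by simp
  finally have "norm (\<psi> n) ^ totient m = 1" by (metis norm_one norm_power)
  moreover have "totient m > 0" using assms(2) by simp
  ultimately show ?thesis by (metis norm_ge_zero power_eq_1_iff less_irrefl real_norm_def abs_norm_cancel)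
qed

lemma norm_dchar_le: "dchar m \<psi> \<Longrightarrow> m > 0 \<Longrightarrow> norm (\<psi> n) \<le> 1"
  using norm_dchar[of m \<psi> n] unit_fun_0[of m \<psi> n] by (cases "coprime n m") (auto simp: dchar_def)

lemma sum_root_of_unity:
  fixes N k :: nat
  assumes "k < N"
  shows "(\<Sum>j<N. exp (2 * of_real pi * \<i> * of_nat k / of_nat N) ^ j) = (if k = 0 then of_nat N else 0)"
proof (cases "k = 0")
  case False
  let ?z = "exp (2 * of_real pi * \<i> * of_nat k / of_nat N)"
  have "?z \<noteq> 1"
    using complex_root_unity_eq[of N k 0] assms False by (auto simp: cong_def)
  moreover have "?z ^ N = 1" using complex_root_unity[of N k] assms by simp
  ultimately show ?thesis using False by (simp add: geometric_sum)
qed simp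

text \<open>One splits a function into simultaneous eigenvectors of the multiplication operators, one unit
  at a time; a simultaneous eigenvector is a multiple of a character.\<close>
lemma dchar_span_induct:
  assumes m: "m > 0" and f: "unit_fun m f"
    and add: "\<And>g h. unit_fun m g \<Longrightarrow> unit_fun m h \<Longrightarrow> P g \<Longrightarrow> P h \<Longrightarrow> P (\<lambda>n. g n + h n)"
    and char: "\<And>\<psi> c. dchar m \<psi> \<Longrightarrow> P (\<lambda>n. c * \<psi> n)"
  shows "P f"
proof -
  define U where "U = {u. u < m \<and> coprime u m}"
  define eig where "eig u g \<longleftrightarrow> (\<exists>l. \<forall>n. g (u * n) = l * g n)" for u and g :: "nat \<Rightarrow> complex"
  define N where "N = totient m"
  have N: "N > 0" using m by (simp add: N_def)
  have sum: "P (\<lambda>n. \<Sum>j<k. g j n)" if "k > 0" "\<And>j. j < k \<Longrightarrow> unit_fun m (g j)" "\<And>j. j < k \<Longrightarrow> P (g j)" for k :: nat and g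
    using that
  proof (induction k rule: nat_induct_non_zero)
    case (Suc k)
    have "unit_fun m (\<lambda>n. \<Sum>j<k. g j n)" using Suc.prems(1)
      unfolding unit_fun_def by (auto intro!: sum.cong sum.neutral)
    then show ?case using Suc by (simp add: add)
  qed simp
  \<comment> \<open>Induction on the set \<open>B\<close> of units for which the eigenvector
    property may still fail.\<close>
  have "P g" if "finite B" "unit_fun m g" "\<And>u. u \<in> U - B \<Longrightarrow> eig u g" for B g
    using that
  proof (induction B arbitrary: g rule: finite_induct)
    case empty
    have ex: "\<exists>l. \<forall>n. g (a * n) = l * g n" if "coprime a m" for a
    proof -
      have "coprime (a mod m) m" using that coprime_cong_iff[of "a mod m" a m] by simp
      then have "eig (a mod m) g" using empty(2) m by (auto simp: U_def)
      then obtain l where l: "\<And>n. g (a mod m * n) = l * g n" by (auto simp: eig_def)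
      have "[a * n = a mod m * n] (mod m)" for n by (simp add: cong_def mod_mult_left_eq)
      then have "g (a * n) = l * g n" for n using unit_fun_cong[OF empty(1)] l by metis
      then show ?thesis by blast
    qed
    \<comment> \<open>Evaluating the eigenvector equation at \<open>b\<close> and at 1 eliminates
      the eigenvalue.\<close>
    have mult: "g (a * b) * g 1 = g a * g b" for a b
    proof (cases "coprime a m")
      case True
      then obtain l where "\<And>n. g (a * n) = l * g n" using ex by blast
      from this[of b] this[of 1] show ?thesis by simp
    qed (use unit_fun_0[OF empty(1)] in auto)
    show ?case
    proof (cases "g 1 = 0")
      case True
      have "g n = 0 * principal_char m n" for n
      proof (cases "coprime n m")
        case c: True
        then obtain l where "\<And>k. g (n * k) = l * g k" using ex by blast
        from this[of 1] show ?thesis using True by simp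
      qed (simp add: unit_fun_0[OF empty(1)])
      then have "g = (\<lambda>n. 0 * principal_char m n)" by blast
      then show ?thesis using char[OF dchar_principal] by metis
    next
      case False
      have "dchar m (\<lambda>n. g n / g 1)"
        using False mult empty(1) by (auto simp: dchar_def unit_fun_def field_simps)
      from char[OF this, of "g 1"] show ?thesis using False by simp
    qed
  next
    case (insert b B)
    show ?case
    proof (cases "b \<in> U")
      case False
      then show ?thesis using insert by (intro insert.IH) auto
    next
      case True
      then have b: "coprime b m" by (simp add: U_def)
      define w where "w k = exp (2 * of_real pi * \<i> * of_nat k / of_nat N)" for k :: nat
      have wN: "w k ^ N = 1" for k using complex_root_unity[of N k] N by (simp add: w_def)
      have wsym: "w k ^ j = w j ^ k" for k j
        by (simp add: w_def exp_of_nat_mult[symmetric] mult_ac)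
      \<comment> \<open>By Euler's theorem the N-th power of multiplication by \<open>b\<close> is
        trivial; \<open>h j\<close> is the projection of \<open>g\<close> to the eigenspace for
        \<open>1 / w j\<close>.\<close>
      define h where "h j n = (\<Sum>k<N. w j ^ k * g (b ^ k * n)) / of_nat N" for j n
      have bN: "g (b ^ N * n) = g n" for n
        using unit_fun_cong[OF insert.prems(1) cong_scalar_right[OF euler_theorem[OF b]]] by (simp add: N_def)
      have "h j (b * n) = (1 / w j) * h j n" for j n
      proof -
        have "w j * (\<Sum>k<N. w j ^ k * g (b ^ k * (b * n))) = (\<Sum>k<N. w j ^ Suc k * g (b ^ Suc k * n))"
          by (simp add: sum_distrib_left mult_ac)
        also have "\<dots> = (\<Sum>k<N. w j ^ k * g (b ^ k * n))"
        proof -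
          have "(\<Sum>k<Suc N. w j ^ k * g (b ^ k * n)) = g n + (\<Sum>k<N. w j ^ Suc k * g (b ^ Suc k * n))"
            by (subst sum.lessThan_Suc_shift) simp
          moreover have "(\<Sum>k<Suc N. w j ^ k * g (b ^ k * n)) = (\<Sum>k<N. w j ^ k * g (b ^ k * n)) + g n"
            using wN[of j] bN[of n] by simp
          ultimately show ?thesis by simp
        qed
        finally have "w j * (h j (b * n)) = h j n" by (simp add: h_def)
        moreover have "w j \<noteq> 0" by (simp add: w_def)
        ultimately show ?thesis by (simp add: field_simps)
      qed
      then have eb: "eig b (h j)" for j unfolding eig_def by blast
      have eu: "eig u (h j)" if u: "u \<in> U - insert b B" for u j
      proof -
        obtain l where l: "\<And>n. g (u * n) = l * g n" using insert.prems(2)[OF u] by (auto simp: eig_def)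
        have "g (b ^ k * (u * n)) = l * g (b ^ k * n)" for k n
          using l[of "b ^ k * n"] by (simp add: mult_ac)
        then have "h j (u * n) = l * h j n" for n
          by (simp add: h_def sum_distrib_left mult_ac)
        then show ?thesis by (auto simp: eig_def)
      qed
      have uh: "unit_fun m (h j)" for j
      proof -
        have "h j a = h j a'" if "[a = a'] (mod m)" for a a'
          unfolding h_def using unit_fun_cong[OF insert.prems(1) cong_scalar_left[OF that]] by simp
        moreover have "h j n = 0" if "\<not> coprime n m" for n
          unfolding h_def using unit_fun_0[OF insert.prems(1)] that by (simp add: coprime_mult_left_iff)
        ultimately show ?thesis by (auto simp: unit_fun_def)
      qed
      have "P (h j)" for j using eb eu uh by (intro insert.IH) (auto simp: insert_Diff_if)
      then have "P (\<lambda>n. \<Sum>j<N. h j n)" using N uh by (intro sum)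
      \<comment> \<open>The projections add up to \<open>g\<close> by orthogonality of roots of
        unity.\<close>
      moreover have "(\<Sum>j<N. h j n) = g n" for n
      proof -
        have "(\<Sum>j<N. h j n) = (\<Sum>k<N. (\<Sum>j<N. w k ^ j) * g (b ^ k * n)) / of_nat N"
          unfolding h_def sum_divide_distrib[symmetric] sum_distrib_right
          by (subst sum.swap) (simp add: wsym)
        also have "\<dots> = (\<Sum>k<N. if k = 0 then of_nat N * g n else 0) / of_nat N"
          unfolding w_def by (intro arg_cong2[where f = "(/)"] sum.cong refl) (auto simp: sum_root_of_unity)
        also have "\<dots> = g n" using N by simp
        finally show ?thesis .
      qed
      ultimately show ?thesis by simp
    qed
  qed
  from this[of U f] f show ?thesis by (simp add: U_def)
qed

text \<open>Multiplication by a unit \<open>b\<close> with \<open>\<psi> b \<noteq> 1\<close>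
  permutes the residues but multiplies the sum by \<open>\<psi> b\<close>.\<close>

lemma sum_dchar_nonprincipal:
  assumes m: "m > 0" and \<psi>: "dchar m \<psi>" "\<psi> \<noteq> principal_char m"
  shows "(\<Sum>a<m. \<psi> a) = 0"
proof -
  obtain b where b: "\<psi> b \<noteq> principal_char m b" using \<psi>(2) by blast
  have cb: "coprime b m"
  proof (rule ccontr)
    assume "\<not> coprime b m"
    then show False using unit_fun_0[OF dcharD(1)[OF \<psi>(1)]] b by (simp add: principal_char_def)
  qed
  have b1: "\<psi> b \<noteq> 1" using b cb by (simp add: principal_char_def)
  have "(\<Sum>a<m. \<psi> a) = (\<Sum>a<m. \<psi> (b * a mod m))"
  proof (rule sum.reindex_bij_betw[symmetric])
    have inj: "inj_on (\<lambda>a. b * a mod m) {..<m}"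
    proof
      fix x y assume xy: "x \<in> {..<m}" "y \<in> {..<m}" "b * x mod m = b * y mod m"
      then have "[b * x = b * y] (mod m)" by (simp add: cong_def)
      then have "[x = y] (mod m)" using cb by (simp add: cong_mult_lcancel_nat coprime_commute)
      then show "x = y" using xy by (simp add: cong_def)
    qed
    then show "bij_betw (\<lambda>a. b * a mod m) {..<m} {..<m}"
      unfolding bij_betw_def using m by (intro conjI endo_inj_surj) auto
  qed
  also have "\<dots> = (\<Sum>a<m. \<psi> b * \<psi> a)"
  proof (rule sum.cong[OF refl])
    fix a
    have "\<psi> (b * a mod m) = \<psi> (b * a)" by (rule unit_fun_cong[OF dcharD(1)[OF \<psi>(1)]]) (simp add: cong_def)
    then show "\<psi> (b * a mod m) = \<psi> b * \<psi> a" using dcharD(3)[OF \<psi>(1)] by simp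
  qed
  also have "\<dots> = \<psi> b * (\<Sum>a<m. \<psi> a)" by (rule sum_distrib_left[symmetric])
  finally have "(\<Sum>a<m. \<psi> a) = \<psi> b * (\<Sum>a<m. \<psi> a)" .
  then show ?thesis using b1 by (metis mult_cancel_right1)
qed

lemma sum_principal_char: 
  assumes "m > 0" shows "(\<Sum>a<m. principal_char m a) = of_nat (totient m)"
proof -
  have "(\<Sum>a<m. principal_char m a) = of_nat (card {a\<in>{..<m}. coprime a m})"
    by (simp add: principal_char_def sum.inter_filter[symmetric])
  also have "card {a\<in>{..<m}. coprime a m} = totient m"
  \<comment> \<open>For \<open>m = 1\<close> the only residue is 0, whereas
    \<open>totatives 1\<close> is \<open>{1}\<close>; just the cardinalities agree.\<close>
  proof (cases "m = 1")
    case False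
    then have "{a\<in>{..<m}. coprime a m} = totatives m"
      using assms by (auto simp: totatives_def le_less intro!: Suc_leI gr0I)
    then show ?thesis by (simp add: totient_def)
  qed (auto simp: lessThan_Suc)
  finally show ?thesis .
qed

section \<open>Dirichlet series\<close>

text \<open>Since 0 to any power is 0 under \<open>powr\<close>, series indexed from 0 effectively
  start at 1.\<close>

definition dterm :: "(nat \<Rightarrow> complex) \<Rightarrow> complex \<Rightarrow> nat \<Rightarrow> complex" where
  "dterm c s n = c n * of_nat n powr (-s)"

definition dseries :: "(nat \<Rightarrow> complex) \<Rightarrow> complex \<Rightarrow> complex" where
  "dseries c s = (\<Sum>n. dterm c s n)"

text \<open>A growth class containing bounded coefficients as well as \<open>mangoldt n\<close> and
  \<open>ln n\<close> times bounded ones, so that one convergence criterion serves all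
  series.\<close>

definition log_bounded :: "(nat \<Rightarrow> complex) \<Rightarrow> bool" where
  "log_bounded c \<longleftrightarrow> (\<exists>C. \<forall>n\<ge>1. norm (c n) \<le> C * (1 + ln (real n)))"

lemma norm_nat_powr: "norm (of_nat n powr (-s) :: complex) = real n powr (- Re s)"
  using norm_powr_real_powr[of "of_nat n" "-s"] by simp

lemma norm_dterm: "norm (dterm c s n) = norm (c n) * real n powr (- Re s)"
  by (simp add: dterm_def norm_mult norm_nat_powr)

lemma dterm_0 [simp]: "dterm c s 0 = 0"
  by (simp add: dterm_def)

lemma log_bounded_summable:
  assumes c: "log_bounded c" and \<sigma>: "\<sigma> > 1"
  shows "summable (\<lambda>n. norm (c n) * real n powr (-\<sigma>))"
proof -
  obtain C where C: "\<And>n. n \<ge> 1 \<Longrightarrow> norm (c n) \<le> C * (1 + ln (real n))" using c by (auto simp: log_bounded_def)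
  have C0: "C \<ge> 0" using order_trans[OF norm_ge_zero C[of 1]] by simp
  \<comment> \<open>Half of the gap above 1 is spent on dominating the logarithm.\<close>
  define e where "e = (\<sigma> - 1) / 2"
  have e: "e > 0" using \<sigma> by (simp add: e_def)
  have sm: "summable (\<lambda>n. C * (1 + 1 / e) * real n powr (e - \<sigma>))"
    using \<sigma> by (intro summable_mult) (simp add: summable_real_powr_iff e_def field_simps)
  show ?thesis
  proof (rule summable_comparison_test[OF _ sm], intro exI allI impI)
    fix n :: nat assume n: "n \<ge> 1"
    have "ln (real n) \<le> real n powr e / e" using n e by (intro ln_powr_bound) auto
    moreover have "1 \<le> real n powr e" using n e by (simp add: ge_one_powr_ge_zero)
    ultimately have "1 + ln (real n) \<le> (1 + 1 / e) * real n powr e" by (simp add: algebra_simps)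
    then have "C * (1 + ln (real n)) \<le> C * ((1 + 1 / e) * real n powr e)" using C0 by (rule mult_left_mono)
    with C[OF n] have "norm (c n) \<le> C * (1 + 1 / e) * real n powr e" by (simp add: mult.assoc)
    then have "norm (c n) * real n powr (-\<sigma>) \<le> C * (1 + 1 / e) * real n powr e * real n powr (-\<sigma>)"
      by (rule mult_right_mono) simp
    then show "norm (norm (c n) * real n powr (-\<sigma>)) \<le> C * (1 + 1 / e) * real n powr (e - \<sigma>)"
      by (simp add: powr_add[symmetric] mult.assoc)
  qed
qed

lemma bounded_imp_log_bounded: "(\<And>n. norm (c n) \<le> C) \<Longrightarrow> log_bounded c"
proof -
  assume le: "\<And>n. norm (c n) \<le> C"
  have C0: "C \<ge> 0" using order_trans[OF norm_ge_zero le[of 0]] .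
  show ?thesis unfolding log_bounded_def
  proof (intro exI allI impI)
    fix n :: nat assume "n \<ge> 1"
    then have "C * 1 \<le> C * (1 + ln (real n))" using C0 by (intro mult_left_mono) auto
    then show "norm (c n) \<le> C * (1 + ln (real n))" using le[of n] by simp
  qed
qed

lemma dseries_norm_summable: "log_bounded c \<Longrightarrow> Re s > 1 \<Longrightarrow> summable (\<lambda>n. norm (dterm c s n))"
  using log_bounded_summable[of c "Re s"] by (simp add: norm_dterm)

lemma dseries_sums: "log_bounded c \<Longrightarrow> Re s > 1 \<Longrightarrow> dterm c s sums dseries c s"
  unfolding dseries_def using summable_norm_cancel[OF dseries_norm_summable] by (simp add: summable_sums)

lemma dterm_has_field_derivative:
  "((\<lambda>s. dterm c s n) has_field_derivative dterm (\<lambda>n. - of_real (ln (real n)) * c n) s n) (at s)"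
proof (cases "n = 0")
  case False
  then have "((\<lambda>s. dterm c s n) has_field_derivative c n * (Ln (of_nat n) * of_nat n powr (-s) * (-1))) (at s)"
    unfolding dterm_def by (auto intro!: derivative_eq_intros simp: powr_def)
  then show ?thesis using False Ln_of_nat[of n] by (simp add: dterm_def mult_ac)
qed simp

lemma dseries_has_field_derivative:
  assumes c: "log_bounded c" and s: "Re s > 1"
  shows "(dseries c has_field_derivative dseries (\<lambda>n. - of_real (ln (real n)) * c n) s) (at s)"
    and "dterm (\<lambda>n. - of_real (ln (real n)) * c n) s sums dseries (\<lambda>n. - of_real (ln (real n)) * c n) s"
proof -
  define S where "S = {s. Re s > 1}"
  have S: "open S" unfolding S_def by (rule open_halfspace_Re_gt)
  have "\<exists>g g'. \<forall>x\<in>S. ((\<lambda>n. dterm c x n) sums g x) \<and>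
      ((\<lambda>n. dterm (\<lambda>n. - of_real (ln (real n)) * c n) x n) sums g' x) \<and> (g has_field_derivative g' x) (at x)"
  proof (rule series_and_derivative_comparison_local[OF S dterm_has_field_derivative])
    fix x assume x: "x \<in> S"
    define d where "d = (Re x - 1) / 2"
    have d: "d > 0" using x by (simp add: d_def S_def)
    have "summable (\<lambda>n. norm (c n) * real n powr (-(1 + d)))" using d by (intro log_bounded_summable c) auto
    moreover have "norm (dterm c y n) \<le> norm (c n) * real n powr (-(1 + d))" if "y \<in> ball x d \<inter> S" for y n
    proof -
      have "Re x - Re y \<le> norm (x - y)" using complex_Re_le_cmod[of "x - y"] by simp
      also have "\<dots> < d" using that by (simp add: dist_norm)
      finally have y: "Re y > 1 + d" by (simp add: d_def field_simps)
      show ?thesis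
      proof (cases "n = 0")
        case False
        then show ?thesis unfolding norm_dterm using y by (intro mult_left_mono powr_mono) auto
      qed simp
    qed
    ultimately show "\<exists>d h. 0 < d \<and> summable h \<and> (\<forall>\<^sub>F n in sequentially. \<forall>y\<in>ball x d \<inter> S. norm (dterm c y n) \<le> h n)"
      using d by (intro exI[of _ d] exI[of _ "\<lambda>n. norm (c n) * real n powr (-(1 + d))"]) auto
  qed
  then obtain g g' where g: "\<And>x. x \<in> S \<Longrightarrow> (\<lambda>n. dterm c x n) sums g x"
     "\<And>x. x \<in> S \<Longrightarrow> (\<lambda>n. dterm (\<lambda>n. - of_real (ln (real n)) * c n) x n) sums g' x"
     "\<And>x. x \<in> S \<Longrightarrow> (g has_field_derivative g' x) (at x)" by blast
  have sS: "s \<in> S" using s by (simp add: S_def)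
  have eq: "g x = dseries c x" if "x \<in> S" for x
    using sums_unique[OF g(1)[OF that]] by (simp add: dseries_def)
  have eq': "g' s = dseries (\<lambda>n. - of_real (ln (real n)) * c n) s"
    using sums_unique[OF g(2)[OF sS]] by (simp add: dseries_def)
  show "(dseries c has_field_derivative dseries (\<lambda>n. - of_real (ln (real n)) * c n) s) (at s)"
    using has_field_derivative_transform_within_open[OF g(3)[OF sS] S sS] eq eq' by simp
  show "dterm (\<lambda>n. - of_real (ln (real n)) * c n) s sums dseries (\<lambda>n. - of_real (ln (real n)) * c n) s"
    using g(2)[OF sS] eq' by simp
qed

lemma dseries_holomorphic: "log_bounded c \<Longrightarrow> dseries c holomorphic_on {s. Re s > 1}"
  unfolding holomorphic_on_def field_differentiable_def
  using dseries_has_field_derivative(1) has_field_derivative_at_within by blast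

lemma nat_powr_mult: "of_nat (d * k) powr z = of_nat d powr z * (of_nat k powr z :: complex)"
  using powr_times_real[of "of_nat d" "of_nat k" z] by simp

text \<open>The divisor sum of \<open>mangoldt\<close> is \<open>ln\<close>, and complete
  multiplicativity of \<open>\<psi>\<close> carries the twist along. Absolute convergence permits
  regrouping the pairs \<open>(d, k)\<close> by their product.\<close>

lemma dseries_mangoldt_mult:
  assumes m: "m > 0" and \<psi>: "dchar m \<psi>" and s: "Re s > 1"
  shows "dseries (\<lambda>n. mangoldt n * \<psi> n) s * dseries \<psi> s = dseries (\<lambda>n. of_real (ln (real n)) * \<psi> n) s"
proof -
  have lb1: "log_bounded (\<lambda>n. mangoldt n * \<psi> n)"
    unfolding log_bounded_def
  proof (intro exI[of _ 1] allI impI)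
    fix n :: nat assume n: "n \<ge> 1"
    have "norm (mangoldt n * \<psi> n) \<le> mangoldt n * 1"
      unfolding norm_mult norm_mangoldt by (intro mult_left_mono norm_dchar_le[OF \<psi> m] mangoldt_nonneg)
    also have "\<dots> \<le> ln (real n)" using mangoldt_le[of n] n by simp
    finally show "norm (mangoldt n * \<psi> n) \<le> 1 * (1 + ln (real n))" by simp
  qed
  have lb2: "log_bounded \<psi>" using norm_dchar_le[OF \<psi> m] by (rule bounded_imp_log_bounded)
  define a b where "a = dterm (\<lambda>n. mangoldt n * \<psi> n) s" and "b = dterm \<psi> s"
  have sa: "(a has_sum dseries (\<lambda>n. mangoldt n * \<psi> n) s) UNIV"
    unfolding a_def by (intro norm_summable_imp_has_sum dseries_norm_summable dseries_sums lb1 s)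
  have sb: "(b has_sum dseries \<psi> s) UNIV"
    unfolding b_def by (intro norm_summable_imp_has_sum dseries_norm_summable dseries_sums lb2 s)
  have na: "(\<lambda>n. norm (a n)) summable_on UNIV" and nb: "(\<lambda>n. norm (b n)) summable_on UNIV"
    using norm_summable_imp_summable_on[of "\<lambda>n. norm (a n)"] norm_summable_imp_summable_on[of "\<lambda>n. norm (b n)"]
      dseries_norm_summable[OF lb1 s] dseries_norm_summable[OF lb2 s] by (auto simp: a_def b_def)
  have ab: "(\<lambda>x. norm (case x of (d, k) \<Rightarrow> a d * b k)) summable_on UNIV \<times> UNIV"
  proof (rule Infinite_Sum.abs_summable_on_Sigma_iff[THEN iffD2], intro conjI ballI)
    show "(\<lambda>y. norm (case (x, y) of (d, k) \<Rightarrow> a d * b k)) summable_on UNIV" for x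
      using summable_on_cmult_right[OF nb, of "norm (a x)"] by (simp add: norm_mult)
    have "(\<lambda>x. norm (a x) * infsum (\<lambda>k. norm (b k)) UNIV) summable_on UNIV"
      by (intro summable_on_cmult_left na)
    then show "(\<lambda>x. norm (\<Sum>\<^sub>\<infinity>y\<in>UNIV. norm (case (x, y) of (d, k) \<Rightarrow> a d * b k))) summable_on UNIV"
      by (simp add: norm_mult infsum_cmult_right' abs_mult infsum_nonneg)
  qed
  have "dseries (\<lambda>n. mangoldt n * \<psi> n) s * dseries \<psi> s = infsum a UNIV * infsum b UNIV"
    using sa sb by (simp add: infsumI)
  also have "\<dots> = (\<Sum>\<^sub>\<infinity>d. \<Sum>\<^sub>\<infinity>k. a d * b k)"
    by (simp add: infsum_cmult_right' infsum_cmult_left')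
  also have "\<dots> = (\<Sum>\<^sub>\<infinity>(d, k)\<in>UNIV \<times> UNIV. a d * b k)"
    using abs_summable_summable[OF ab] by (intro infsum_Sigma'_banach) simp
  \<comment> \<open>Pairs containing 0 contribute nothing; they are dropped because \<open>k\<close>
    could not be recovered from \<open>d * k\<close> and \<open>d\<close> when
    \<open>d = 0\<close>.\<close>
  also have "\<dots> = (\<Sum>\<^sub>\<infinity>(d, k)\<in>{1..} \<times> {1..}. a d * b k)"
  proof (rule infsum_cong_neutral)
    fix x assume "x \<in> (UNIV :: nat set) \<times> (UNIV :: nat set) - {1..} \<times> {1..}"
    then show "(case x of (d, k) \<Rightarrow> a d * b k) = 0"
      by (cases x) (auto simp: a_def b_def Suc_le_eq)
  qed auto
  also have "\<dots> = (\<Sum>\<^sub>\<infinity>(n, d)\<in>Sigma {1..} (\<lambda>n. {d. d dvd n}). a d * b (n div d))"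
  proof (rule infsum_reindex_bij_witness[where i = "\<lambda>(n, d). (d, n div d)" and j = "\<lambda>(d, k). (d * k, d)"])
    fix x :: "nat \<times> nat" assume "x \<in> Sigma {1..} (\<lambda>n. {d. d dvd n})"
    then show "(case case x of (n, d) \<Rightarrow> (d, n div d) of (d, k) \<Rightarrow> (d * k, d)) = x"
      "(case x of (n, d) \<Rightarrow> (d, n div d)) \<in> {1..} \<times> {1..}" 
      by (auto simp: Suc_le_eq elim!: dvdE)
  qed (auto simp: Suc_le_eq)
  also have "\<dots> = (\<Sum>\<^sub>\<infinity>n\<in>{1..}. \<Sum>\<^sub>\<infinity>d\<in>{d. d dvd n}. a d * b (n div d))"
  proof (rule infsum_Sigma'_banach[symmetric])
    have "(\<lambda>(d, k). a d * b k) summable_on {1..} \<times> {1..}"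
      by (rule summable_on_subset_banach[OF abs_summable_summable[OF ab]]) auto
    moreover have "(\<lambda>(d, k). a d * b k) summable_on {1..} \<times> {1..} \<longleftrightarrow>
        (\<lambda>(n, d). a d * b (n div d)) summable_on Sigma {1..} (\<lambda>n. {d. d dvd n})"
    proof (rule summable_on_reindex_bij_witness[where i = "\<lambda>(n, d). (d, n div d)" and j = "\<lambda>(d, k). (d * k, d)"])
      fix x :: "nat \<times> nat" assume "x \<in> Sigma {1..} (\<lambda>n. {d. d dvd n})"
      then show "(case case x of (n, d) \<Rightarrow> (d, n div d) of (d, k) \<Rightarrow> (d * k, d)) = x"
        "(case x of (n, d) \<Rightarrow> (d, n div d)) \<in> {1..} \<times> {1..}" 
        by (auto simp: Suc_le_eq elim!: dvdE)
    qed (auto simp: Suc_le_eq)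
    ultimately show "(\<lambda>(n, d). a d * b (n div d)) summable_on Sigma {1..} (\<lambda>n. {d. d dvd n})" by blast
  qed
  also have "\<dots> = (\<Sum>\<^sub>\<infinity>n\<in>{1..}. dterm (\<lambda>n. of_real (ln (real n)) * \<psi> n) s n)"
  proof (rule infsum_cong)
    fix n :: nat assume n: "n \<in> {1..}"
    then have fin: "finite {d. d dvd n}" by simp
    have "a d * b (n div d) = mangoldt d * (\<psi> n * of_nat n powr (-s))" if dn: "d dvd n" for d
    proof -
      obtain k where k: "n = d * k" using dn by blast
      then have "d > 0" using n by (cases "d = 0") auto
      then have "n div d = k" using k by simp
      then show ?thesis unfolding a_def b_def dterm_def k
        using dcharD(3)[OF \<psi>, of d k] nat_powr_mult[of d k "-s"] by simp
    qed
    then have "(\<Sum>\<^sub>\<infinity>d\<in>{d. d dvd n}. a d * b (n div d)) = (\<Sum>d\<in>{d. d dvd n}. mangoldt d * (\<psi> n * of_nat n powr (-s)))"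
      using fin by (simp add: infsum_finite)
    also have "\<dots> = of_real (ln (real n)) * (\<psi> n * of_nat n powr (-s))"
      using mangoldt_sum[of n, where 'a = complex] n by (simp flip: sum_distrib_right)
    finally show "(\<Sum>\<^sub>\<infinity>d\<in>{d. d dvd n}. a d * b (n div d)) = dterm (\<lambda>n. of_real (ln (real n)) * \<psi> n) s n"
      by (simp add: dterm_def)
  qed
  also have "\<dots> = (\<Sum>\<^sub>\<infinity>n. dterm (\<lambda>n. of_real (ln (real n)) * \<psi> n) s n)"
    by (rule infsum_cong_neutral) (auto simp: Suc_le_eq)
  also have "\<dots> = dseries (\<lambda>n. of_real (ln (real n)) * \<psi> n) s"
  proof -
    have "log_bounded (\<lambda>n. of_real (ln (real n)) * \<psi> n)"
      unfolding log_bounded_def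
    proof (intro exI[of _ 1] allI impI)
      fix n :: nat assume n: "n \<ge> 1"
      have "norm (of_real (ln (real n)) * \<psi> n) \<le> ln (real n) * 1"
        unfolding norm_mult using n by (intro mult_mono norm_dchar_le[OF \<psi> m]) auto
      then show "norm (of_real (ln (real n)) * \<psi> n) \<le> 1 * (1 + ln (real n))" by simp
    qed
    then show ?thesis by (intro infsumI norm_summable_imp_has_sum dseries_norm_summable dseries_sums s)
  qed
  finally show ?thesis .
qed

section \<open>Continuation to the half plane Re s > 0\<close>

lemma powr_diff_bound:
  fixes s :: complex and n :: nat
  assumes n: "n \<ge> 1" and s: "Re s > 0" and u: "real n \<le> u" "u \<le> real n + 1"
  shows "norm (of_real u powr (-s) - of_nat n powr (-s)) \<le> norm s * real n powr (- Re s - 1)"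
proof -
  define S where "S = complex_of_real ` {real n..real n + 1}"
  have conv: "convex S"
    unfolding S_def by (intro convex_linear_image linearI) (auto simp: scaleR_conv_of_real)
  have "norm (of_real u powr (-s) - of_real (real n) powr (-s)) \<le> norm s * real n powr (- Re s - 1) * norm (of_real u - of_real (real n) :: complex)"
  proof (rule field_differentiable_bound[OF conv])
    fix z assume "z \<in> S"
    then obtain v where v: "z = of_real v" "real n \<le> v" "v \<le> real n + 1" by (auto simp: S_def)
    have v0: "v > 0" using v n by linarith
    then have "z \<notin> \<real>\<^sub>\<le>\<^sub>0" using v by simp
    then show "((\<lambda>z. z powr (-s)) has_field_derivative (-s) * z powr (-s - 1)) (at z within S)"
      by (rule has_field_derivative_at_within[OF has_field_derivative_powr])
    have "norm (z powr (-s - 1)) = v powr (- Re s - 1)"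
      using v v0 norm_powr_real_powr[of z "-s - 1"] by simp
    also have "\<dots> \<le> real n powr (- Re s - 1)" using v n s by (intro powr_mono2') auto
    finally show "norm (- s * z powr (- s - 1)) \<le> norm s * real n powr (- Re s - 1)"
      by (simp add: norm_mult mult_left_mono)
  qed (use u in \<open>auto simp: S_def simp del: of_real_of_nat_eq\<close>)
  also have "norm (of_real u - of_real (real n) :: complex) = u - real n"
    using u by (metis abs_of_nonneg diff_ge_0_iff_ge norm_of_real of_real_diff)
  also have "norm s * real n powr (- Re s - 1) * (u - real n) \<le> norm s * real n powr (- Re s - 1) * 1"
    using u by (intro mult_left_mono) auto
  finally show ?thesis by simp
qed

text \<open>The expression is \<open>s - 1\<close> times the difference between
  \<open>n powr (-s)\<close> and the integral of \<open>u powr (-s)\<close> from \<open>n\<close> to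
  \<open>n + 1\<close>. The mean value inequality gains a factor \<open>1 / n\<close> over the
  single terms.\<close>

lemma zeta_term_bound:
  fixes s :: complex and n :: nat
  assumes n: "n \<ge> 1" and s: "Re s > 0"
  shows "norm ((s - 1) * of_nat n powr (-s) + of_nat (Suc n) powr (1 - s) - of_nat n powr (1 - s))
      \<le> norm (s - 1) * norm s * real n powr (- Re s - 1)"
proof -
  define S where "S = complex_of_real ` {real n..real n + 1}"
  have conv: "convex S"
    unfolding S_def by (intro convex_linear_image linearI) (auto simp: scaleR_conv_of_real)
  define g where "g w = (s - 1) * of_nat n powr (-s) * w + w powr (1 - s)" for w
  have "norm (g (of_real (real n + 1)) - g (of_real (real n))) \<le>
      norm (s - 1) * norm s * real n powr (- Re s - 1) * norm (of_real (real n + 1) - of_real (real n) :: complex)"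
  proof (rule field_differentiable_bound[OF conv])
    fix z assume "z \<in> S"
    then obtain v where v: "z = of_real v" "real n \<le> v" "v \<le> real n + 1" by (auto simp: S_def)
    have v0: "v > 0" using v n by linarith
    then have "z \<notin> \<real>\<^sub>\<le>\<^sub>0" using v by simp
    then have "((\<lambda>z. z powr (1 - s)) has_field_derivative (1 - s) * z powr (1 - s - 1)) (at z within S)"
      by (rule has_field_derivative_at_within[OF has_field_derivative_powr])
    then have "(g has_field_derivative (s - 1) * of_nat n powr (-s) * 1 + (1 - s) * z powr (1 - s - 1)) (at z within S)"
      unfolding g_def by (intro DERIV_add DERIV_cmult DERIV_ident)
    then show "(g has_field_derivative (s - 1) * of_nat n powr (-s) + (1 - s) * z powr (- s)) (at z within S)"
      by simp
    have "(s - 1) * of_nat n powr (-s) + (1 - s) * z powr (- s) = (1 - s) * (z powr (-s) - of_nat n powr (-s))"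
      by (simp add: algebra_simps)
    also have "norm \<dots> \<le> norm (s - 1) * (norm s * real n powr (- Re s - 1))"
      unfolding norm_mult norm_minus_commute[of 1 s] v(1) using v n s by (intro mult_left_mono powr_diff_bound) auto
    finally show "norm ((s - 1) * of_nat n powr (-s) + (1 - s) * z powr (- s)) \<le> norm (s - 1) * norm s * real n powr (- Re s - 1)"
      by (simp add: mult.assoc)
  qed (auto simp: S_def simp del: of_real_of_nat_eq of_real_add of_real_1)
  also have "norm (of_real (real n + 1) - of_real (real n) :: complex) = 1" by simp
  also have "g (of_real (real n + 1)) - g (of_real (real n)) =
     (s - 1) * of_nat n powr (-s) + of_nat (Suc n) powr (1 - s) - of_nat n powr (1 - s)"
    by (simp add: g_def algebra_simps)
  finally show ?thesis by simp
qed

text \<open>Near \<open>x\<close> the terms are dominated by a multiple of \<open>n powr (-1 - Re x / 2)\<close>, so the series converges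
  locally uniformly.\<close>
lemma half_plane_series:
  fixes f :: "nat \<Rightarrow> complex \<Rightarrow> complex" and Q :: "complex \<Rightarrow> real"
  assumes hol: "\<And>n s. Re s > 0 \<Longrightarrow> f n field_differentiable (at s)"
    and Q: "continuous_on UNIV Q"
    and bound: "\<And>n s. n \<ge> 1 \<Longrightarrow> Re s > 0 \<Longrightarrow> norm (f n s) \<le> Q s * real n powr (- Re s - 1)"
  obtains g where "g holomorphic_on {s. Re s > 0}" "\<And>s. Re s > 0 \<Longrightarrow> (\<lambda>n. f n s) sums g s"
proof -
  define S where "S = {s. Re s > 0}"
  have S: "open S" unfolding S_def by (rule open_halfspace_Re_gt)
  have "\<exists>g g'. \<forall>x\<in>S. ((\<lambda>n. f n x) sums g x) \<and> ((\<lambda>n. deriv (f n) x) sums g' x) \<and> (g has_field_derivative g' x) (at x)"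
  proof (rule series_and_derivative_comparison_local[OF S])
    show "(f n has_field_derivative deriv (f n) x) (at x)" if "x \<in> S" for n x
      using hol[of x n] that by (simp add: S_def DERIV_deriv_iff_field_differentiable)
  next
    fix x assume x: "x \<in> S"
    define d where "d = Re x / 2"
    have d: "d > 0" using x by (simp add: d_def S_def)
    have "bounded (Q ` cball x d)"
      by (intro compact_imp_bounded compact_continuous_image continuous_on_subset[OF Q]) auto
    then obtain C where C: "\<And>y. y \<in> cball x d \<Longrightarrow> \<bar>Q y\<bar> \<le> C"
      unfolding bounded_iff by (metis image_eqI real_norm_def)
    have "norm (f n y) \<le> C * real n powr (- d - 1)" if n: "n \<ge> 1" and y: "y \<in> ball x d \<inter> S" for n y
    proof -
      have "Re x - Re y \<le> norm (x - y)" using complex_Re_le_cmod[of "x - y"] by simp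
      also have "\<dots> < d" using y by (simp add: dist_norm)
      finally have ry: "Re y > d" by (simp add: d_def field_simps)
      have "norm (f n y) \<le> Q y * real n powr (- Re y - 1)" using n y by (intro bound) (auto simp: S_def)
      also have "\<dots> \<le> C * real n powr (- d - 1)"
        using C[of y] y n ry by (intro mult_mono powr_mono) auto
      finally show ?thesis .
    qed
    moreover have "summable (\<lambda>n. C * real n powr (- d - 1))"
      using d by (intro summable_mult) (simp add: summable_real_powr_iff)
    ultimately show "\<exists>d h. 0 < d \<and> summable h \<and> (\<forall>\<^sub>F n in sequentially. \<forall>y\<in>ball x d \<inter> S. norm (f n y) \<le> h n)"
      using d by (intro exI[of _ d] exI[of _ "\<lambda>n. C * real n powr (- d - 1)"]) (auto intro!: eventually_sequentiallyI[of 1])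
  qed
  then obtain g g' where g: "\<And>x. x \<in> S \<Longrightarrow> (\<lambda>n. f n x) sums g x" "\<And>x. x \<in> S \<Longrightarrow> (g has_field_derivative g' x) (at x)"
    by blast
  show ?thesis
  proof (rule that[of g])
    show "g holomorphic_on {s. Re s > 0}"
      using g(2) has_field_derivative_at_within unfolding holomorphic_on_def field_differentiable_def S_def by blast
  qed (use g(1) in \<open>auto simp: S_def\<close>)
qed

lemma nat_powr_tendsto_0: 
  fixes s :: complex assumes "Re s > 0" shows "(\<lambda>n. of_nat n powr (-s)) \<longlonglongrightarrow> (0 :: complex)"
proof (rule tendsto_norm_zero_cancel)
  have "(\<lambda>n. real n powr (- Re s)) \<longlonglongrightarrow> 0"
    using assms by (intro tendsto_neg_powr filterlim_real_sequentially) auto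
  then show "(\<lambda>n. norm (of_nat n powr (-s) :: complex)) \<longlonglongrightarrow> 0" by (simp add: norm_nat_powr)
qed

lemma nat_powr_field_differentiable:
  assumes "n > 0" "f field_differentiable (at s)"
  shows "(\<lambda>z. of_nat n powr f z :: complex) field_differentiable (at s)"
proof -
  obtain f' where "(f has_field_derivative f') (at s)" using assms(2) by (auto simp: field_differentiable_def)
  from DERIV_chain2[OF has_field_derivative_powr_right this, of "of_nat n"] assms(1)
  show ?thesis by (auto simp: field_differentiable_def)
qed

text \<open>Summation by parts pairs bounded coefficient sums with differences of consecutive
  powers; these gain a factor \<open>1 / n\<close>, so \<open>half_plane_series\<close>
  applies.\<close>

lemma abel_dirichlet_series:
  assumes bound: "\<And>n. norm (\<Sum>k<n. c k) \<le> (M :: real)"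
  obtains H where "H holomorphic_on {s. Re s > 0}" "\<And>s. Re s > 0 \<Longrightarrow> dterm c s sums H s"
proof -
  define C where "C n = (\<Sum>k<n. c k)" for n
  define f where "f n s = C (Suc n) * (of_nat n powr (-s) - of_nat (Suc n) powr (-s))" for n and s :: complex
  have M: "M \<ge> 0" using order_trans[OF norm_ge_zero bound[of 0]] .
  obtain H where H: "H holomorphic_on {s. Re s > 0}" "\<And>s. Re s > 0 \<Longrightarrow> (\<lambda>n. f n s) sums H s"
  proof (rule half_plane_series[of f "\<lambda>s. M * norm s"])
    show "f n field_differentiable (at s)" for n s
    proof (cases "n = 0")
      case False
      then show ?thesis unfolding f_def
        by (intro derivative_intros nat_powr_field_differentiable) auto
    next
      case True
      then show ?thesis unfolding f_def by simp
    qed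
    show "norm (f n s) \<le> M * norm s * real n powr (- Re s - 1)" if "n \<ge> 1" "Re s > 0" for n s
    proof -
      have "norm (of_nat n powr (-s) - of_nat (Suc n) powr (-s) :: complex) \<le> norm s * real n powr (- Re s - 1)"
        using powr_diff_bound[OF that, of "real (Suc n)"] by (simp add: norm_minus_commute add.commute)
      then have "norm (f n s) \<le> M * (norm s * real n powr (- Re s - 1))"
        unfolding f_def norm_mult C_def using M by (intro mult_mono bound) auto
      then show ?thesis by (simp add: mult.assoc)
    qed
  qed (auto intro!: continuous_intros)
  show ?thesis
  proof (rule that[OF H(1)])
    fix s assume s: "Re s > 0"
    have part: "(\<Sum>n<N. dterm c s n) = (\<Sum>n<N. f n s) + C N * of_nat N powr (-s)" for N
    proof (induction N)
      case (Suc N)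
      have "C (Suc N) = C N + c N" by (simp add: C_def)
      then show ?case using Suc by (simp add: f_def dterm_def algebra_simps)
    qed (simp add: C_def)
    have "(\<lambda>N. C N * of_nat N powr (-s)) \<longlonglongrightarrow> 0"
    proof (rule Lim_null_comparison)
      show "\<forall>\<^sub>F N in sequentially. norm (C N * of_nat N powr (-s)) \<le> M * norm (of_nat N powr (-s) :: complex)"
        using bound by (intro always_eventually allI) (simp add: C_def norm_mult mult_right_mono)
      show "(\<lambda>N. M * norm (of_nat N powr (-s) :: complex)) \<longlonglongrightarrow> 0"
        using tendsto_mult[OF tendsto_const[of M] tendsto_norm[OF nat_powr_tendsto_0[OF s]]] by simp
    qed
    then have "(\<lambda>N. (\<Sum>n<N. f n s) + C N * of_nat N powr (-s)) \<longlonglongrightarrow> H s + 0"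
      using H(2)[OF s] unfolding sums_def by (intro tendsto_add)
    then show "dterm c s sums H s" unfolding sums_def part by simp
  qed
qed

text \<open>\<open>Z\<close> is \<open>s - 1\<close> times the zeta function, with the pole removed:
  each term is compared with an integral, and the integrals telescope.\<close>

lemma zeta_extension:
  obtains Z where "Z holomorphic_on {s. Re s > 0}" "Z 1 = 1"
    "\<And>s. Re s > 1 \<Longrightarrow> Z s = (s - 1) * dseries (\<lambda>_. 1) s"
proof -
  \<comment> \<open>The value 1 at \<open>n = 0\<close> is the starting value of the telescoping
    powers \<open>n powr (1 - s)\<close>.\<close>
  define f where "f n s = (if n = 0 then 1 else (s - 1) * of_nat n powr (-s) + of_nat (Suc n) powr (1 - s) - of_nat n powr (1 - s))"
    for n :: nat and s :: complex
  obtain Z where Z: "Z holomorphic_on {s. Re s > 0}" "\<And>s. Re s > 0 \<Longrightarrow> (\<lambda>n. f n s) sums Z s"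
  proof (rule half_plane_series[of f "\<lambda>s. norm (s - 1) * norm s"])
    show "f n field_differentiable (at s)" for n s
    proof (cases "n = 0")
      case False
      then have "(\<lambda>s. (s - 1) * of_nat n powr (-s) + of_nat (Suc n) powr (1 - s) - of_nat n powr (1 - s) :: complex)
          field_differentiable (at s)"
        by (intro derivative_intros nat_powr_field_differentiable) auto
      moreover have "f n = (\<lambda>s. (s - 1) * of_nat n powr (-s) + of_nat (Suc n) powr (1 - s) - of_nat n powr (1 - s))"
        by (intro ext) (simp only: f_def False if_False)
      ultimately show ?thesis by simp
    next
      case True
      then have "f n = (\<lambda>_. 1)" by (simp add: f_def fun_eq_iff)
      then show ?thesis by simp
    qed
    show "norm (f n s) \<le> norm (s - 1) * norm s * real n powr (- Re s - 1)" if "n \<ge> 1" "Re s > 0" for n s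
      using zeta_term_bound[OF that] that by (simp add: f_def)
  qed (auto intro!: continuous_intros)
  show ?thesis
  proof (rule that[OF Z(1)])
    have "f n 1 = (if n = 0 then 1 else 0)" for n by (simp add: f_def del: of_nat_Suc)
    then have "(\<lambda>n. f n 1) sums 1" using sums_single[of 0 "\<lambda>_. 1 :: complex"] by simp
    then show "Z 1 = 1" using Z(2)[of 1] sums_unique2 by force
    fix s assume s: "Re s > 1"
    have tail: "(\<lambda>n. (of_nat n powr (1 - s) :: complex)) \<longlonglongrightarrow> 0"
      using nat_powr_tendsto_0[of "s - 1"] s by simp
    have part: "(\<Sum>n<Suc N. f n s) = (s - 1) * (\<Sum>n<Suc N. dterm (\<lambda>_. 1) s n) + of_nat (Suc N) powr (1 - s)" for N
      by (induction N) (auto simp: f_def dterm_def algebra_simps)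
    have "(\<lambda>N. (s - 1) * (\<Sum>n<Suc N. dterm (\<lambda>_. 1) s n) + of_nat (Suc N) powr (1 - s)) \<longlonglongrightarrow> (s - 1) * dseries (\<lambda>_. 1) s + 0"
      using dseries_sums[of "\<lambda>_. 1" s] bounded_imp_log_bounded[of "\<lambda>_. 1" 1] s
      by (intro tendsto_add tendsto_mult tendsto_const LIMSEQ_Suc tail) (auto simp: sums_def)
    then have "(\<lambda>N. \<Sum>n<Suc N. f n s) \<longlonglongrightarrow> (s - 1) * dseries (\<lambda>_. 1) s" unfolding part by simp
    moreover have "(\<lambda>N. \<Sum>n<Suc N. f n s) \<longlonglongrightarrow> Z s"
      using Z(2)[of s] s by (intro LIMSEQ_Suc) (auto simp: sums_def)
    ultimately show "Z s = (s - 1) * dseries (\<lambda>_. 1) s" by (rule LIMSEQ_unique[symmetric])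
  qed
qed

lemma periodic_sum_bound:
  fixes c :: "nat \<Rightarrow> complex"
  assumes m: "m > 0" and per: "\<And>a b. [a = b] (mod m) \<Longrightarrow> c a = c b" and zero: "(\<Sum>a<m. c a) = 0"
    and bound: "\<And>n. norm (c n) \<le> C"
  shows "norm (\<Sum>k<n. c k) \<le> real m * C"
proof -
  have split: "(\<Sum>k<m + n. c k) = (\<Sum>k<m. c k) + (\<Sum>k<n. c (k + m))" for n
    by (induction n) (auto simp: add_ac)
  have "(\<Sum>k<q * m + l. c k) = (\<Sum>k<l. c k)" for q l
  proof (induction q)
    case (Suc q)
    have "(\<Sum>k<Suc q * m + l. c k) = (\<Sum>k<m + (q * m + l). c k)" by (simp add: algebra_simps)
    also have "\<dots> = (\<Sum>k<m. c k) + (\<Sum>k<q * m + l. c (k + m))"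
      by (rule split)
    also have "(\<Sum>k<q * m + l. c (k + m)) = (\<Sum>k<q * m + l. c k)"
      by (intro sum.cong refl per) (simp add: cong_def)
    finally show ?case using Suc zero by simp
  qed simp
  from this[of "n div m" "n mod m"] have "(\<Sum>k<n. c k) = (\<Sum>k<n mod m. c k)" by simp
  also have "norm \<dots> \<le> (\<Sum>k<n mod m. C)" by (intro order_trans[OF norm_sum] sum_mono bound)
  also have "\<dots> = real (n mod m) * C" by simp
  also have "\<dots> \<le> real m * C"
    using m order_trans[OF norm_ge_zero bound[of 0]] by (intro mult_right_mono) auto
  finally show ?thesis .
qed

text \<open>The sum of a nonprincipal character over a period vanishes, so summation by parts
  applies directly. From the principal one its mean \<open>\<rho>\<close> is split off first; that
  part contributes \<open>\<rho>\<close> times zeta, whence \<open>F 1 = \<rho>\<close>.\<close>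

lemma L_extension:
  assumes m: "m > 0" and \<psi>: "dchar m \<psi>"
  obtains F where "F holomorphic_on {s. Re s > 0}"
    "\<And>s. Re s > 1 \<Longrightarrow> F s = (if \<psi> = principal_char m then s - 1 else 1) * dseries \<psi> s"
    "\<psi> = principal_char m \<Longrightarrow> F 1 \<noteq> 0"
    "\<psi> \<noteq> principal_char m \<Longrightarrow> (\<lambda>n. \<psi> n / of_nat n) sums F 1"
proof (cases "\<psi> = principal_char m")
  case False
  have "norm (\<Sum>k<n. \<psi> k) \<le> real m * 1" for n
    using unit_fun_cong[OF dcharD(1)[OF \<psi>]] sum_dchar_nonprincipal[OF m \<psi> False] norm_dchar_le[OF \<psi> m]
    by (intro periodic_sum_bound[OF m]) auto
  then obtain H where H: "H holomorphic_on {s. Re s > 0}" "\<And>s. Re s > 0 \<Longrightarrow> dterm \<psi> s sums H s"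
    using abel_dirichlet_series by blast
  show ?thesis
  proof (rule that[OF H(1)])
    have "dterm \<psi> 1 n = \<psi> n / of_nat n" for n
      by (cases "n = 0") (auto simp: dterm_def powr_minus divide_inverse)
    then have "dterm \<psi> 1 = (\<lambda>n. \<psi> n / of_nat n)" by (rule ext)
    then show "(\<lambda>n. \<psi> n / of_nat n) sums H 1" using H(2)[of 1] by simp
    show "H s = (if \<psi> = principal_char m then s - 1 else 1) * dseries \<psi> s" if "Re s > 1" for s
      using sums_unique[OF H(2)[of s]] that False by (simp add: dseries_def)
  qed (use False in auto)
next
  case True
  define \<rho> :: complex where "\<rho> = of_nat (totient m) / of_nat m"
  have \<rho>: "\<rho> \<noteq> 0" using m by (simp add: \<rho>_def)
  define c where "c n = \<psi> n - \<rho>" for n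
  have "norm (\<Sum>k<n. c k) \<le> real m * (1 + norm \<rho>)" for n
  proof (rule periodic_sum_bound[OF m])
    show "c a = c b" if "[a = b] (mod m)" for a b
      using unit_fun_cong[OF dcharD(1)[OF \<psi>] that] by (simp add: c_def)
    show "(\<Sum>a<m. c a) = 0" using sum_principal_char[OF m] True m by (simp add: c_def sum_subtractf \<rho>_def)
    show "norm (c n) \<le> 1 + norm \<rho>" for n
      unfolding c_def using norm_dchar_le[OF \<psi> m, of n] by (intro order_trans[OF norm_triangle_ineq4]) simp
  qed
  then obtain H where H: "H holomorphic_on {s. Re s > 0}" "\<And>s. Re s > 0 \<Longrightarrow> dterm c s sums H s"
    using abel_dirichlet_series by blast
  obtain Z where Z: "Z holomorphic_on {s. Re s > 0}" "Z 1 = 1"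
    "\<And>s. Re s > 1 \<Longrightarrow> Z s = (s - 1) * dseries (\<lambda>_. 1) s" using zeta_extension by blast
  show ?thesis
  proof (rule that[of "\<lambda>s. (s - 1) * H s + \<rho> * Z s"])
    show "(\<lambda>s. (s - 1) * H s + \<rho> * Z s) holomorphic_on {s. Re s > 0}"
      using H Z by (intro holomorphic_intros)
    show "(s - 1) * H s + \<rho> * Z s = (if \<psi> = principal_char m then s - 1 else 1) * dseries \<psi> s" if s: "Re s > 1" for s
    proof -
      have "(\<lambda>n. dterm c s n + \<rho> * dterm (\<lambda>_. 1) s n) sums (H s + \<rho> * dseries (\<lambda>_. 1) s)"
        using s H(2)[of s] bounded_imp_log_bounded[of "\<lambda>_. 1" 1] by (intro sums_add sums_mult dseries_sums) auto
      moreover have "dterm c s n + \<rho> * dterm (\<lambda>_. 1) s n = dterm \<psi> s n" for n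
        by (simp add: c_def dterm_def algebra_simps)
      ultimately have "H s + \<rho> * dseries (\<lambda>_. 1) s = dseries \<psi> s" by (simp add: dseries_def sums_iff)
      then have "(s - 1) * (H s + \<rho> * dseries (\<lambda>_. 1) s) = (s - 1) * dseries \<psi> s" by simp
      moreover have "(s - 1) * H s + \<rho> * Z s = (s - 1) * (H s + \<rho> * dseries (\<lambda>_. 1) s)"
        unfolding Z(3)[OF s] by (simp add: distrib_left mult.left_commute)
      ultimately show ?thesis using True by simp
    qed
  qed (use True Z(2) \<rho> in auto)
qed

section \<open>Nonvanishing on the line\<close>

lemma divisor_sum_mult:
  fixes c :: "nat \<Rightarrow> real"
  assumes c: "\<And>x y. c (x * y) = c x * c y" and ab: "coprime a b" "a > 0" "b > 0"
  shows "(\<Sum>d | d dvd a * b. c d) = (\<Sum>d | d dvd a. c d) * (\<Sum>d | d dvd b. c d)"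
proof -
  have "(\<Sum>d | d dvd a. c d) * (\<Sum>d | d dvd b. c d) = (\<Sum>(x, y)\<in>{d. d dvd a} \<times> {d. d dvd b}. c (x * y))"
    unfolding sum_product sum.cartesian_product c by (rule refl)
  also have "\<dots> = (\<Sum>x\<in>{d. d dvd a} \<times> {d. d dvd b}. c (fst x * snd x))"
    by (simp add: split_beta)
  also have "\<dots> = (\<Sum>d | d dvd a * b. c d)"
  proof (rule sum.reindex_bij_betw[where h = "\<lambda>x. fst x * snd x" and g = c])
    show "bij_betw (\<lambda>x. fst x * snd x) ({d. d dvd a} \<times> {d. d dvd b}) {d. d dvd a * b}"
      unfolding bij_betw_def
    proof
      show "inj_on (\<lambda>x. fst x * snd x) ({d. d dvd a} \<times> {d. d dvd b})"
      proof (rule inj_onI)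
        fix u v assume uv: "u \<in> {d. d dvd a} \<times> {d. d dvd b}" "v \<in> {d. d dvd a} \<times> {d. d dvd b}"
          "fst u * snd u = fst v * snd v"
        have "fst u dvd a" "snd u dvd b" "fst v dvd a" "snd v dvd b" using uv(1,2) by auto
        then have "coprime (fst u) (snd v)" "coprime (fst v) (snd u)"
          using ab(1) by (meson coprime_divisors)+
        then show "u = v" using uv(3) coprime_crossproduct_nat[of "fst u" "snd v" "fst v" "snd u"]
          by (simp add: prod_eq_iff mult.commute)
      qed
      show "(\<lambda>x. fst x * snd x) ` ({d. d dvd a} \<times> {d. d dvd b}) = {d. d dvd a * b}"
      proof (intro equalityI subsetI)
        fix d assume "d \<in> {d. d dvd a * b}"
        then obtain x y where "d = x * y" "x dvd a" "y dvd b" using division_decomp by blast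
        then show "d \<in> (\<lambda>x. fst x * snd x) ` ({d. d dvd a} \<times> {d. d dvd b})"
          by (intro image_eqI[of _ _ "(x, y)"]) auto
      qed (auto intro: mult_dvd_mono)
    qed
  qed
  finally show ?thesis by simp
qed

text \<open>The sum is geometric in \<open>c p\<close>; for \<open>c p = -1\<close> it is 1 or 0
  according to the parity of \<open>k\<close>.\<close>

lemma divisor_sum_prime_power:
  fixes c :: "nat \<Rightarrow> real"
  assumes c: "\<And>x y. c (x * y) = c x * c y" "c 1 = 1" "c p \<in> {-1, 0, 1}" and p: "prime p"
  shows "(\<Sum>d | d dvd p ^ k. c d) \<ge> 0" "even k \<Longrightarrow> (\<Sum>d | d dvd p ^ k. c d) \<ge> 1"
proof -
  have pow: "c (p ^ i) = c p ^ i" for i by (induction i) (simp_all add: c del: One_nat_def)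
  have "{d. d dvd p ^ k} = (\<lambda>i. p ^ i) ` {..k}" using p by (auto simp: divides_primepow_nat le_imp_power_dvd)
  moreover have "inj_on (\<lambda>i. p ^ i) {..k}" using prime_gt_1_nat[OF p] by (auto intro!: inj_onI)
  ultimately have "(\<Sum>d | d dvd p ^ k. c d) = (\<Sum>i\<le>k. c p ^ i)"
    by (simp only: sum.reindex o_def pow)
  moreover have "(\<Sum>i\<le>k. (-1) ^ i :: real) = (if even k then 1 else 0)" by (induction k) auto
  moreover have "(\<Sum>i\<le>k. 0 ^ i :: real) = 1" by (induction k) auto
  ultimately have "(\<Sum>d | d dvd p ^ k. c d) \<ge> (if even k then 1 else 0)"
    using c(3) by auto
  then show "(\<Sum>d | d dvd p ^ k. c d) \<ge> 0" "even k \<Longrightarrow> (\<Sum>d | d dvd p ^ k. c d) \<ge> 1"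
    by (auto split: if_splits)
qed

text \<open>Induction splits off the full power of one prime. For a square this exponent is even and
  the cofactor is again a square.\<close>

lemma divisor_sum_real_char:
  fixes c :: "nat \<Rightarrow> real"
  assumes c: "\<And>x y. c (x * y) = c x * c y" "c 1 = 1" "\<And>x. c x \<in> {-1, 0, 1}" and n: "n > 0"
  shows "(\<Sum>d | d dvd n. c d) \<ge> 0 \<and> ((\<exists>k. n = k ^ 2) \<longrightarrow> (\<Sum>d | d dvd n. c d) \<ge> 1)"
  using n
proof (induction n rule: less_induct)
  case (less n)
  show ?case
  proof (cases "n = 1")
    case True
    then show ?thesis using c by simp
  next
    case False
    then obtain p where p: "prime p" "p dvd n" using prime_factor_nat by blast
    define k where "k = multiplicity p n"
    obtain q where q: "n = p ^ k * q" "\<not> p dvd q"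
      using multiplicity_decompose'[of n p] p(1) less.prems not_prime_unit[of p] unfolding k_def by (metis less_irrefl)
    have k: "k > 0" using p less.prems by (simp add: k_def prime_multiplicity_gt_zero_iff)
    have q0: "q > 0" using q less.prems by (cases q) auto
    have "1 * q < p ^ k * q" using p k q0 by (intro mult_strict_right_mono one_less_power prime_gt_1_nat) auto
    then have qn: "q < n" using q by simp
    have cop: "coprime (p ^ k) q" using p q by (simp add: prime_imp_coprime)
    have eq: "(\<Sum>d | d dvd n. c d) = (\<Sum>d | d dvd p ^ k. c d) * (\<Sum>d | d dvd q. c d)"
      unfolding q(1) using p q0 by (intro divisor_sum_mult c cop) (auto simp: prime_gt_0_nat)
    note pk = divisor_sum_prime_power[of c p k, OF c(1,2,3) p(1)]
    have IH: "(\<Sum>d | d dvd q. c d) \<ge> 0" "(\<exists>j. q = j ^ 2) \<Longrightarrow> (\<Sum>d | d dvd q. c d) \<ge> 1"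
      using less.IH[OF qn q0] by auto
    show ?thesis
    proof (intro conjI impI)
      show "(\<Sum>d | d dvd n. c d) \<ge> 0" using eq pk(1) IH(1) by simp
      assume "\<exists>j. n = j ^ 2"
      then obtain j where j: "n = j ^ 2" by blast
      have j0: "j > 0" using j less.prems by (cases j) auto
      define e where "e = multiplicity p j"
      have ke: "k = 2 * e" unfolding k_def j e_def using p j0 by (simp add: prime_elem_multiplicity_power_distrib)
      have "p ^ e dvd j" unfolding e_def by (rule multiplicity_dvd)
      then obtain i where i: "j = p ^ e * i" by (elim dvdE)
      have "p ^ k * q = (p ^ e * i) ^ 2" using q(1) j unfolding i by simp
      also have "\<dots> = p ^ k * i ^ 2" by (simp add: ke power_mult_distrib power_mult[symmetric] mult.commute)
      finally have "p ^ k * q = p ^ k * i ^ 2" .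
      then have "q = i ^ 2" using p by (simp add: prime_gt_0_nat)
      then have "(\<Sum>d | d dvd q. c d) \<ge> 1" using IH(2) by blast
      then show "(\<Sum>d | d dvd n. c d) \<ge> 1" using eq pk(2) ke by (simp add: mult_ge1_I)
    qed
  qed
qed

text \<open>With \<open>u = sqrt t\<close>, pairing \<open>t ^ i\<close> with
  \<open>t ^ (n - i)\<close> bounds the second sum below by \<open>(n + 1) * u ^ n\<close>. The
  product of two consecutive bounds has exponent \<open>2 * n - 1\<close>, and one more factor
  \<open>u \<le> 1\<close> is given away. This is the monotonicity behind the Lambert
  estimate.\<close>

lemma geometric_AM_GM:
  fixes t :: real
  assumes t: "0 < t" "t \<le> 1"
  shows "real n * real (Suc n) * t ^ n \<le> (\<Sum>i<n. t ^ i) * (\<Sum>i<Suc n. t ^ i)"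
proof -
  define u where "u = sqrt t"
  have u: "u > 0" "t = u ^ 2" using t by (auto simp: u_def)
  have key: "real (Suc n) * u ^ n \<le> (\<Sum>i<Suc n. t ^ i)" for n
  proof -
    have "2 * (real (Suc n) * u ^ n) = (\<Sum>i<Suc n. 2 * u ^ n)" by simp
    also have "\<dots> \<le> (\<Sum>i<Suc n. t ^ i + t ^ (n - i))"
    proof (rule sum_mono)
      fix i assume "i \<in> {..<Suc n}"
      then have i: "u ^ i * u ^ (n - i) = u ^ n" by (simp flip: power_add)
      have "0 \<le> (u ^ i - u ^ (n - i)) ^ 2" by simp
      also have "\<dots> = t ^ i + t ^ (n - i) - 2 * (u ^ i * u ^ (n - i))"
        by (simp add: u(2) power2_eq_square algebra_simps power_mult_distrib)
      finally show "2 * u ^ n \<le> t ^ i + t ^ (n - i)" using i by simp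
    qed
    also have "\<dots> = (\<Sum>i<Suc n. t ^ i) + (\<Sum>i<Suc n. t ^ (n - i))" by (rule sum.distrib)
    also have "(\<Sum>i<Suc n. t ^ (n - i)) = (\<Sum>i<Suc n. t ^ i)"
      using sum.nat_diff_reindex[of "\<lambda>i. t ^ i" "Suc n"] by simp
    finally show ?thesis by simp
  qed
  show ?thesis
  proof (cases n)
    case (Suc k)
    have "real n * real (Suc n) * t ^ n = (real n * u ^ n) * (real (Suc n) * u ^ n)"
      by (simp add: u(2) power_mult_distrib power2_eq_square)
    also have "\<dots> \<le> (real n * u ^ k) * (real (Suc n) * u ^ n)"
      using u(1) t Suc by (intro mult_right_mono mult_left_mono power_decreasing) (auto simp: u_def)
    also have "\<dots> \<le> (\<Sum>i<n. t ^ i) * (\<Sum>i<Suc n. t ^ i)"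
      using key[of k] key[of n] u(1) t by (intro mult_mono) (auto simp: Suc intro!: sum_nonneg add_nonneg_nonneg)
    finally show ?thesis .
  qed simp
qed

lemma lambert_term_sums:
  fixes t :: real
  assumes t: "0 < t" "t < 1" and n: "n > 0"
  shows "(\<lambda>l. if n dvd l \<and> l > 0 then t ^ l else 0) sums (t ^ n / (1 - t ^ n))"
proof -
  have tn: "t ^ n < 1" using t n by (simp add: power_less_one_iff)
  have "(\<lambda>k. t ^ n * (t ^ n) ^ k) sums (t ^ n * (1 / (1 - t ^ n)))"
    using t tn by (intro sums_mult geometric_sums) auto
  then have "(\<lambda>k. t ^ (n * Suc k)) sums (t ^ n / (1 - t ^ n))" by (simp add: power_mult power_add)
  then have "(\<lambda>k. (\<lambda>l. if n dvd l \<and> l > 0 then t ^ l else 0) (n * Suc k)) sums (t ^ n / (1 - t ^ n))"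
    using n by simp
  then show ?thesis
  proof (subst (asm) sums_mono_reindex)
    show "strict_mono (\<lambda>k. n * Suc k)" using n by (intro strict_monoI) simp
    fix l assume l: "l \<notin> range (\<lambda>k. n * Suc k)"
    have "\<not> (n dvd l \<and> l > 0)"
    proof
      assume "n dvd l \<and> l > 0"
      then obtain k where "l = n * k" "k > 0" by (auto elim!: dvdE)
      then have "l = n * Suc (k - 1)" by simp
      then show False using l by blast
    qed
    then show "(if n dvd l \<and> l > 0 then t ^ l else 0) = 0" by (rule if_not_P)
  qed
qed

text \<open>\<open>(1 - t) * (t ^ n / (1 - t ^ n))\<close> is compared with \<open>1 / n\<close>,
  its limit as \<open>t\<close> tends to 1. The difference \<open>\<beta> n\<close> is nonnegative
  and decreasing and starts at \<open>1 - t\<close>, so summation by parts loses only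
  \<open>M * (1 - t)\<close>, uniformly in \<open>N\<close>.\<close>

lemma sums_div_imp_lambert_bounded:
  fixes c :: "nat \<Rightarrow> real"
  assumes c0: "c 0 = 0" and M: "\<And>n. \<bar>\<Sum>k<n. c k\<bar> \<le> M" and t: "0 < t" "t < 1"
  shows "\<bar>\<Sum>n=1..N. c n * (t ^ n / (1 - t ^ n))\<bar> \<le> M + \<bar>\<Sum>n=1..N. c n / real n\<bar> / (1 - t)"
proof -
  define S where "S n = (\<Sum>i<n. t ^ i)" for n
  have S: "(1 - t) * S n = 1 - t ^ n" for n unfolding S_def by (rule one_diff_power_eq[symmetric])
  have S0: "S n > 0" if "n > 0" for n unfolding S_def using t that by (intro sum_pos) (auto simp: lessThan_empty_iff)
  define \<beta> where "\<beta> n = 1 / real n - t ^ n / S n" for n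
  have mono: "\<beta> (Suc n) \<le> \<beta> n" if n: "n > 0" for n
  proof -
    have pos: "S n > 0" "S (Suc n) > 0" "real n > 0" using S0 n by auto
    \<comment> \<open>The factor \<open>S (Suc n) - t * S n\<close> collapses to 1, after which
      monotonicity is exactly \<open>geometric_AM_GM\<close>.\<close>
    have "\<beta> n - \<beta> (Suc n) = 1 / (real n * real (Suc n)) - t ^ n * (S (Suc n) - t * S n) / (S n * S (Suc n))"
    proof -
      have "1 / real n - 1 / real (Suc n) = 1 / (real n * real (Suc n))"
        using pos by (simp add: field_simps)
      moreover have "t ^ n / S n - t ^ Suc n / S (Suc n) = t ^ n * (S (Suc n) - t * S n) / (S n * S (Suc n))"
        using pos by (simp add: divide_simps) (simp add: algebra_simps)
      ultimately show ?thesis unfolding \<beta>_def by linarith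
    qed
    also have "S (Suc n) - t * S n = 1"
    proof -
      have "S (Suc n) = S n + t ^ n" by (simp add: S_def)
      then show ?thesis using S[of n] by (simp add: algebra_simps)
    qed
    also have "1 / (real n * real (Suc n)) - t ^ n * 1 / (S n * S (Suc n)) \<ge> 0"
    proof -
      have "real n * real (Suc n) * t ^ n \<le> S n * S (Suc n)"
        unfolding S_def using t by (intro geometric_AM_GM) auto
      then have "t ^ n / (S n * S (Suc n)) \<le> 1 / (real n * real (Suc n))"
        using pos by (simp add: divide_simps mult_ac)
      then show ?thesis by simp
    qed
    finally show ?thesis by simp
  qed
  have nonneg: "\<beta> n \<ge> 0" if "n > 0" for n
  proof -
    have "real n * t ^ n = (\<Sum>i<n. t ^ n)" by simp
    also have "\<dots> \<le> S n" unfolding S_def using t by (intro sum_mono power_decreasing) auto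
    finally show ?thesis using S0[OF that] that by (simp add: \<beta>_def field_simps)
  qed
  have b1: "\<beta> 1 = 1 - t" by (simp add: \<beta>_def S_def)
  have M0: "M \<ge> 0" using M[of 0] by simp
  define C where "C n = (\<Sum>k<n. c k)" for n
  have part: "(\<Sum>n=1..N. c n * \<beta> n) = (\<Sum>n=1..N. C (Suc n) * (\<beta> n - \<beta> (Suc n))) + C (Suc N) * \<beta> (Suc N)" for N
  proof (induction N)
    case (Suc N)
    have "C (Suc (Suc N)) = C (Suc N) + c (Suc N)" by (simp add: C_def)
    then show ?case using Suc by (simp add: algebra_simps)
  qed (simp add: C_def c0)
  have tele: "(\<Sum>n=1..N. M * (\<beta> n - \<beta> (Suc n))) = M * (\<beta> 1 - \<beta> (Suc N))" for N
    by (induction N) (auto simp: algebra_simps)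
  have "\<bar>\<Sum>n=1..N. c n * \<beta> n\<bar> \<le> (\<Sum>n=1..N. M * (\<beta> n - \<beta> (Suc n))) + M * \<beta> (Suc N)"
    unfolding part
  proof (rule order_trans[OF abs_triangle_ineq add_mono])
    show "\<bar>\<Sum>n=1..N. C (Suc n) * (\<beta> n - \<beta> (Suc n))\<bar> \<le> (\<Sum>n=1..N. M * (\<beta> n - \<beta> (Suc n)))"
    proof (intro order_trans[OF sum_abs] sum_mono)
      fix n assume "n \<in> {1..N}"
      then have "\<beta> n - \<beta> (Suc n) \<ge> 0" using mono[of n] by simp
      then show "\<bar>C (Suc n) * (\<beta> n - \<beta> (Suc n))\<bar> \<le> M * (\<beta> n - \<beta> (Suc n))"
        using M[of "Suc n"] by (simp add: abs_mult C_def mult_right_mono)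
    qed
    show "\<bar>C (Suc N) * \<beta> (Suc N)\<bar> \<le> M * \<beta> (Suc N)"
      using M[of "Suc N"] nonneg[of "Suc N"] by (simp add: abs_mult C_def mult_right_mono)
  qed
  also have "\<dots> = M * (1 - t)" unfolding tele b1 by (simp add: algebra_simps)
  finally have bnd: "\<bar>\<Sum>n=1..N. c n * \<beta> n\<bar> \<le> M * (1 - t)" .
  have "(1 - t) * (\<Sum>n=1..N. c n * (t ^ n / (1 - t ^ n))) = (\<Sum>n=1..N. c n / real n) - (\<Sum>n=1..N. c n * \<beta> n)"
    unfolding sum_distrib_left sum_subtractf[symmetric]
  proof (rule sum.cong[OF refl])
    fix n assume "n \<in> {1..N}"
    show "(1 - t) * (c n * (t ^ n / (1 - t ^ n))) = c n / real n - c n * \<beta> n"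
    proof -
      have "(1 - t) * (c n * (t ^ n / ((1 - t) * S n))) = c n * (t ^ n / S n)" using t by simp
      then show ?thesis unfolding S[symmetric] \<beta>_def by (simp add: right_diff_distrib)
    qed
  qed
  then have eq: "\<bar>(1 - t) * (\<Sum>n=1..N. c n * (t ^ n / (1 - t ^ n)))\<bar> =
      \<bar>(\<Sum>n=1..N. c n / real n) - (\<Sum>n=1..N. c n * \<beta> n)\<bar>" by (rule arg_cong)
  have "\<bar>(1 - t) * (\<Sum>n=1..N. c n * (t ^ n / (1 - t ^ n)))\<bar> \<le> \<bar>\<Sum>n=1..N. c n / real n\<bar> + M * (1 - t)"
    unfolding eq using bnd by linarith
  moreover have "\<bar>(1 - t) * (\<Sum>n=1..N. c n * (t ^ n / (1 - t ^ n)))\<bar>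
      = (1 - t) * \<bar>\<Sum>n=1..N. c n * (t ^ n / (1 - t ^ n))\<bar>"
    using t by (subst abs_mult) (simp only: abs_of_pos diff_gt_0_iff_gt)
  ultimately have "(1 - t) * \<bar>\<Sum>n=1..N. c n * (t ^ n / (1 - t ^ n))\<bar> \<le> \<bar>\<Sum>n=1..N. c n / real n\<bar> + M * (1 - t)"
    by simp
  then have "\<bar>\<Sum>n=1..N. c n * (t ^ n / (1 - t ^ n))\<bar> \<le> (\<bar>\<Sum>n=1..N. c n / real n\<bar> + M * (1 - t)) / (1 - t)"
    using t by (simp only: pos_le_divide_eq diff_gt_0_iff_gt mult.commute)
  also have "\<dots> = M + \<bar>\<Sum>n=1..N. c n / real n\<bar> / (1 - t)"
    using t by (simp add: add_divide_distrib)
  finally show ?thesis .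
qed

text \<open>Monsky's argument: the Lambert series of a real character is bounded near \<open>1\<close> if \<open>L(1) = 0\<close>,
  but its power series coefficients are nonnegative, and at least \<open>1\<close> at squares.\<close>
lemma real_char_L_nonzero:
  fixes c :: "nat \<Rightarrow> real"
  assumes c: "\<And>x y. c (x * y) = c x * c y" "c 1 = 1" "\<And>x. c x \<in> {-1, 0, 1}"
    and c0: "c 0 = 0" and M: "\<And>n. \<bar>\<Sum>k<n. c k\<bar> \<le> M" and L: "(\<lambda>n. c n / real n) sums 0"
  shows False
proof -
  have sq: "(\<Sum>k=1..K. t ^ (k\<^sup>2)) \<le> M" if t: "0 < t" "t < 1" for K and t :: real
  proof -
    define V where "V N = (\<Sum>n=1..N. c n * (t ^ n / (1 - t ^ n)))" for N
    \<comment> \<open>\<open>W N\<close> covers the damage of truncating at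
      \<open>n \<le> N\<close>: an exponent \<open>l > N\<close> has at most \<open>l\<close>
      divisors in range, each with coefficient at least -1.\<close>
    define W where "W N = (\<Sum>l. if l > N then real l * t ^ l else 0)" for N
    have sm: "summable (\<lambda>l. real l * t ^ l)"
    proof (rule summable_comparison_test)
      show "summable (\<lambda>l. of_nat (Suc l) * t ^ l)" using geometric_deriv_sums[of t] t by (auto simp: sums_iff)
      show "\<exists>N. \<forall>n\<ge>N. norm (real n * t ^ n) \<le> of_nat (Suc n) * t ^ n"
        using t by (auto simp: abs_mult)
    qed
    have Wtail: "W N = (\<Sum>l. real l * t ^ l) - (\<Sum>l<Suc N. real l * t ^ l)"
      and Wsm: "summable (\<lambda>l. if l > N then real l * t ^ l else 0)" for N
    proof -
      have "(\<lambda>l. real l * t ^ l - (if l \<in> {..<Suc N} then real l * t ^ l else 0)) sums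
         ((\<Sum>l. real l * t ^ l) - (\<Sum>l<Suc N. real l * t ^ l))"
        by (intro sums_diff summable_sums sm sums_If_finite_set) auto
      moreover have "(\<lambda>l. real l * t ^ l - (if l \<in> {..<Suc N} then real l * t ^ l else 0)) =
          (\<lambda>l. if l > N then real l * t ^ l else 0)" by (auto simp: fun_eq_iff)
      ultimately have "(\<lambda>l. if l > N then real l * t ^ l else 0) sums
         ((\<Sum>l. real l * t ^ l) - (\<Sum>l<Suc N. real l * t ^ l))" by simp
      then show "W N = (\<Sum>l. real l * t ^ l) - (\<Sum>l<Suc N. real l * t ^ l)"
        "summable (\<lambda>l. if l > N then real l * t ^ l else 0)" by (auto simp: W_def sums_iff)
    qed
    have W0: "W \<longlonglongrightarrow> 0"
    proof -
      have "(\<lambda>N. (\<Sum>l. real l * t ^ l) - (\<Sum>l<Suc N. real l * t ^ l)) \<longlonglongrightarrow> (\<Sum>l. real l * t ^ l) - (\<Sum>l. real l * t ^ l)"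
        using summable_LIMSEQ[OF sm] by (intro tendsto_diff tendsto_const LIMSEQ_Suc)
      then show ?thesis by (simp add: Wtail[abs_def])
    qed
    \<comment> \<open>Up to \<open>N\<close> the coefficients are complete divisor sums, at least 1
      at squares; beyond \<open>N\<close> the loss is covered by \<open>W N\<close>.\<close>
    have lower: "(\<Sum>k=1..K. t ^ (k\<^sup>2)) - W N \<le> V N" if N: "K\<^sup>2 \<le> N" for N
    proof -
      have VS: "(\<lambda>l. \<Sum>n=1..N. c n * (if n dvd l \<and> l > 0 then t ^ l else 0)) sums V N"
        unfolding V_def using t by (intro sums_sum sums_mult lambert_term_sums) auto
      have "(\<lambda>l. \<Sum>k=1..K. if l = k\<^sup>2 then t ^ l else 0) sums (\<Sum>k=1..K. t ^ (k\<^sup>2))"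
        by (intro sums_sum sums_single)
      then have HS: "(\<lambda>l. (\<Sum>k=1..K. if l = k\<^sup>2 then t ^ l else 0) - (if l > N then real l * t ^ l else 0)) sums
          ((\<Sum>k=1..K. t ^ (k\<^sup>2)) - W N)"
        unfolding W_def by (intro sums_diff summable_sums Wsm)
      show ?thesis
      proof (rule sums_le[OF _ HS VS])
        fix l
        show "(\<Sum>k=1..K. if l = k\<^sup>2 then t ^ l else 0) - (if l > N then real l * t ^ l else 0)
            \<le> (\<Sum>n=1..N. c n * (if n dvd l \<and> l > 0 then t ^ l else 0))"
        proof (cases "l = 0")
          case True
          then show ?thesis by (auto intro!: sum_nonpos)
        next
          case l: False
          have eq: "(\<Sum>n=1..N. c n * (if n dvd l \<and> l > 0 then t ^ l else 0)) = (\<Sum>n\<in>{n\<in>{1..N}. n dvd l}. c n) * t ^ l"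
            unfolding sum_distrib_right using l by (subst sum.inter_filter) (auto intro!: sum.cong)
          show ?thesis
          proof (cases "l \<le> N")
            case True
            have "{n\<in>{1..N}. n dvd l} = {d. d dvd l}"
              using l True by (auto dest: dvd_imp_le intro: Suc_leI dvd_pos_nat)
            then have "(\<Sum>n=1..N. c n * (if n dvd l \<and> l > 0 then t ^ l else 0)) = (\<Sum>d | d dvd l. c d) * t ^ l"
              using eq by simp
            also have "\<dots> \<ge> (if \<exists>k. l = k\<^sup>2 then 1 else 0) * t ^ l"
              using divisor_sum_real_char[of c l, OF c] l t by (intro mult_right_mono) auto
            also have "(if \<exists>k. l = k\<^sup>2 then 1 else 0) * t ^ l \<ge> (\<Sum>k=1..K. if l = k\<^sup>2 then t ^ l else 0)"
            proof (cases "\<exists>k. l = k\<^sup>2")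
              case True
              then obtain k where k: "l = k\<^sup>2" by blast
              have "(\<Sum>j=1..K. if l = j\<^sup>2 then t ^ l else 0) = (\<Sum>j=1..K. if j = k then t ^ l else 0)"
                by (intro sum.cong) (auto simp: k power2_eq_iff_nonneg)
              also have "\<dots> \<le> t ^ l" using t by (simp add: sum.delta)
              finally show ?thesis using True by simp
            qed (auto intro!: sum_nonpos)
            finally show ?thesis using True by simp
          next
            case False
            have "(\<Sum>k=1..K. if l = k\<^sup>2 then t ^ l else 0) \<le> 0"
            proof (rule sum_nonpos)
              fix k assume "k \<in> {1..K}"
              then have "k\<^sup>2 \<le> K\<^sup>2" by (intro power_mono) auto
              then have "k\<^sup>2 \<le> N" using N by (rule order_trans)
              then show "(if l = k\<^sup>2 then t ^ l else 0) \<le> 0" using False by auto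
            qed
            moreover have "- real l \<le> (\<Sum>n\<in>{n\<in>{1..N}. n dvd l}. c n)"
            proof -
              have sub: "{n\<in>{1..N}. n dvd l} \<subseteq> {1..l}" using l by (auto dest: dvd_imp_le)
              have "real (card {n\<in>{1..N}. n dvd l}) \<le> real l"
                using card_mono[OF _ sub] by simp
              moreover have "(\<Sum>n\<in>{n\<in>{1..N}. n dvd l}. - 1) \<le> (\<Sum>n\<in>{n\<in>{1..N}. n dvd l}. c n)"
                using c(3) by (intro sum_mono) (metis insert_iff empty_iff le_minus_one_simps(1) le_minus_one_simps(2) order_refl neg_le_0_iff_le zero_le_one order_trans)
              ultimately show ?thesis by simp
            qed
            then have "- real l * t ^ l \<le> (\<Sum>n\<in>{n\<in>{1..N}. n dvd l}. c n) * t ^ l"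
              using t by (intro mult_right_mono) auto
            ultimately show ?thesis unfolding eq using False by simp
          qed
        qed
      qed
    qed
    have Lz: "(\<lambda>N. \<Sum>n=1..N. c n / real n) \<longlonglongrightarrow> 0"
    proof -
      have "(\<lambda>N. \<Sum>n<Suc N. c n / real n) \<longlonglongrightarrow> 0" using L unfolding sums_def by (rule LIMSEQ_Suc)
      moreover have "(\<Sum>n<Suc N. c n / real n) = (\<Sum>n=1..N. c n / real n)" for N
        by (simp add: lessThan_Suc_atMost atMost_atLeast0 sum.atLeast_Suc_atMost)
      ultimately show ?thesis by simp
    qed
    have A: "(\<lambda>N. (\<Sum>k=1..K. t ^ (k\<^sup>2)) - W N) \<longlonglongrightarrow> (\<Sum>k=1..K. t ^ (k\<^sup>2)) - 0"
      by (intro tendsto_diff tendsto_const W0)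
    have B: "(\<lambda>N. M + \<bar>\<Sum>n=1..N. c n / real n\<bar> / (1 - t)) \<longlonglongrightarrow> M + \<bar>0\<bar> / (1 - t)"
      using t by (intro tendsto_intros Lz) auto
    \<comment> \<open>For fixed \<open>t\<close> the partial sums of \<open>c n / n\<close> tend to
      0, so the factor \<open>1 / (1 - t)\<close> does no harm.\<close>
    have "\<forall>\<^sub>F N in sequentially. (\<Sum>k=1..K. t ^ (k\<^sup>2)) - W N \<le> M + \<bar>\<Sum>n=1..N. c n / real n\<bar> / (1 - t)"
      using eventually_ge_at_top[of "K\<^sup>2"]
    proof eventually_elim
      case (elim N)
      show ?case
        using lower[OF elim] sums_div_imp_lambert_bounded[OF c0 M t, of N] unfolding V_def by linarith
    qed
    from tendsto_le[OF sequentially_bot B A this] have "(\<Sum>k=1..K. t ^ (k\<^sup>2)) - 0 \<le> M + \<bar>0\<bar> / (1 - t)" .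
    then show ?thesis by simp
  qed
  \<comment> \<open>Letting \<open>t\<close> tend to 1 from below turns the sum over squares into
    \<open>K\<close>, which is arbitrary.\<close>
  have "real K \<le> M" for K :: nat
  proof (rule tendsto_upperbound)
    have "((\<lambda>t. \<Sum>k=1..K. t ^ (k\<^sup>2)) \<longlongrightarrow> (\<Sum>k=1..K. 1 ^ (k\<^sup>2))) (at_left (1::real))"
      by (intro tendsto_intros)
    then show "((\<lambda>t. \<Sum>k=1..K. t ^ (k\<^sup>2)) \<longlongrightarrow> real K) (at_left (1::real))" by simp
    show "\<forall>\<^sub>F t in at_left (1::real). (\<Sum>k=1..K. t ^ (k\<^sup>2)) \<le> M"
      using eventually_at_left_real[OF zero_less_one] by eventually_elim (use sq in auto)
  qed simp
  then show False using reals_Archimedean2[of M] by (metis not_le)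
qed

section \<open>The 3-4-1 argument\<close>

lemma log_bounded_dchar: "m > 0 \<Longrightarrow> dchar m \<psi> \<Longrightarrow> log_bounded \<psi>"
  using norm_dchar_le by (intro bounded_imp_log_bounded) blast

lemma log_bounded_mangoldt:
  assumes "\<And>n. norm (f n) \<le> C" shows "log_bounded (\<lambda>n. mangoldt n * f n)"
  unfolding log_bounded_def
proof (intro exI[of _ C] allI impI)
  fix n :: nat assume n: "n \<ge> 1"
  have C: "C \<ge> 0" using order_trans[OF norm_ge_zero assms[of 0]] .
  have "norm (mangoldt n * f n) \<le> ln (real n) * C"
    unfolding norm_mult norm_mangoldt using n mangoldt_le[of n] by (intro mult_mono assms) auto
  also have "\<dots> \<le> (1 + ln (real n)) * C" using C by (intro mult_right_mono) auto
  finally show "norm (mangoldt n * f n) \<le> C * (1 + ln (real n))" by (simp add: mult.commute)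
qed

abbreviation Lambda_series :: "(nat \<Rightarrow> complex) \<Rightarrow> complex \<Rightarrow> complex" where
  "Lambda_series f \<equiv> dseries (\<lambda>n. mangoldt n * f n)"

lemma dseries_dchar_deriv:
  assumes m: "m > 0" and \<psi>: "dchar m \<psi>" and s: "Re s > 1"
  shows "(dseries \<psi> has_field_derivative - (Lambda_series \<psi> s * dseries \<psi> s)) (at s)"
proof -
  have "dseries (\<lambda>n. - of_real (ln (real n)) * \<psi> n) s = - dseries (\<lambda>n. of_real (ln (real n)) * \<psi> n) s"
  proof -
    have "(\<lambda>n. - dterm (\<lambda>n. - of_real (ln (real n)) * \<psi> n) s n) sums - dseries (\<lambda>n. - of_real (ln (real n)) * \<psi> n) s"
      by (intro sums_minus dseries_has_field_derivative(2) log_bounded_dchar[OF m \<psi>] s)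
    moreover have "- dterm (\<lambda>n. - of_real (ln (real n)) * \<psi> n) s n = dterm (\<lambda>n. of_real (ln (real n)) * \<psi> n) s n" for n
      by (simp add: dterm_def)
    ultimately have "dterm (\<lambda>n. of_real (ln (real n)) * \<psi> n) s sums - dseries (\<lambda>n. - of_real (ln (real n)) * \<psi> n) s"
      by simp
    then have "dseries (\<lambda>n. of_real (ln (real n)) * \<psi> n) s = - dseries (\<lambda>n. - of_real (ln (real n)) * \<psi> n) s"
      unfolding dseries_def by (rule sums_unique[symmetric])
    then show ?thesis by simp
  qed
  then show ?thesis
    using dseries_has_field_derivative(1)[OF log_bounded_dchar[OF m \<psi>] s] dseries_mangoldt_mult[OF m \<psi> s] by simp
qed

text \<open>One nonzero value makes the integration constant in \<open>norm_dseries_dchar\<close>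
  nonzero. At 3 the tail is at most 1 / 2, because \<open>1 / n ^ 3\<close> is dominated by a
  telescoping series.\<close>

lemma dseries_dchar_3_nonzero:
  assumes m: "m > 0" and \<psi>: "dchar m \<psi>"
  shows "dseries \<psi> 3 \<noteq> 0"
proof -
  have part: "norm ((\<Sum>n<N+2. dterm \<psi> 3 n) - 1) \<le> 1 / 2 - 1 / (2 * (real N + 1))" for N
  proof (induction N)
    case 0
    then show ?case using dcharD(2)[OF \<psi>] by (simp add: dterm_def eval_nat_numeral)
  next
    case (Suc N)
    have "norm (dterm \<psi> 3 (N + 2)) \<le> 1 * real (N + 2) powr (-3)"
      unfolding norm_dterm using norm_dchar_le[OF \<psi> m] by (intro mult_mono) auto
    also have "\<dots> = 1 / real (N + 2) ^ 3" by (simp add: powr_minus_divide powr_numeral)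
    also have "\<dots> \<le> 1 / (2 * (real N + 1) * (real N + 2))"
    proof (rule divide_left_mono)
      have "2 * (real N + 1) \<le> (real N + 2) ^ 2" by (simp add: power2_eq_square algebra_simps)
      then have "2 * (real N + 1) * (real N + 2) \<le> (real N + 2) ^ 2 * (real N + 2)" by (rule mult_right_mono) simp
      then show "2 * (real N + 1) * (real N + 2) \<le> real (N + 2) ^ 3" by (simp add: power3_eq_cube power2_eq_square add.commute)
    qed auto
    also have "\<dots> = 1 / (2 * (real N + 1)) - 1 / (2 * (real (Suc N) + 1))"
      by (simp add: divide_simps)
    finally have "norm (dterm \<psi> 3 (N + 2)) \<le> 1 / (2 * (real N + 1)) - 1 / (2 * (real (Suc N) + 1))" .
    moreover have "(\<Sum>n<Suc N+2. dterm \<psi> 3 n) - 1 = ((\<Sum>n<N+2. dterm \<psi> 3 n) - 1) + dterm \<psi> 3 (N + 2)" by simp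
    ultimately show ?case using Suc norm_triangle_ineq[of "(\<Sum>n<N+2. dterm \<psi> 3 n) - 1" "dterm \<psi> 3 (N + 2)"]
      by (simp only:)
  qed
  have "norm (dseries \<psi> 3 - 1) \<le> 1 / 2"
  proof (rule Lim_norm_ubound[OF sequentially_bot])
    have "(\<lambda>N. \<Sum>n<N+2. dterm \<psi> 3 n) \<longlonglongrightarrow> dseries \<psi> 3"
      using dseries_sums[OF log_bounded_dchar[OF m \<psi>], of 3] unfolding sums_def by (rule LIMSEQ_ignore_initial_segment) simp
    then show "(\<lambda>N. (\<Sum>n<N+2. dterm \<psi> 3 n) - 1) \<longlonglongrightarrow> dseries \<psi> 3 - 1" by (intro tendsto_diff tendsto_const)
    show "\<forall>\<^sub>F N in sequentially. norm ((\<Sum>n<N+2. dterm \<psi> 3 n) - 1) \<le> 1 / 2"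
    proof (intro always_eventually allI)
      fix N
      have "1 / (2 * (real N + 1)) \<ge> 0" by simp
      then show "norm ((\<Sum>n<N+2. dterm \<psi> 3 n) - 1) \<le> 1 / 2" using part[of N] by linarith
    qed
  qed
  then show ?thesis by auto
qed

text \<open>The logarithm of \<open>\<bar>L\<bar>\<close> on the half plane of absolute convergence, obtained from the
  differential equation \<open>L' = - A L\<close> instead of the Euler product.\<close>
lemma norm_dseries_dchar:
  assumes m: "m > 0" and \<psi>: "dchar m \<psi>"
  obtains P c where "c > 0" "\<And>s. Re s > 1 \<Longrightarrow> norm (dseries \<psi> s) = c * exp (- Re (P s))"
    "\<And>s. Re s > 1 \<Longrightarrow> (P has_field_derivative Lambda_series \<psi> s) (at s)"
proof -
  define S where "S = {s :: complex. Re s > 1}"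
  have S: "open S" "convex S" unfolding S_def by (auto intro: open_halfspace_Re_gt convex_halfspace_Re_gt)
  have "Lambda_series \<psi> holomorphic_on S"
    unfolding S_def by (intro dseries_holomorphic log_bounded_mangoldt[of _ 1] norm_dchar_le[OF \<psi> m])
  then obtain P where P: "\<And>s. s \<in> S \<Longrightarrow> (P has_field_derivative Lambda_series \<psi> s) (at s)"
    using holomorphic_convex_primitive'[OF S(2,1)] at_within_open[OF _ S(1)] by metis
  \<comment> \<open>By the differential equation \<open>k\<close> has derivative 0, so
    \<open>dseries \<psi>\<close> is a constant times \<open>exp (- P s)\<close>.\<close>
  define k where "k s = dseries \<psi> s * exp (P s)" for s
  have "(k has_field_derivative 0) (at s)" if "s \<in> S" for s
  proof -
    have s: "Re s > 1" using that by (simp add: S_def)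
    have "(k has_field_derivative (- (Lambda_series \<psi> s * dseries \<psi> s)) * exp (P s) + (exp (P s) * Lambda_series \<psi> s) * dseries \<psi> s) (at s)"
      unfolding k_def by (intro DERIV_mult dseries_dchar_deriv[OF m \<psi> s] DERIV_chain2[OF DERIV_exp P[OF that]])
    then show ?thesis by (simp add: algebra_simps)
  qed
  then obtain K where K: "\<And>s. s \<in> S \<Longrightarrow> k s = K"
    using has_field_derivative_zero_constant[OF S(2), of k] has_field_derivative_at_within by metis
  have "K \<noteq> 0" using K[of 3] dseries_dchar_3_nonzero[OF m \<psi>] by (auto simp: S_def k_def)
  show ?thesis
  proof (rule that[of "norm K" P])
    fix s :: complex assume "Re s > 1"
    then have "dseries \<psi> s * exp (P s) = K" using K[of s] by (simp add: S_def k_def)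
    then have "norm (dseries \<psi> s) * exp (Re (P s)) = norm K" by (metis norm_mult norm_exp_eq_Re)
    then show "norm (dseries \<psi> s) = norm K * exp (- Re (P s))" by (simp add: exp_minus field_simps)
  qed (use \<open>K \<noteq> 0\<close> P in \<open>auto simp: S_def\<close>)
qed

lemma dchar_square: "dchar m \<psi> \<Longrightarrow> dchar m (\<lambda>n. \<psi> n * \<psi> n)"
  by (auto simp: dchar_def unit_fun_def)

text \<open>On the unit circle this is 3 + 4 cos u + cos 2u = 2 (1 + cos u)^2.\<close>

lemma Re_341: 
  assumes "norm z = 1" shows "3 + 4 * Re z + Re (z * z) \<ge> 0"
proof -
  have "(Re z)\<^sup>2 + (Im z)\<^sup>2 = 1" using assms by (simp add: cmod_def)
  then have "3 + 4 * Re z + Re (z * z) = 2 * (1 + Re z)\<^sup>2" by (simp add: power2_eq_square algebra_simps)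
  then show ?thesis by simp
qed

text \<open>The term of index \<open>n\<close> is \<open>mangoldt n * n powr (-x)\<close> times the
  expression of \<open>Re_341\<close>, taken at \<open>\<psi> n\<close> times \<open>n\<close> to
  the power -it.\<close>

lemma Lambda_series_341:
  assumes m: "m > 0" and \<psi>: "dchar m \<psi>" and x: "x > 1"
  shows "0 \<le> 3 * Re (Lambda_series (principal_char m) (of_real x)) + 4 * Re (Lambda_series \<psi> (of_real x + \<i> * of_real t))
     + Re (Lambda_series (\<lambda>n. \<psi> n * \<psi> n) (of_real x + 2 * (\<i> * of_real t)))"
proof -
  let ?T = "\<lambda>f s n. dterm (\<lambda>n. mangoldt n * f n) s n"
  have lb: "log_bounded (\<lambda>n. mangoldt n * f n)" if "dchar m f" for f :: "nat \<Rightarrow> complex"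
    using norm_dchar_le[OF that m] by (rule log_bounded_mangoldt)
  have s: "(\<lambda>n. 3 * Re (?T (principal_char m) (of_real x) n) + 4 * Re (?T \<psi> (of_real x + \<i> * of_real t) n)
     + Re (?T (\<lambda>n. \<psi> n * \<psi> n) (of_real x + 2 * (\<i> * of_real t)) n)) sums
     (3 * Re (Lambda_series (principal_char m) (of_real x)) + 4 * Re (Lambda_series \<psi> (of_real x + \<i> * of_real t))
     + Re (Lambda_series (\<lambda>n. \<psi> n * \<psi> n) (of_real x + 2 * (\<i> * of_real t))))"
    using x by (intro sums_add sums_mult sums_Re dseries_sums lb dchar_principal \<psi> dchar_square) auto
  show ?thesis
  proof (rule sums_le[OF _ sums_zero s])
    fix n
    show "0 \<le> 3 * Re (?T (principal_char m) (of_real x) n) + 4 * Re (?T \<psi> (of_real x + \<i> * of_real t) n)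
     + Re (?T (\<lambda>n. \<psi> n * \<psi> n) (of_real x + 2 * (\<i> * of_real t)) n)"
    proof (cases "n = 0 \<or> \<not> coprime n m")
      case True
      then show ?thesis using unit_fun_0[OF dcharD(1)[OF \<psi>], of n] by (auto simp: principal_char_def dterm_def)
    next
      case False
      define w :: complex where "w = of_nat n powr (- (\<i> * of_real t))"
      define z where "z = \<psi> n * w"
      have "norm w = 1" unfolding w_def using False norm_nat_powr[of n "\<i> * of_real t"] by simp
      then have z1: "norm z = 1" using norm_dchar[OF \<psi> m, of n] False by (simp add: z_def norm_mult)
      define a where "a = mangoldt n * real n powr (-x)"
      have a: "a \<ge> 0" by (simp add: a_def mangoldt_nonneg)
      have px: "of_nat n powr (- of_real x) = (of_real (real n powr (-x)) :: complex)"
        using powr_of_real[of "real n" "-x"] by simp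
      have p1: "?T \<psi> (of_real x + \<i> * of_real t) n = of_real a * z"
        unfolding dterm_def minus_add_distrib powr_add px z_def w_def a_def by simp
      have p2: "?T (\<lambda>n. \<psi> n * \<psi> n) (of_real x + 2 * (\<i> * of_real t)) n = of_real a * (z * z)"
      proof -
        have "of_nat n powr (- (2 * (\<i> * of_real t))) = w * w"
          unfolding w_def powr_add[symmetric] by simp
        then show ?thesis unfolding dterm_def minus_add_distrib powr_add px z_def a_def by simp
      qed
      have p0: "?T (principal_char m) (of_real x) n = of_real a"
        unfolding dterm_def px a_def using False by (simp add: principal_char_def)
      have "0 \<le> a * (3 + 4 * Re z + Re (z * z))" by (intro mult_nonneg_nonneg a Re_341 z1)
      then show ?thesis unfolding p0 p1 p2 by (simp add: algebra_simps)
    qed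
  qed
qed

lemma holomorphic_bounded_on_ray:
  assumes F: "F holomorphic_on {s. Re s > 0}" and w: "Re w = 0"
  obtains M where "M > 0" "\<And>x. 0 \<le> x \<Longrightarrow> x \<le> 1 \<Longrightarrow> norm (F (of_real (1 + x) + w)) \<le> M"
proof -
  have "continuous_on {0..1} (\<lambda>x. F (of_real (1 + x) + w))"
    by (rule continuous_on_compose2[OF holomorphic_on_imp_continuous_on[OF F]])
       (use w in \<open>auto intro!: continuous_intros\<close>)
  then have "bounded ((\<lambda>x. F (of_real (1 + x) + w)) ` {0..1::real})"
    by (intro compact_imp_bounded compact_continuous_image) auto
  then show ?thesis using that unfolding bounded_pos by (metis atLeastAtMost_iff image_eqI)
qed

text \<open>Dividing out the zero leaves a holomorphic function, which is bounded on the compact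
  piece of the ray.\<close>

lemma holomorphic_zero_on_ray:
  assumes F: "F holomorphic_on {s. Re s > 0}" and w: "Re w = 0" and zero: "F (1 + w) = 0"
  obtains M where "M > 0" "\<And>x. 0 \<le> x \<Longrightarrow> x \<le> 1 \<Longrightarrow> norm (F (of_real (1 + x) + w)) \<le> M * x"
proof -
  define G where "G z = (if z = 1 + w then deriv F (1 + w) else (F z - F (1 + w)) / (z - (1 + w)))" for z
  have "G holomorphic_on {s. Re s > 0}"
    unfolding G_def by (intro pole_lemma_open F open_halfspace_Re_gt)
  then obtain M where M: "M > 0" "\<And>x. 0 \<le> x \<Longrightarrow> x \<le> 1 \<Longrightarrow> norm (G (of_real (1 + x) + w)) \<le> M"
    by (rule holomorphic_bounded_on_ray[OF _ w]) blast+
  show ?thesis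
  proof (rule that[OF M(1)])
    fix x :: real assume x: "0 \<le> x" "x \<le> 1"
    have "F (of_real (1 + x) + w) = of_real x * G (of_real (1 + x) + w)"
      using zero by (cases "x = 0") (auto simp: G_def)
    then have "norm (F (of_real (1 + x) + w)) = x * norm (G (of_real (1 + x) + w))" using x by (simp add: norm_mult)
    also have "\<dots> \<le> x * M" using x M(2) by (intro mult_left_mono) auto
    finally show "norm (F (of_real (1 + x) + w)) \<le> M * x" by (simp add: mult.commute)
  qed
qed

lemma has_real_derivative_Re_shift:
  assumes "(P has_field_derivative A) (at (of_real x + w))"
  shows "((\<lambda>x. Re (P (of_real x + w))) has_real_derivative Re A) (at x)"
proof -
  have "((\<lambda>x. of_real x + w) has_vector_derivative 1) (at x)"
    by (auto intro!: derivative_eq_intros)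
  from field_vector_diff_chain_at[OF this assms]
  have "((\<lambda>x. P (of_real x + w)) has_vector_derivative A) (at x)" by (simp add: o_def)
  from bounded_linear.has_vector_derivative[OF bounded_linear_Re this]
  show ?thesis by (simp add: has_real_derivative_iff_has_vector_derivative)
qed

text \<open>Cancels the simple pole at 1, which only the principal character has.\<close>

definition L_factor :: "nat \<Rightarrow> (nat \<Rightarrow> complex) \<Rightarrow> complex \<Rightarrow> complex" where
  "L_factor m \<psi> s = (if \<psi> = principal_char m then s - 1 else 1)"

lemma L_factor_principal [simp]: "L_factor m (principal_char m) s = s - 1"
  by (simp add: L_factor_def)

lemma L_extension':
  assumes "m > 0" "dchar m \<psi>"
  shows "\<exists>F. F holomorphic_on {s. Re s > 0} \<and> (\<forall>s. Re s > 1 \<longrightarrow> F s = L_factor m \<psi> s * dseries \<psi> s) \<and>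
    (\<psi> = principal_char m \<longrightarrow> F 1 \<noteq> 0) \<and> (\<psi> \<noteq> principal_char m \<longrightarrow> (\<lambda>n. \<psi> n / of_nat n) sums F 1)"
proof (rule L_extension[OF assms])
  fix F assume F: "F holomorphic_on {s. Re s > 0}"
    "\<And>s. Re s > 1 \<Longrightarrow> F s = (if \<psi> = principal_char m then s - 1 else 1) * dseries \<psi> s"
    "\<psi> = principal_char m \<Longrightarrow> F 1 \<noteq> 0"
    "\<psi> \<noteq> principal_char m \<Longrightarrow> (\<lambda>n. \<psi> n / of_nat n) sums F 1"
  show ?thesis unfolding L_factor_def using F by (intro exI[of _ F]) blast
qed

text \<open>Integrating \<open>Lambda_series_341\<close> keeps the product of the three norms, to
  the powers 3, 4 and 1, away from 0 on approach to the line. A zero would make it at most a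
  multiple of \<open>x ^ 4 / x ^ 3\<close>. The condition on \<open>t\<close> keeps the third series
  off its pole.\<close>

lemma L_extension_nonzero_341:
  assumes m: "m > 0" and \<psi>: "dchar m \<psi>" and F: "F holomorphic_on {s. Re s > 0}"
    and FL: "\<And>s. Re s > 1 \<Longrightarrow> F s = L_factor m \<psi> s * dseries \<psi> s"
    and t: "t \<noteq> 0 \<or> (\<lambda>n. \<psi> n * \<psi> n) \<noteq> principal_char m"
  shows "F (1 + \<i> * of_real t) \<noteq> 0"
proof
  assume zero: "F (1 + \<i> * of_real t) = 0"
  let ?\<psi>2 = "\<lambda>n. \<psi> n * \<psi> n"
  obtain F0 where F0: "F0 holomorphic_on {s. Re s > 0}" "\<And>s. Re s > 1 \<Longrightarrow> F0 s = (s - 1) * dseries (principal_char m) s"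
    using L_extension'[OF m dchar_principal] unfolding L_factor_principal by blast
  obtain F2 where F2: "F2 holomorphic_on {s. Re s > 0}" "\<And>s. Re s > 1 \<Longrightarrow> F2 s = L_factor m ?\<psi>2 s * dseries ?\<psi>2 s"
    using L_extension'[OF m dchar_square[OF \<psi>]] by blast
  obtain P0 c0 where P0: "c0 > 0" "\<And>s. Re s > 1 \<Longrightarrow> norm (dseries (principal_char m) s) = c0 * exp (- Re (P0 s))"
    "\<And>s. Re s > 1 \<Longrightarrow> (P0 has_field_derivative Lambda_series (principal_char m) s) (at s)"
    by (rule norm_dseries_dchar[OF m dchar_principal]) blast
  obtain P1 c1 where P1: "c1 > 0" "\<And>s. Re s > 1 \<Longrightarrow> norm (dseries \<psi> s) = c1 * exp (- Re (P1 s))"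
    "\<And>s. Re s > 1 \<Longrightarrow> (P1 has_field_derivative Lambda_series \<psi> s) (at s)"
    by (rule norm_dseries_dchar[OF m \<psi>]) blast
  obtain P2 c2 where P2: "c2 > 0" "\<And>s. Re s > 1 \<Longrightarrow> norm (dseries ?\<psi>2 s) = c2 * exp (- Re (P2 s))"
    "\<And>s. Re s > 1 \<Longrightarrow> (P2 has_field_derivative Lambda_series ?\<psi>2 s) (at s)"
    by (rule norm_dseries_dchar[OF m dchar_square[OF \<psi>]]) blast
  define w where "w = \<i> * of_real t"
  have w: "Re w = 0" "Re (2 * w) = 0" by (auto simp: w_def)
  \<comment> \<open>Up to a constant, \<open>l\<close> is minus the logarithm of that product; being
    nondecreasing it is at most its value at 2.\<close>
  define l where "l x = 3 * Re (P0 (of_real x + 0)) + 4 * Re (P1 (of_real x + w)) + Re (P2 (of_real x + 2 * w))" for x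
  have l: "l x \<le> l 2" if x: "1 < x" "x \<le> 2" for x
  proof (rule DERIV_nonneg_imp_nondecreasing[OF x(2)])
    fix y assume "x \<le> y" "y \<le> 2"
    then have y: "y > 1" using x by simp
    have "(l has_real_derivative 3 * Re (Lambda_series (principal_char m) (of_real y + 0)) + 4 * Re (Lambda_series \<psi> (of_real y + w))
       + Re (Lambda_series ?\<psi>2 (of_real y + 2 * w))) (at y)"
      unfolding l_def using y w
      by (intro DERIV_add DERIV_cmult has_real_derivative_Re_shift P0 P1 P2) auto
    moreover have "3 * Re (Lambda_series (principal_char m) (of_real y + 0)) + 4 * Re (Lambda_series \<psi> (of_real y + w))
       + Re (Lambda_series ?\<psi>2 (of_real y + 2 * w)) \<ge> 0"
      using Lambda_series_341[OF m \<psi> y, of t] by (simp add: w_def)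
    ultimately show "\<exists>z. (l has_real_derivative z) (at y) \<and> 0 \<le> z" by blast
  qed
  define \<kappa> where "\<kappa> = c0 ^ 3 * c1 ^ 4 * c2 * exp (- l 2)"
  have \<kappa>: "\<kappa> > 0" using P0(1) P1(1) P2(1) by (simp add: \<kappa>_def)
  have lower: "\<kappa> \<le> norm (dseries (principal_char m) (of_real (1 + x) + 0)) ^ 3 * norm (dseries \<psi> (of_real (1 + x) + w)) ^ 4
      * norm (dseries ?\<psi>2 (of_real (1 + x) + 2 * w))" if x: "0 < x" "x \<le> 1" for x
  proof -
    have "norm (dseries (principal_char m) (of_real (1 + x) + 0)) ^ 3 * norm (dseries \<psi> (of_real (1 + x) + w)) ^ 4
      * norm (dseries ?\<psi>2 (of_real (1 + x) + 2 * w)) =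
       (c0 * exp (- Re (P0 (of_real (1 + x) + 0)))) ^ 3 * (c1 * exp (- Re (P1 (of_real (1 + x) + w)))) ^ 4 * (c2 * exp (- Re (P2 (of_real (1 + x) + 2 * w))))"
      using x w by (subst P0(2), simp, subst P1(2), simp, subst P2(2)) auto
    also have "\<dots> = c0 ^ 3 * c1 ^ 4 * c2 * exp (- l (1 + x))"
    proof -
      have e: "(c0 * exp (- a)) ^ 3 * (c1 * exp (- b)) ^ 4 * (c2 * exp (- d)) = c0 ^ 3 * c1 ^ 4 * c2 * exp (- (3 * a + 4 * b + d))"
        for a b d :: real
      proof -
        have "exp (- a) ^ 3 = exp (3 * (- a))" "exp (- b) ^ 4 = exp (4 * (- b))"
          using exp_of_nat_mult[of 3 "- a"] exp_of_nat_mult[of 4 "- b"] by simp_all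
        moreover have "exp (- (3 * a + 4 * b + d)) = exp (3 * (- a)) * exp (4 * (- b)) * exp (- d)"
          unfolding exp_add[symmetric] by simp
        ultimately show ?thesis unfolding power_mult_distrib by (simp only: mult_ac)
      qed
      show ?thesis unfolding l_def e ..
    qed
    also have "\<dots> \<ge> \<kappa>" unfolding \<kappa>_def using l[of "1 + x"] x P0(1) P1(1) P2(1) by (intro mult_left_mono) auto
    finally show ?thesis .
  qed
  have quot: "norm D \<le> B / r" if "norm (q * D) \<le> B" "r \<le> norm q" "r > 0" for q D :: complex and B r :: real
  proof -
    have "r * norm D \<le> norm q * norm D" using that by (intro mult_right_mono) auto
    also have "\<dots> \<le> B" using that by (simp add: norm_mult)
    finally show ?thesis using that by (simp add: field_simps)
  qed
  have shift: "norm (of_real (1 + x) + k * w - 1) \<ge> \<bar>Im (k * w)\<bar>" for x and k :: complex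
    using abs_Im_le_cmod[of "of_real (1 + x) + k * w - 1"] by simp
  obtain M0 where M0: "M0 > 0" "\<And>x. 0 \<le> x \<Longrightarrow> x \<le> 1 \<Longrightarrow> norm (F0 (of_real (1 + x) + 0)) \<le> M0"
    by (rule holomorphic_bounded_on_ray[OF F0(1), of 0]) auto
  have D0: "norm (dseries (principal_char m) (of_real (1 + x) + 0)) \<le> M0 / x" if x: "0 < x" "x \<le> 1" for x
    using M0(2)[of x] F0(2)[of "of_real (1 + x) + 0"] x by (intro quot[where q = "of_real (1 + x) + 0 - 1"]) auto
  obtain M1 where M1: "M1 > 0" "\<And>x. 0 \<le> x \<Longrightarrow> x \<le> 1 \<Longrightarrow> norm (F (of_real (1 + x) + w)) \<le> M1 * x"
    by (rule holomorphic_zero_on_ray[OF F w(1)]) (use zero in \<open>auto simp: w_def\<close>)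
  \<comment> \<open>A lower bound for the pole factor along the ray. A principal
    \<open>\<psi>\<close> has a principal square, which leaves only \<open>t \<noteq> 0\<close> in
    the hypothesis.\<close>
  define r1 where "r1 = (if \<psi> = principal_char m then \<bar>t\<bar> else 1)"
  have "(\<lambda>n. \<psi> n * \<psi> n) = principal_char m" if "\<psi> = principal_char m"
    unfolding that by (simp add: principal_char_def fun_eq_iff)
  then have r1: "r1 > 0" using t by (auto simp: r1_def)
  have D1: "norm (dseries \<psi> (of_real (1 + x) + w)) \<le> M1 * x / r1" if x: "0 < x" "x \<le> 1" for x
    using M1(2)[of x] FL[of "of_real (1 + x) + w"] x w shift[where x = x and k = 1] r1
    by (intro quot[where q = "L_factor m \<psi> (of_real (1 + x) + w)"]) (auto simp: L_factor_def r1_def w_def)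
  obtain M2 where M2: "M2 > 0" "\<And>x. 0 \<le> x \<Longrightarrow> x \<le> 1 \<Longrightarrow> norm (F2 (of_real (1 + x) + 2 * w)) \<le> M2"
    by (rule holomorphic_bounded_on_ray[OF F2(1) w(2)]) blast
  define r2 where "r2 = (if ?\<psi>2 = principal_char m then 2 * \<bar>t\<bar> else 1)"
  have r2: "r2 > 0" using t by (auto simp: r2_def)
  have D2: "norm (dseries ?\<psi>2 (of_real (1 + x) + 2 * w)) \<le> M2 / r2" if x: "0 < x" "x \<le> 1" for x
    using M2(2)[of x] F2(2)[of "of_real (1 + x) + 2 * w"] x w shift[where x = x and k = 2] r2
    by (intro quot[where q = "L_factor m ?\<psi>2 (of_real (1 + x) + 2 * w)"]) (auto simp: L_factor_def r2_def w_def)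
  define C where "C = M0 ^ 3 * (M1 / r1) ^ 4 * (M2 / r2)"
  have C: "C > 0" using M0(1) M1(1) M2(1) r1 r2 by (simp add: C_def)
  have upper: "\<kappa> \<le> C * x" if x: "0 < x" "x \<le> 1" for x
  proof -
    have "\<kappa> \<le> (M0 / x) ^ 3 * (M1 * x / r1) ^ 4 * (M2 / r2)"
      using M0(1) M1(1) M2(1) r1 r2 x
      by (intro order_trans[OF lower[OF x]] mult_mono power_mono D0 D1 D2) auto
    also have "\<dots> = C * x" 
    proof -
      have "(M0 / x) ^ 3 * (M1 * x / r1) ^ 4 = M0 ^ 3 * (M1 / r1) ^ 4 * (x ^ 4 / x ^ 3)"
        by (simp add: power_divide power_mult_distrib mult_ac)
      also have "x ^ 4 / x ^ 3 = x" using x by (simp add: eval_nat_numeral)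
      finally show ?thesis by (simp add: C_def)
    qed
    finally show ?thesis .
  qed
  define x where "x = min 1 (\<kappa> / (2 * C))"
  have x: "0 < x" "x \<le> 1" "x \<le> \<kappa> / (2 * C)" using \<kappa> C by (auto simp: x_def)
  then have "C * x \<le> \<kappa> / 2" using C by (simp add: field_simps)
  then show False using upper[OF x(1,2)] \<kappa> by linarith
qed

lemma real_dchar_L1_nonzero:
  assumes m: "m > 0" and \<psi>: "dchar m \<psi>" "\<psi> \<noteq> principal_char m"
    and sq: "(\<lambda>n. \<psi> n * \<psi> n) = principal_char m" and L: "(\<lambda>n. \<psi> n / of_nat n) sums 0"
  shows False
proof -
  have sq': "\<psi> n * \<psi> n = principal_char m n" for n using sq by (rule fun_cong)
  have vals: "\<psi> n \<in> {-1, 0, 1}" for n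
  proof -
    have "\<psi> n * \<psi> n = 0 \<or> \<psi> n * \<psi> n = 1" using sq'[of n] by (auto simp: principal_char_def)
    then show ?thesis by (auto simp: square_eq_1_iff)
  qed
  define c where "c n = Re (\<psi> n)" for n
  have cv: "c n \<in> {-1, 0, 1}" and \<psi>c: "\<psi> n = of_real (c n)" for n
    using vals[of n] by (auto simp: c_def)
  have "m \<noteq> 1"
  proof
    assume "m = 1"
    then have "\<psi> n = principal_char m n" for n
      using unit_fun_cong[OF dcharD(1)[OF \<psi>(1)], of n 1] dcharD(2)[OF \<psi>(1)] by (simp add: principal_char_def)
    then show False using \<psi>(2) by blast
  qed
  then have c0: "c 0 = 0" using unit_fun_0[OF dcharD(1)[OF \<psi>(1)], of 0] by (simp add: c_def)
  have M: "\<bar>\<Sum>k<n. c k\<bar> \<le> real m" for n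
  proof -
    have "norm (\<Sum>k<n. \<psi> k) \<le> real m * 1"
      using unit_fun_cong[OF dcharD(1)[OF \<psi>(1)]] sum_dchar_nonprincipal[OF m \<psi>] norm_dchar_le[OF \<psi>(1) m]
      by (intro periodic_sum_bound[OF m]) auto
    moreover have "\<bar>\<Sum>k<n. c k\<bar> \<le> norm (\<Sum>k<n. \<psi> k)"
      unfolding c_def using abs_Re_le_cmod[of "\<Sum>k<n. \<psi> k"] by simp
    ultimately show ?thesis by simp
  qed
  have "(\<lambda>n. Re (\<psi> n / of_nat n)) sums Re 0" by (intro sums_Re L)
  then have Lc: "(\<lambda>n. c n / real n) sums 0" unfolding c_def by simp
  have mult: "c (x * y) = c x * c y" for x y
  proof -
    have "of_real (c (x * y)) = (of_real (c x * c y) :: complex)"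
      using dcharD(3)[OF \<psi>(1), of x y] \<psi>c by simp
    then show ?thesis by (simp only: of_real_eq_iff)
  qed
  have one: "c 1 = 1" using dcharD(2)[OF \<psi>(1)] by (simp add: c_def)
  show False by (rule real_char_L_nonzero[OF mult one cv c0 M Lc])
qed

section \<open>Logarithmic derivatives up to the line\<close>

text \<open>\<open>g\<close> is minus the logarithmic derivative of the pole-free \<open>F\<close>,
  for the principal character corrected by the regular part of zeta. That \<open>F\<close> has no
  zero is put together from the exponential formula for Re s > 1, the 3-4-1 argument on the line,
  and at 1 the residue of the principal character or Monsky's argument for real characters.\<close>

lemma Lambda_series_dchar_extension:
  assumes m: "m > 0" and \<psi>: "dchar m \<psi>"
  obtains g where "continuous_on {s. Re s \<ge> 1} g"
    "\<And>s. Re s > 1 \<Longrightarrow> Lambda_series \<psi> s - (if \<psi> = principal_char m then 1 else 0) * dseries (\<lambda>_. 1) s = g s"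
proof -
  obtain F where F: "F holomorphic_on {s. Re s > 0}"
    and FL: "\<And>s. Re s > 1 \<Longrightarrow> F s = L_factor m \<psi> s * dseries \<psi> s"
    and F1: "\<psi> = principal_char m \<Longrightarrow> F 1 \<noteq> 0" "\<psi> \<noteq> principal_char m \<Longrightarrow> (\<lambda>n. \<psi> n / of_nat n) sums F 1"
    using L_extension'[OF m \<psi>] by blast
  obtain Z where Z: "Z holomorphic_on {s. Re s > 0}" "Z 1 = 1"
    "\<And>s. Re s > 1 \<Longrightarrow> Z s = (s - 1) * dseries (\<lambda>_. 1) s" by (rule zeta_extension) blast
  obtain P c where P: "c > 0" "\<And>s. Re s > 1 \<Longrightarrow> norm (dseries \<psi> s) = c * exp (- Re (P s))"
    by (rule norm_dseries_dchar[OF m \<psi>]) blast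
  have S: "open {s :: complex. Re s > 0}" by (rule open_halfspace_Re_gt)
  have dnz: "dseries \<psi> s \<noteq> 0" if "Re s > 1" for s
    using P(1) P(2)[OF that] by (metis exp_gt_zero less_irrefl mult_pos_pos norm_zero)
  have nz: "F s \<noteq> 0" if s: "Re s \<ge> 1" for s
  proof (cases "Re s = 1")
    case False
    then have s1: "Re s > 1" using s by simp
    then have "L_factor m \<psi> s \<noteq> 0" by (auto simp: L_factor_def)
    then show ?thesis using FL[OF s1] dnz[OF s1] by simp
  next
    case True
    define t where "t = Im s"
    have st: "s = 1 + \<i> * of_real t" using True by (simp add: t_def complex_eq_iff)
    show ?thesis
    proof (cases "t \<noteq> 0 \<or> (\<lambda>n. \<psi> n * \<psi> n) \<noteq> principal_char m")
      case True
      then show ?thesis unfolding st by (intro L_extension_nonzero_341[OF m \<psi> F FL])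
    next
      case False
      then have s1: "s = 1" using st by simp
      show ?thesis
      proof (cases "\<psi> = principal_char m")
        case True
        then show ?thesis using F1(1) s1 by simp
      next
        case np: False
        show ?thesis
        proof
          assume "F s = 0"
          then have "(\<lambda>n. \<psi> n / of_nat n) sums 0" using F1(2)[OF np] s1 by simp
          then show False using real_dchar_L1_nonzero[OF m \<psi> np] False by blast
        qed
      qed
    qed
  qed
  \<comment> \<open>As \<open>Z 1 = 1\<close>, this is zeta minus \<open>1 / (s - 1)\<close>,
    extended over the point 1.\<close>
  define E where "E z = (if z = 1 then deriv Z 1 else (Z z - Z 1) / (z - 1))" for z
  have E: "E holomorphic_on {s. Re s > 0}" unfolding E_def by (intro pole_lemma_open Z S)
  define g where "g s = - (deriv F s / F s) - (if \<psi> = principal_char m then E s else 0)" for s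
  show ?thesis
  proof (rule that[of g])
    have sub: "{s. Re s \<ge> 1} \<subseteq> {s. Re s > 0}" by auto
    have "continuous_on {s. Re s \<ge> 1} F" "continuous_on {s. Re s \<ge> 1} (deriv F)" "continuous_on {s. Re s \<ge> 1} E"
      using sub F E holomorphic_deriv[OF F S] holomorphic_on_imp_continuous_on continuous_on_subset by blast+
    then show "continuous_on {s. Re s \<ge> 1} g"
      unfolding g_def using nz by (cases "\<psi> = principal_char m") (auto intro!: continuous_intros)
    fix s :: complex assume s: "Re s > 1"
    have ls: "(L_factor m \<psi> has_field_derivative (if \<psi> = principal_char m then 1 else 0)) (at s)"
      unfolding L_factor_def by (cases "\<psi> = principal_char m") (auto intro!: derivative_eq_intros)
    have op: "open {s :: complex. Re s > 1}" by (rule open_halfspace_Re_gt)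
    have "((\<lambda>s. L_factor m \<psi> s * dseries \<psi> s) has_field_derivative
        (if \<psi> = principal_char m then 1 else 0) * dseries \<psi> s + (- (Lambda_series \<psi> s * dseries \<psi> s)) * L_factor m \<psi> s) (at s)"
      by (intro DERIV_mult ls dseries_dchar_deriv[OF m \<psi> s])
    then have "(F has_field_derivative
        (if \<psi> = principal_char m then 1 else 0) * dseries \<psi> s + (- (Lambda_series \<psi> s * dseries \<psi> s)) * L_factor m \<psi> s) (at s)"
      by (rule has_field_derivative_transform_within_open[OF _ op]) (use s FL in auto)
    then have "deriv F s = (if \<psi> = principal_char m then 1 else 0) * dseries \<psi> s - Lambda_series \<psi> s * dseries \<psi> s * L_factor m \<psi> s"
      by (simp add: DERIV_imp_deriv)
    then have "- (deriv F s / F s) = Lambda_series \<psi> s - (if \<psi> = principal_char m then 1 else 0) / L_factor m \<psi> s"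
      using FL[OF s] dnz[OF s] nz[of s] s by (auto simp: field_simps)
    moreover have "s \<noteq> 1" using s by auto
    then have "E s = dseries (\<lambda>_. 1) s - 1 / (s - 1)"
      using Z(2) Z(3)[OF s] by (simp add: E_def diff_divide_distrib)
    ultimately show "Lambda_series \<psi> s - (if \<psi> = principal_char m then 1 else 0) * dseries (\<lambda>_. 1) s = g s"
      by (simp add: g_def L_factor_def)
  qed
qed

lemma unit_fun_bounded:
  assumes "m > 0" "unit_fun m f" shows "norm (f n) \<le> (\<Sum>a<m. norm (f a))"
proof -
  have "f n = f (n mod m)" by (rule unit_fun_cong[OF assms(2)]) (simp add: cong_def)
  also have "norm (f (n mod m)) \<le> (\<Sum>a<m. norm (f a))"
    using assms(1) by (intro member_le_sum) auto
  finally show ?thesis .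
qed

text \<open>The claim is linear in \<open>f\<close>, so \<open>dchar_span_induct\<close> reduces it
  to multiples of characters; the mean over the units picks out the principal one.\<close>

lemma Lambda_series_extension:
  assumes m: "m > 0" and f: "unit_fun m f"
  shows "\<exists>g. continuous_on {s. Re s \<ge> 1} g \<and>
    (\<forall>s. Re s > 1 \<longrightarrow> Lambda_series f s - (\<Sum>a<m. f a) / of_nat (totient m) * dseries (\<lambda>_. 1) s = g s)"
proof (rule dchar_span_induct[OF m f])
  have tm: "of_nat (totient m) \<noteq> (0 :: complex)" using m by simp
  fix \<psi> c assume \<psi>: "dchar m \<psi>"
  obtain g where g: "continuous_on {s. Re s \<ge> 1} g"
    "\<And>s. Re s > 1 \<Longrightarrow> Lambda_series \<psi> s - (if \<psi> = principal_char m then 1 else 0) * dseries (\<lambda>_. 1) s = g s"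
    by (rule Lambda_series_dchar_extension[OF m \<psi>]) blast
  have mean: "(\<Sum>a<m. c * \<psi> a) / of_nat (totient m) = c * (if \<psi> = principal_char m then 1 else 0)"
    using sum_principal_char[OF m] sum_dchar_nonprincipal[OF m \<psi>] tm by (auto simp flip: sum_distrib_left)
  have lin: "Lambda_series (\<lambda>n. c * \<psi> n) s = c * Lambda_series \<psi> s" if "Re s > 1" for s
  proof -
    have "(\<lambda>n. c * dterm (\<lambda>n. mangoldt n * \<psi> n) s n) sums (c * Lambda_series \<psi> s)"
      using norm_dchar_le[OF \<psi> m] that by (intro sums_mult dseries_sums log_bounded_mangoldt[of _ 1])
    moreover have "(\<lambda>n. c * dterm (\<lambda>n. mangoldt n * \<psi> n) s n) = dterm (\<lambda>n. mangoldt n * (c * \<psi> n)) s"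
      by (simp add: dterm_def fun_eq_iff mult_ac)
    ultimately show ?thesis by (simp add: dseries_def sums_iff)
  qed
  show "\<exists>g. continuous_on {s. Re s \<ge> 1} g \<and> (\<forall>s. Re s > 1 \<longrightarrow> Lambda_series (\<lambda>n. c * \<psi> n) s
      - (\<Sum>a<m. c * \<psi> a) / of_nat (totient m) * dseries (\<lambda>_. 1) s = g s)"
  proof (intro exI[of _ "\<lambda>s. c * g s"] conjI allI impI)
    show "continuous_on {s. Re s \<ge> 1} (\<lambda>s. c * g s)" using g(1) by (intro continuous_intros)
    fix s :: complex assume s: "Re s > 1"
    show "Lambda_series (\<lambda>n. c * \<psi> n) s - (\<Sum>a<m. c * \<psi> a) / of_nat (totient m) * dseries (\<lambda>_. 1) s = c * g s"
      unfolding mean lin[OF s] g(2)[OF s, symmetric] by (simp add: right_diff_distrib mult.assoc)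
  qed
next
  fix g h :: "nat \<Rightarrow> complex" assume gh: "unit_fun m g" "unit_fun m h"
  assume "\<exists>G. continuous_on {s. Re s \<ge> 1} G \<and> (\<forall>s. Re s > 1 \<longrightarrow> Lambda_series g s
      - (\<Sum>a<m. g a) / of_nat (totient m) * dseries (\<lambda>_. 1) s = G s)"
    and "\<exists>G. continuous_on {s. Re s \<ge> 1} G \<and> (\<forall>s. Re s > 1 \<longrightarrow> Lambda_series h s
      - (\<Sum>a<m. h a) / of_nat (totient m) * dseries (\<lambda>_. 1) s = G s)"
  then obtain G H where G: "continuous_on {s. Re s \<ge> 1} G" "\<And>s. Re s > 1 \<Longrightarrow> Lambda_series g s
      - (\<Sum>a<m. g a) / of_nat (totient m) * dseries (\<lambda>_. 1) s = G s"
    and H: "continuous_on {s. Re s \<ge> 1} H" "\<And>s. Re s > 1 \<Longrightarrow> Lambda_series h s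
      - (\<Sum>a<m. h a) / of_nat (totient m) * dseries (\<lambda>_. 1) s = H s" by blast
  have lin: "Lambda_series (\<lambda>n. g n + h n) s = Lambda_series g s + Lambda_series h s" if "Re s > 1" for s
  proof -
    have "(\<lambda>n. dterm (\<lambda>n. mangoldt n * g n) s n + dterm (\<lambda>n. mangoldt n * h n) s n) sums (Lambda_series g s + Lambda_series h s)"
      using unit_fun_bounded[OF m gh(1)] unit_fun_bounded[OF m gh(2)] that
      by (intro sums_add dseries_sums log_bounded_mangoldt)
    moreover have "(\<lambda>n. dterm (\<lambda>n. mangoldt n * g n) s n + dterm (\<lambda>n. mangoldt n * h n) s n) = dterm (\<lambda>n. mangoldt n * (g n + h n)) s"
      by (simp add: dterm_def fun_eq_iff algebra_simps)
    ultimately show ?thesis by (simp add: dseries_def sums_iff)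
  qed
  show "\<exists>G. continuous_on {s. Re s \<ge> 1} G \<and> (\<forall>s. Re s > 1 \<longrightarrow> Lambda_series (\<lambda>n. g n + h n) s
      - (\<Sum>a<m. g a + h a) / of_nat (totient m) * dseries (\<lambda>_. 1) s = G s)"
  proof (intro exI[of _ "\<lambda>s. G s + H s"] conjI allI impI)
    show "continuous_on {s. Re s \<ge> 1} (\<lambda>s. G s + H s)" using G(1) H(1) by (intro continuous_intros)
    fix s :: complex assume s: "Re s > 1"
    show "Lambda_series (\<lambda>n. g n + h n) s - (\<Sum>a<m. g a + h a) / of_nat (totient m) * dseries (\<lambda>_. 1) s = G s + H s"
      unfolding lin[OF s] G(2)[OF s, symmetric] H(2)[OF s, symmetric]
      by (simp add: sum.distrib add_divide_distrib distrib_right)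
  qed
qed

section \<open>A Tauberian theorem\<close>

text \<open>The Fourier transform of the triangle \<open>1 - \<bar>t\<bar> / K\<close> on the
  interval from \<open>-K\<close> to \<open>K\<close>; \<open>K\<close> is the limit value at
  0.\<close>

definition fejer :: "real \<Rightarrow> real \<Rightarrow> real" where
  "fejer K v = (if v = 0 then K else 2 * (1 - cos (K * v)) / (K * v\<^sup>2))"

lemma fejer_nonneg: "K > 0 \<Longrightarrow> fejer K v \<ge> 0"
  by (simp add: fejer_def)

lemma one_minus_cos: "1 - cos x = 2 * (sin (x / 2))\<^sup>2" for x :: real
  using cos_double_sin[of "x / 2"] by simp

lemma fejer_le:
  assumes K: "K > 0" shows "fejer K v \<le> K" "v \<noteq> 0 \<Longrightarrow> fejer K v \<le> 4 / (K * v\<^sup>2)"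
proof -
  show "fejer K v \<le> K"
  proof (cases "v = 0")
    case False
    have "\<bar>sin (K * v / 2)\<bar>\<^sup>2 \<le> \<bar>K * v / 2\<bar>\<^sup>2" by (intro power_mono abs_sin_x_le_abs_x) auto
    then have "2 * (1 - cos (K * v)) \<le> K * (K * v\<^sup>2)"
      unfolding one_minus_cos by (simp add: power2_eq_square power_mult_distrib field_simps)
    then show ?thesis using K False by (simp add: fejer_def divide_le_eq)
  qed (simp add: fejer_def)
  assume v: "v \<noteq> 0"
  have "2 * (1 - cos (K * v)) \<le> 2 * (1 - (- 1))" by (intro mult_left_mono diff_left_mono cos_ge_minus_one) auto
  then show "fejer K v \<le> 4 / (K * v\<^sup>2)" using K v by (simp add: fejer_def divide_right_mono)
qed

text \<open>The majorant is a multiple of the derivative of \<open>arctan\<close>, which makes sums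
  of the kernel telescope later.\<close>

lemma fejer_le_poisson:
  assumes K: "K > 0" shows "fejer K v \<le> (K + 4 / K) / (1 + v\<^sup>2)"
proof -
  have "v\<^sup>2 * fejer K v \<le> 4 / K"
  proof (cases "v = 0")
    case False
    then have "v\<^sup>2 * fejer K v \<le> v\<^sup>2 * (4 / (K * v\<^sup>2))" using fejer_le(2)[OF K] by (intro mult_left_mono) auto
    then show ?thesis using False K by (simp add: field_simps)
  qed (use K in simp)
  then have "(1 + v\<^sup>2) * fejer K v \<le> K + 4 / K" using fejer_le(1)[OF K, of v] by (simp add: algebra_simps)
  moreover have "1 + v\<^sup>2 > 0" by (simp add: add_pos_nonneg)
  ultimately show ?thesis by (simp add: pos_le_divide_eq mult.commute)
qed

text \<open>For \<open>y = K * v / 2\<close>, of size at most 1 / 2, \<open>sin y\<close> keeps at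
  least 5 / 6 of the size of \<open>y\<close>, and 25 / 36 exceeds 1 / 2.\<close>

lemma fejer_ge:
  assumes K: "K > 0" and v: "\<bar>v\<bar> \<le> 1 / K" shows "fejer K v \<ge> K / 2"
proof (cases "v = 0")
  case False
  define y where "y = K * v / 2"
  have y: "y \<noteq> 0" "\<bar>y\<bar> \<le> 1 / 2" using False K v by (auto simp: y_def abs_mult field_simps)
  have "\<bar>sin y - y\<bar> \<le> \<bar>y\<bar> ^ 3 / 6"
    using Maclaurin_sin_bound[of y 3] by (simp add: eval_nat_numeral sin_coeff_def field_simps)
  also have "\<dots> \<le> \<bar>y\<bar> / 6"
  proof -
    have "\<bar>y\<bar> * \<bar>y\<bar> \<le> 1 * 1" using y by (intro mult_mono) auto
    then have "\<bar>y\<bar> * (\<bar>y\<bar> * \<bar>y\<bar>) \<le> \<bar>y\<bar> * (1 * 1)" by (intro mult_left_mono) auto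
    then show ?thesis by (simp add: power3_eq_cube mult.assoc)
  qed
  finally have "\<bar>sin y\<bar> \<ge> 5 / 6 * \<bar>y\<bar>" by linarith
  then have "(5 / 6 * \<bar>y\<bar>)\<^sup>2 \<le> \<bar>sin y\<bar>\<^sup>2" by (intro power_mono) auto
  then have s: "25 / 36 * y\<^sup>2 \<le> (sin y)\<^sup>2" by (simp add: power_mult_distrib power_divide)
  have "y\<^sup>2 > 0" using y by simp
  then have "y\<^sup>2 / 2 \<le> (sin y)\<^sup>2" using s by linarith
  then have "K * (K * v\<^sup>2) / 2 \<le> 2 * (1 - cos (K * v))"
    unfolding one_minus_cos y_def by (simp add: power_divide power_mult_distrib power2_eq_square mult_ac)
  then show ?thesis using K False by (simp add: fejer_def le_divide_eq)
qed (use K in \<open>simp add: fejer_def\<close>)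

text \<open>Two translates of the kernel by a half period have no common zero.\<close>
lemma fejer_tail:
  assumes K: "K > 0" and \<delta>: "\<delta> > 0" and v: "\<bar>v\<bar> \<ge> \<delta>"
  shows "fejer K v \<le> (1 + pi / \<delta>)\<^sup>2 / K * (fejer 1 v + fejer 1 (v + pi))"
proof -
  have v0: "v \<noteq> 0" using v \<delta> by auto
  define R where "R = (\<bar>v\<bar> + pi)\<^sup>2"
  have R: "R > 0" unfolding R_def using pi_gt_zero by (intro zero_less_power) linarith
  have sq1: "v\<^sup>2 \<le> R" unfolding R_def using power_mono[of "\<bar>v\<bar>" "\<bar>v\<bar> + pi" 2] by simp
  have "\<bar>v + pi\<bar> \<le> \<bar>v\<bar> + pi" using pi_gt_zero by linarith
  then have sq2: "(v + pi)\<^sup>2 \<le> R" unfolding R_def using power_mono[of "\<bar>v + pi\<bar>" "\<bar>v\<bar> + pi" 2] by simp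
  have f1: "fejer 1 v \<ge> 2 * (1 - cos v) / R"
    unfolding fejer_def using v0 sq1 R by (auto intro!: divide_left_mono)
  have f2: "fejer 1 (v + pi) \<ge> 2 * (1 + cos v) / R"
  proof (cases "v + pi = 0")
    case True
    then have "v = - pi" by simp
    then show ?thesis by (simp add: fejer_def)
  next
    case False
    have "0 \<le> 1 + cos v" by (metis add.commute cos_ge_minus_one diff_minus_eq_add le_diff_eq diff_ge_0_iff_ge)
    then have "2 * (1 + cos v) / R \<le> 2 * (1 + cos v) / (v + pi)\<^sup>2"
      using False sq2 R by (intro divide_left_mono) auto
    then show ?thesis using False by (simp add: fejer_def)
  qed
  \<comment> \<open>\<open>1 - cos v\<close> and \<open>1 + cos v\<close> add up to 2, so the
    cosines drop out.\<close>
  have "4 / R = 2 * (1 - cos v) / R + 2 * (1 + cos v) / R" using R by (simp add: field_simps)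
  then have low: "4 / R \<le> fejer 1 v + fejer 1 (v + pi)" using f1 f2 by linarith
  have "R \<le> v\<^sup>2 * (1 + pi / \<delta>)\<^sup>2"
  proof -
    have "pi \<le> \<bar>v\<bar> * (pi / \<delta>)" using v \<delta> pi_gt_zero by (simp add: field_simps)
    then have "\<bar>v\<bar> + pi \<le> \<bar>v\<bar> * (1 + pi / \<delta>)" by (simp add: algebra_simps)
    then have "(\<bar>v\<bar> + pi)\<^sup>2 \<le> (\<bar>v\<bar> * (1 + pi / \<delta>))\<^sup>2" by (intro power_mono) auto
    then show ?thesis by (simp add: R_def power_mult_distrib)
  qed
  then have "1 / v\<^sup>2 \<le> (1 + pi / \<delta>)\<^sup>2 / R" using v0 R by (simp add: field_simps)
  then have "4 / (K * v\<^sup>2) \<le> (1 + pi / \<delta>)\<^sup>2 / K * (4 / R)" using K v0 R by (simp add: field_simps)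
  also have "\<dots> \<le> (1 + pi / \<delta>)\<^sup>2 / K * (fejer 1 v + fejer 1 (v + pi))"
    using K low by (intro mult_left_mono) auto
  finally show ?thesis using fejer_le(2)[OF K v0] by linarith
qed

section \<open>Fejer-weighted integrals of Dirichlet series\<close>

text \<open>The integral of \<open>(1 - \<bar>t\<bar> / K) * cis (t * s) * h t\<close> from
  \<open>-K\<close> to \<open>K\<close>, folded onto nonnegative \<open>t\<close>.\<close>

definition fejer_int :: "real \<Rightarrow> (real \<Rightarrow> complex) \<Rightarrow> real \<Rightarrow> complex" where
  "fejer_int K h s = integral {0..K} (\<lambda>t. of_real (1 - t / K) * (cis (t * s) * h t + cis (- (t * s)) * h (- t)))"

lemma fejer_has_integral:
  assumes K: "K > 0"
  shows "((\<lambda>t. (1 - t / K) * (2 * cos (t * v))) has_integral fejer K v) {0..K}"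
proof (cases "v = 0")
  case True
  have "((\<lambda>t. (1 - t / K) * 2) has_integral ((2 * K - K\<^sup>2 / K) - (2 * 0 - 0\<^sup>2 / K))) {0..K}"
    using K by (intro fundamental_theorem_of_calculus)
      (auto intro!: derivative_eq_intros simp: has_real_derivative_iff_has_vector_derivative[symmetric] field_simps)
  then show ?thesis using True K by (simp add: fejer_def power2_eq_square)
next
  case False
  define G where "G t = 2 * ((1 - t / K) * sin (t * v) / v - cos (t * v) / (K * v\<^sup>2))" for t
  have "((\<lambda>t. (1 - t / K) * (2 * cos (t * v))) has_integral (G K - G 0)) {0..K}"
  proof (rule fundamental_theorem_of_calculus)
    fix t
    have "(G has_real_derivative (1 - t / K) * (2 * cos (t * v))) (at t)"
      unfolding G_def using K False
      by (auto intro!: derivative_eq_intros simp: field_simps power2_eq_square)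
    then show "(G has_vector_derivative (1 - t / K) * (2 * cos (t * v))) (at t within {0..K})"
      using has_real_derivative_iff_has_vector_derivative has_vector_derivative_at_within by blast
  qed (use K in auto)
  moreover have "G K - G 0 = fejer K v" using K False by (simp add: G_def fejer_def field_simps)
  ultimately show ?thesis by simp
qed

lemma fejer_int_power:
  assumes K: "K > 0"
  shows "fejer_int K (\<lambda>t. cis (- (t * u))) s = of_real (fejer K (s - u))"
proof -
  have "of_real (1 - t / K) * (cis (t * s) * cis (- (t * u)) + cis (- (t * s)) * cis (- (- t * u)))
      = (of_real ((1 - t / K) * (2 * cos (t * (s - u)))) :: complex)" for t
  proof -
    have "cis (t * s) * cis (- (t * u)) + cis (- (t * s)) * cis (- (- t * u)) = of_real (2 * cos (t * (s - u)))"
      unfolding cis_mult by (simp add: complex_eq_iff algebra_simps cos_diff sin_diff)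
    then show ?thesis by simp
  qed
  then show ?thesis
    unfolding fejer_int_def
    by (intro integral_unique) (simp only: has_integral_of_real[OF fejer_has_integral[OF K, of "s - u"]])
qed

lemma nat_powr_line:
  assumes "n > 0"
  shows "of_nat n powr (- (of_real (1 + \<kappa>) + \<i> * of_real t)) = (of_real (real n powr (-1 - \<kappa>)) * cis (- (t * ln (real n))) :: complex)"
proof -
  have "of_nat n powr (- (of_real (1 + \<kappa>) + \<i> * of_real t)) = exp (- (of_real (1 + \<kappa>) + \<i> * of_real t) * of_real (ln (real n)) :: complex)"
    using assms Ln_of_nat[of n] by (simp add: powr_def)
  also have "\<dots> = exp (of_real ((-1 - \<kappa>) * ln (real n)) + \<i> * of_real (- (t * ln (real n))))"
    by (simp add: algebra_simps)
  also have "\<dots> = of_real (exp ((-1 - \<kappa>) * ln (real n))) * cis (- (t * ln (real n)))"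
    unfolding exp_add cis_conv_exp exp_of_real by (rule refl)
  also have "exp ((-1 - \<kappa>) * ln (real n)) = real n powr (-1 - \<kappa>)" using assms by (simp add: powr_def)
  finally show ?thesis .
qed

lemma uniform_limit_fejer_int:
  assumes K: "K > 0" and h: "\<And>N. continuous_on {-K..K} (h N)" and lim: "uniform_limit {-K..K} h g sequentially"
  shows "(\<lambda>N. fejer_int K (h N) s) \<longlonglongrightarrow> fejer_int K g s"
proof -
  define H where "H h t = of_real (1 - t / K) * (cis (t * s) * h t + cis (- (t * s)) * h (- t))" for h :: "real \<Rightarrow> complex" and t
  have cont: "continuous_on {0..K} (H (h N))" for N
  proof -
    have 1: "continuous_on {0..K} (h N)" by (rule continuous_on_subset[OF h]) auto
    have 2: "continuous_on {0..K} (\<lambda>t. h N (- t))"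
      by (rule continuous_on_compose2[OF h]) (auto intro!: continuous_intros)
    show ?thesis unfolding H_def using K by (intro continuous_intros continuous_on_cis 1 2) auto
  qed
  have unif: "uniform_limit {0..K} (\<lambda>N. H (h N)) (H g) sequentially"
  proof (rule uniform_limitI)
    fix e :: real assume e: "e > 0"
    have "\<forall>\<^sub>F N in sequentially. \<forall>t\<in>{-K..K}. dist (h N t) (g t) < e / 2"
      using lim half_gt_zero[OF e] unfolding uniform_limit_iff by blast
    then show "\<forall>\<^sub>F N in sequentially. \<forall>t\<in>{0..K}. dist (H (h N) t) (H g t) < e"
    proof eventually_elim
      case (elim N)
      show ?case
      proof
        fix t assume t: "t \<in> {0..K}"
        have d: "norm (h N t - g t) < e / 2" "norm (h N (- t) - g (- t)) < e / 2"
          using elim t by (auto simp: dist_norm)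
        have "norm (H (h N) t - H g t) = \<bar>1 - t / K\<bar> * norm (cis (t * s) * (h N t - g t) + cis (- (t * s)) * (h N (- t) - g (- t)))"
        proof -
          have "H (h N) t - H g t = of_real (1 - t / K) * (cis (t * s) * (h N t - g t) + cis (- (t * s)) * (h N (- t) - g (- t)))"
            unfolding H_def by (simp add: algebra_simps)
          then show ?thesis by (simp only: norm_mult norm_of_real)
        qed
        also have "\<dots> \<le> 1 * (norm (h N t - g t) + norm (h N (- t) - g (- t)))"
        proof (intro mult_mono)
          have "0 \<le> t / K" "t / K \<le> 1" using t K by auto
          then show "\<bar>1 - t / K\<bar> \<le> 1" by linarith
          show "norm (cis (t * s) * (h N t - g t) + cis (- (t * s)) * (h N (- t) - g (- t))) \<le> norm (h N t - g t) + norm (h N (- t) - g (- t))"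
            using norm_triangle_ineq[of "cis (t * s) * (h N t - g t)" "cis (- (t * s)) * (h N (- t) - g (- t))"]
            by (simp only: norm_mult norm_cis mult_1_left)
        qed auto
        also have "\<dots> < e" using d by simp
        finally show "dist (H (h N) t) (H g t) < e" by (simp add: dist_norm)
      qed
    qed
  qed
  obtain I J where IJ: "\<And>N. (H (h N) has_integral I N) {0..K}" "(H g has_integral J) {0..K}" "I \<longlonglongrightarrow> J"
    by (rule uniform_limit_integral[OF unif cont]) auto
  have "fejer_int K (h N) s = I N" for N using IJ(1)[of N] unfolding H_def fejer_int_def by (rule integral_unique)
  moreover have "fejer_int K g s = J" using IJ(2) unfolding H_def fejer_int_def by (rule integral_unique)
  ultimately show ?thesis using IJ(3) by simp
qed

text \<open>On the line Re s = 1 + \<kappa> the series converges uniformly in \<open>t\<close> and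
  can be integrated term by term; the term of index \<open>n\<close> oscillates with frequency
  \<open>ln n\<close> and yields the kernel at \<open>s - ln n\<close>.\<close>

lemma fejer_int_dseries:
  assumes K: "K > 0" and c: "log_bounded c" and \<kappa>: "\<kappa> > 0"
  shows "(\<lambda>n. c n * of_real (real n powr (-1 - \<kappa>) * fejer K (s - ln (real n)))) sums
     fejer_int K (\<lambda>t. dseries c (of_real (1 + \<kappa>) + \<i> * of_real t)) s"
proof -
  define f where "f n t = dterm c (of_real (1 + \<kappa>) + \<i> * of_real t) n" for n t
  have ft: "f n t = c n * of_real (real n powr (-1 - \<kappa>)) * cis (- (t * ln (real n)))" for n t
    using nat_powr_line[of n \<kappa> t] by (cases "n = 0") (auto simp: f_def dterm_def)
  have fc: "continuous_on A (f n)" for A n unfolding ft[abs_def] by (intro continuous_intros continuous_on_cis)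
  have unif: "uniform_limit {-K..K} (\<lambda>N t. \<Sum>n<N. f n t) (\<lambda>t. \<Sum>n. f n t) sequentially"
  proof (rule Weierstrass_m_test)
    show "norm (f n t) \<le> norm (c n) * real n powr (-(1 + \<kappa>))" for n t
      unfolding f_def norm_dterm by simp
    show "summable (\<lambda>n. norm (c n) * real n powr (-(1 + \<kappa>)))" using \<kappa> by (intro log_bounded_summable c) auto
  qed
  have lim: "(\<lambda>N. fejer_int K (\<lambda>t. \<Sum>n<N. f n t) s) \<longlonglongrightarrow> fejer_int K (\<lambda>t. \<Sum>n. f n t) s"
    by (rule uniform_limit_fejer_int[OF K _ unif]) (intro continuous_on_sum fc)
  have fin: "fejer_int K (\<lambda>t. \<Sum>n<N. f n t) s = (\<Sum>n<N. c n * of_real (real n powr (-1 - \<kappa>) * fejer K (s - ln (real n))))" for N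
  proof -
    have I: "((\<lambda>t. of_real (1 - t / K) * (cis (t * s) * f n t + cis (- (t * s)) * f n (- t))) has_integral
        c n * of_real (real n powr (-1 - \<kappa>) * fejer K (s - ln (real n)))) {0..K}" for n
    proof -
      let ?g = "\<lambda>t. of_real (1 - t / K) * (cis (t * s) * cis (- (t * ln (real n))) + cis (- (t * s)) * cis (- (- t * ln (real n))))"
      have "?g integrable_on {0..K}"
        using K by (intro integrable_continuous_interval continuous_intros continuous_on_cis) auto
      then have "(?g has_integral of_real (fejer K (s - ln (real n)))) {0..K}"
        using fejer_int_power[OF K, of "ln (real n)" s] unfolding fejer_int_def by (simp add: has_integral_iff)
      then have "((\<lambda>t. (c n * of_real (real n powr (-1 - \<kappa>))) * ?g t) has_integral (c n * of_real (real n powr (-1 - \<kappa>))) * of_real (fejer K (s - ln (real n)))) {0..K}"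
        by (rule has_integral_mult_right)
      then show ?thesis unfolding ft by (simp add: algebra_simps)
    qed
    have "((\<lambda>t. \<Sum>n<N. of_real (1 - t / K) * (cis (t * s) * f n t + cis (- (t * s)) * f n (- t))) has_integral
       (\<Sum>n<N. c n * of_real (real n powr (-1 - \<kappa>) * fejer K (s - ln (real n))))) {0..K}"
      by (intro has_integral_sum I) auto
    moreover have "(\<Sum>n<N. of_real (1 - t / K) * (cis (t * s) * f n t + cis (- (t * s)) * f n (- t))) =
       of_real (1 - t / K) * (cis (t * s) * (\<Sum>n<N. f n t) + cis (- (t * s)) * (\<Sum>n<N. f n (- t)))" for t
      by (simp only: sum_distrib_left sum.distrib distrib_left)
    ultimately show ?thesis unfolding fejer_int_def by (simp only: integral_unique)
  qed
  have "(\<lambda>t. \<Sum>n. f n t) = (\<lambda>t. dseries c (of_real (1 + \<kappa>) + \<i> * of_real t))"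
    by (simp add: f_def dseries_def)
  then show ?thesis using lim unfolding sums_def fin by simp
qed

text \<open>Integration by parts gives decay \<open>1 / s\<close> for a polynomial, and
  Stone-Weierstrass reduces a continuous \<open>h\<close> to that case.\<close>

lemma riemann_lebesgue_interval:
  assumes K: "K > 0" and h: "continuous_on {0..K} (h :: real \<Rightarrow> complex)"
  shows "((\<lambda>s. integral {0..K} (\<lambda>t. cis (t * s) * h t)) \<longlongrightarrow> 0) at_top"
    and "((\<lambda>s. integral {0..K} (\<lambda>t. cis (- (t * s)) * h t)) \<longlongrightarrow> 0) at_top"
proof -
  \<comment> \<open>The sign \<open>\<sigma>\<close> treats both exponentials at once.\<close>
  have main: "((\<lambda>s. integral {0..K} (\<lambda>t. cis (t * (\<sigma> * s)) * h t)) \<longlongrightarrow> 0) at_top" if \<sigma>: "\<bar>\<sigma>\<bar> = 1" for \<sigma> :: real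
  proof (rule tendstoI)
    fix e :: real assume e: "e > 0"
    obtain p where p: "polynomial_function p" "\<And>t. t \<in> {0..K} \<Longrightarrow> norm (h t - p t) < e / (2 * K)"
      using Stone_Weierstrass_polynomial_function[of "{0..K}" h "e / (2 * K)"] h e K by auto
    obtain p' where p': "polynomial_function p'" "\<And>t. (p has_vector_derivative p' t) (at t)"
      using has_vector_derivative_polynomial_function[OF p(1)] by blast
    have pc: "continuous_on A p" "continuous_on A p'" for A
      using p(1) p'(1) by (auto intro: continuous_on_polymonial_function)
    have "bounded (p' ` {0..K})" by (intro compact_imp_bounded compact_continuous_image pc) auto
    then obtain B where B: "\<And>t. t \<in> {0..K} \<Longrightarrow> norm (p' t) \<le> B" by (metis bounded_iff image_eqI)
    have B0: "B \<ge> 0" using order_trans[OF norm_ge_zero B[of 0]] K by simp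
    define C where "C = norm (p K) + norm (p 0) + B * K"
    have C: "C \<ge> 0" using B0 K by (simp add: C_def)
    have bound: "norm (integral {0..K} (\<lambda>t. cis (t * (\<sigma> * s)) * h t)) \<le> C / s + e / 2" if s: "s > 0" for s
    proof -
      define z where "z = \<i> * of_real (\<sigma> * s)"
      have z: "z \<noteq> 0" "norm z = s" using s \<sigma> by (auto simp: z_def norm_mult abs_mult)
      have cz: "cis (t * (\<sigma> * s)) = exp (of_real t * z)" for t by (simp add: z_def cis_conv_exp mult_ac)
      define G where "G t = exp (of_real t * z) * p t / z" for t
      have "((\<lambda>t. exp (of_real t * z) * p t + exp (of_real t * z) * p' t / z) has_integral (G K - G 0)) {0..K}"
      proof (rule fundamental_theorem_of_calculus)
        fix t
        have "((\<lambda>t. exp (of_real t * z)) has_vector_derivative (exp (of_real t * z) * z)) (at t)"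
          by (rule has_vector_derivative_real_field) (auto intro!: derivative_eq_intros)
        then have "(G has_vector_derivative ((exp (of_real t * z) * p' t + (exp (of_real t * z) * z) * p t) / z)) (at t)"
          unfolding G_def by (intro has_vector_derivative_divide has_vector_derivative_mult p'(2))
        then have "(G has_vector_derivative (exp (of_real t * z) * p t + exp (of_real t * z) * p' t / z)) (at t)"
          using z by (simp add: add_divide_distrib add.commute)
        then show "(G has_vector_derivative (exp (of_real t * z) * p t + exp (of_real t * z) * p' t / z)) (at t within {0..K})"
          by (rule has_vector_derivative_at_within)
      qed (use K in auto)
      then have I1: "((\<lambda>t. cis (t * (\<sigma> * s)) * p t + cis (t * (\<sigma> * s)) * p' t / z) has_integral (G K - G 0)) {0..K}"
        by (simp only: cz)
      have i2: "(\<lambda>t. cis (t * (\<sigma> * s)) * p' t / z) integrable_on {0..K}"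
        using z by (intro integrable_continuous_interval continuous_intros continuous_on_cis pc) auto
      have i3: "(\<lambda>t. cis (t * (\<sigma> * s)) * (h t - p t)) integrable_on {0..K}"
        by (intro integrable_continuous_interval continuous_intros continuous_on_cis pc h)
      have eq: "cis (t * (\<sigma> * s)) * h t = (cis (t * (\<sigma> * s)) * p t + cis (t * (\<sigma> * s)) * p' t / z)
          - cis (t * (\<sigma> * s)) * p' t / z + cis (t * (\<sigma> * s)) * (h t - p t)" for t
        by (simp add: right_diff_distrib)
      define I2 where "I2 = integral {0..K} (\<lambda>t. cis (t * (\<sigma> * s)) * p' t / z)"
      define I3 where "I3 = integral {0..K} (\<lambda>t. cis (t * (\<sigma> * s)) * (h t - p t))"
      have "((\<lambda>t. cis (t * (\<sigma> * s)) * h t) has_integral ((G K - G 0) - I2 + I3)) {0..K}"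
        unfolding eq I2_def I3_def by (intro has_integral_add has_integral_diff I1 integrable_integral i2 i3)
      then have "integral {0..K} (\<lambda>t. cis (t * (\<sigma> * s)) * h t) = (G K - G 0) - I2 + I3" by (rule integral_unique)
      then have "norm (integral {0..K} (\<lambda>t. cis (t * (\<sigma> * s)) * h t)) \<le> (norm (G K) + norm (G 0)) + norm I2 + norm I3"
        using norm_triangle_ineq4[of "G K" "G 0"] norm_triangle_ineq4[of "G K - G 0" I2] norm_triangle_ineq[of "G K - G 0 - I2" I3]
        by simp
      also have "\<dots> \<le> (norm (p K) / s + norm (p 0) / s) + B / s * K + e / (2 * K) * K"
      proof (intro add_mono)
        have nG: "norm (G t) = norm (p t) / s" for t
          unfolding G_def cz[symmetric] using z by (simp add: norm_mult norm_divide)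
        show "norm (G K) \<le> norm (p K) / s" "norm (G 0) \<le> norm (p 0) / s" unfolding nG by auto
        have "norm I2 \<le> B / s * (K - 0)" unfolding I2_def
        proof (rule integral_bound)
          show "continuous_on {0..K} (\<lambda>t. cis (t * (\<sigma> * s)) * p' t / z)"
            using z by (intro continuous_intros continuous_on_cis pc) auto
        qed (use K B z s in \<open>auto simp: norm_mult norm_divide divide_right_mono\<close>)
        then show "norm I2 \<le> B / s * K" by simp
        have "norm I3 \<le> e / (2 * K) * (K - 0)" unfolding I3_def
        proof (rule integral_bound)
          show "continuous_on {0..K} (\<lambda>t. cis (t * (\<sigma> * s)) * (h t - p t))"
            by (intro continuous_intros continuous_on_cis pc h)
        qed (use K p(2) in \<open>auto simp: norm_mult less_imp_le\<close>)
        then show "norm I3 \<le> e / (2 * K) * K" by simp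
      qed
      also have "\<dots> = C / s + e / 2" using K by (simp add: C_def add_divide_distrib)
      finally show ?thesis .
    qed
    have "\<forall>\<^sub>F s in at_top. s > max 0 (2 * C / e)" by (rule eventually_gt_at_top)
    then show "\<forall>\<^sub>F s in at_top. dist (integral {0..K} (\<lambda>t. cis (t * (\<sigma> * s)) * h t)) 0 < e"
    proof eventually_elim
      case (elim s)
      then have s: "s > 0" "2 * C / e < s" by auto
      then have "C / s < e / 2" using e by (simp add: field_simps)
      then have "norm (integral {0..K} (\<lambda>t. cis (t * (\<sigma> * s)) * h t)) < e" using bound[OF s(1)] by linarith
      then show ?case by simp
    qed
  qed
  show "((\<lambda>s. integral {0..K} (\<lambda>t. cis (t * s) * h t)) \<longlongrightarrow> 0) at_top" using main[of 1] by simp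
  show "((\<lambda>s. integral {0..K} (\<lambda>t. cis (- (t * s)) * h t)) \<longlongrightarrow> 0) at_top" using main[of "-1"] by simp
qed

lemma fejer_int_tendsto_0:
  assumes K: "K > 0" and h: "continuous_on {-K..K} h"
  shows "((\<lambda>s. fejer_int K h s) \<longlongrightarrow> 0) at_top"
proof -
  have 1: "continuous_on {0..K} h" by (rule continuous_on_subset[OF h]) auto
  have 2: "continuous_on {0..K} (\<lambda>t. h (- t))"
    by (rule continuous_on_compose2[OF h]) (auto intro!: continuous_intros)
  have c1: "continuous_on {0..K} (\<lambda>t. of_real (1 - t / K) * h t)"
   and c2: "continuous_on {0..K} (\<lambda>t. of_real (1 - t / K) * h (- t))"
    using K by (auto intro!: continuous_intros 1 2)
  have "fejer_int K h s = integral {0..K} (\<lambda>t. cis (t * s) * (of_real (1 - t / K) * h t)) +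
      integral {0..K} (\<lambda>t. cis (- (t * s)) * (of_real (1 - t / K) * h (- t)))" for s
    unfolding fejer_int_def
    by (subst integral_add[symmetric])
       (auto intro!: integrable_continuous_interval continuous_intros continuous_on_cis c1 c2 1 2 simp: algebra_simps K less_imp_neq[OF K, symmetric])
  then show ?thesis using tendsto_add[OF riemann_lebesgue_interval(1)[OF K c1] riemann_lebesgue_interval(2)[OF K c2]] by simp
qed

section \<open>Smoothed sums over ln n\<close>

definition fejer_sum :: "(nat \<Rightarrow> real) \<Rightarrow> real \<Rightarrow> real \<Rightarrow> real" where
  "fejer_sum a K s = (\<Sum>n. a n / real n * fejer K (s - ln (real n)))"

text \<open>Mean value theorem for \<open>arctan (ln u - s)\<close> between \<open>n\<close> and
  \<open>n + 1\<close>. The factor 6 is 2 times 3: \<open>u \<le> 2 * n\<close>, and a change of the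
  logarithm by at most 1 alters \<open>1 + v\<^sup>2\<close> by a factor of at most 3.\<close>

lemma arctan_ln_increment:
  assumes n: "n \<ge> 1"
  shows "1 / real n * (1 / (1 + (s - ln (real n))\<^sup>2)) \<le> 6 * (arctan (ln (real (Suc n)) - s) - arctan (ln (real n) - s))"
proof -
  define f where "f u = arctan (ln u - s)" for u
  have d: "(f has_real_derivative (1 / u) * (1 / (1 + (ln u - s)\<^sup>2))) (at u)" if "u > 0" for u
    unfolding f_def using that by (auto intro!: derivative_eq_intros simp: field_simps)
  obtain u where u: "real n < u" "u < real (Suc n)" "f (real (Suc n)) - f (real n) = (real (Suc n) - real n) * ((1 / u) * (1 / (1 + (ln u - s)\<^sup>2)))"
    using MVT2[of "real n" "real (Suc n)" f "\<lambda>u. (1 / u) * (1 / (1 + (ln u - s)\<^sup>2))"] d n by auto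
  define v where "v = s - ln (real n)"
  have u0: "u > 0" "u \<le> 2 * real n" using u n by auto
  have "ln u \<le> ln (2 * real n)" using u0 n by simp
  also have "\<dots> = ln 2 + ln (real n)" using n by (simp add: ln_mult)
  also have "ln (2::real) \<le> 1" using ln_2_less_1 by simp
  finally have l1: "ln u \<le> 1 + ln (real n)" by simp
  have l2: "ln (real n) \<le> ln u" using u n by simp
  have "\<bar>ln u - s\<bar> \<le> \<bar>v\<bar> + 1" using l1 l2 unfolding v_def by linarith
  then have "(ln u - s)\<^sup>2 \<le> (\<bar>v\<bar> + 1)\<^sup>2" using power_mono[of "\<bar>ln u - s\<bar>" "\<bar>v\<bar> + 1" 2] by simp
  also have "\<dots> \<le> 2 * v\<^sup>2 + 2"
    using sum_squares_bound[of "\<bar>v\<bar>" 1] by (simp add: power2_eq_square algebra_simps)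
  finally have "1 + (ln u - s)\<^sup>2 \<le> 1 + (2 * v\<^sup>2 + 2)" by (rule add_left_mono)
  also have "\<dots> \<le> 3 * (1 + v\<^sup>2)" by simp
  finally have q: "1 + (ln u - s)\<^sup>2 \<le> 3 * (1 + v\<^sup>2)" .
  have pos: "1 + (ln u - s)\<^sup>2 > 0" "1 + v\<^sup>2 > 0" by (auto intro: add_pos_nonneg)
  have "u * (1 + (ln u - s)\<^sup>2) \<le> (2 * real n) * (3 * (1 + v\<^sup>2))"
    using u0 q pos by (intro mult_mono) auto
  then have "1 / ((2 * real n) * (3 * (1 + v\<^sup>2))) \<le> 1 / (u * (1 + (ln u - s)\<^sup>2))"
    using u0 pos n by (intro divide_left_mono) auto
  moreover have "1 / a * (1 / b) = 6 * (1 / ((2 * a) * (3 * b)))" for a b :: real by simp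
  then have "1 / real n * (1 / (1 + v\<^sup>2)) = 6 * (1 / ((2 * real n) * (3 * (1 + v\<^sup>2))))" .
  moreover have "f (real (Suc n)) - f (real n) = 1 / (u * (1 + (ln u - s)\<^sup>2))" using u(3) by simp
  moreover have "x \<le> 6 * d" if "y \<le> z" "x = 6 * y" "d = z" for x y z d :: real
    using that by simp
  ultimately show ?thesis unfolding f_def v_def by blast
qed

text \<open>The increments of \<open>arctan\<close> telescope to at most \<open>pi\<close>, so the
  bound is uniform in \<open>s\<close>.\<close>

lemma fejer_harmonic:
  assumes K: "K > 0"
  shows "summable (\<lambda>n. 1 / real n * fejer K (s - ln (real n)))"
    and "fejer_sum (\<lambda>_. 1) K s \<le> (K + 4 / K) * (6 * pi)"
proof -
  define w where "w n = 1 / real n * fejer K (s - ln (real n))" for n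
  have w0: "w n \<ge> 0" for n using fejer_nonneg[OF K] by (simp add: w_def)
  have Kp: "K + 4 / K > 0" using K by (simp add: add_pos_pos)
  have le: "w n \<le> (K + 4 / K) * (6 * (arctan (ln (real (Suc n)) - s) - arctan (ln (real n) - s)))" if n: "n \<ge> 1" for n
  proof -
    have "w n \<le> 1 / real n * ((K + 4 / K) / (1 + (s - ln (real n))\<^sup>2))"
      unfolding w_def by (intro mult_left_mono fejer_le_poisson[OF K]) auto
    also have "\<dots> = (K + 4 / K) * (1 / real n * (1 / (1 + (s - ln (real n))\<^sup>2)))" by simp
    also have "\<dots> \<le> (K + 4 / K) * (6 * (arctan (ln (real (Suc n)) - s) - arctan (ln (real n) - s)))"
      using Kp by (intro mult_left_mono arctan_ln_increment[OF n]) auto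
    finally show ?thesis .
  qed
  have part: "(\<Sum>n<N. w n) \<le> (K + 4 / K) * (6 * pi)" for N
  proof -
    have tel: "(\<Sum>n<Suc M. w n) \<le> (K + 4 / K) * (6 * (arctan (ln (real (Suc M)) - s) - arctan (ln 1 - s)))" for M
    proof (induction M)
      case 0
      then show ?case by (simp add: w_def)
    next
      case (Suc M)
      then show ?case using le[of "Suc M"] by (simp add: algebra_simps)
    qed
    have "arctan (ln (real (Suc N)) - s) - arctan (ln 1 - s) \<le> pi"
      using arctan_ubound[of "ln (real (Suc N)) - s"] arctan_lbound[of "ln 1 - s"] by linarith
    then have "(K + 4 / K) * (6 * (arctan (ln (real (Suc N)) - s) - arctan (ln 1 - s))) \<le> (K + 4 / K) * (6 * pi)"
      using Kp by (intro mult_left_mono) auto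
    with tel[of N] have "(\<Sum>n<Suc N. w n) \<le> (K + 4 / K) * (6 * pi)" by (rule order_trans)
    moreover have "(\<Sum>n<N. w n) \<le> (\<Sum>n<Suc N. w n)" using w0 by simp
    ultimately show ?thesis by (rule order_trans[rotated])
  qed
  have sw: "summable w"
  proof (rule bounded_imp_summable[OF w0])
    show "(\<Sum>k\<le>n. w k) \<le> (K + 4 / K) * (6 * pi)" for n
      using part[of "Suc n"] by (simp only: lessThan_Suc_atMost)
  qed
  then show "summable (\<lambda>n. 1 / real n * fejer K (s - ln (real n)))" unfolding w_def .
  have "(\<Sum>n. w n) \<le> (K + 4 / K) * (6 * pi)" using part by (intro suminf_le_const sw)
  then show "fejer_sum (\<lambda>_. 1) K s \<le> (K + 4 / K) * (6 * pi)" unfolding fejer_sum_def w_def .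
qed

lemma harmonic_window:
  fixes d :: real
  assumes d: "d > 0"
  shows "\<forall>\<^sub>F s in at_top. (\<Sum>n | s < ln (real n) \<and> ln (real n) \<le> s + d. 1 / real n) \<ge> d / 2"
    and "finite {n. s < ln (real n) \<and> ln (real n) \<le> s + d}"
proof -
  have fin: "finite {n. s < ln (real n) \<and> ln (real n) \<le> s + d}" for s
  proof (rule finite_subset)
    show "{n. s < ln (real n) \<and> ln (real n) \<le> s + d} \<subseteq> {..nat \<lfloor>exp (s + d)\<rfloor>}"
    proof
      fix n assume n: "n \<in> {n. s < ln (real n) \<and> ln (real n) \<le> s + d}"
      have "real n \<le> exp (s + d)"
      proof (cases "n = 0")
        case False
        then have "real n = exp (ln (real n))" by simp
        also have "\<dots> \<le> exp (s + d)" using n by (subst exp_le_cancel_iff) simp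
        finally show ?thesis .
      qed simp
      then show "n \<in> {..nat \<lfloor>exp (s + d)\<rfloor>}" by (simp add: le_nat_floor)
    qed
  qed simp
  show "finite {n. s < ln (real n) \<and> ln (real n) \<le> s + d}" by (rule fin)
  \<comment> \<open>Comparison with the logarithm bounds the window sum below by this difference, as
    the first integer beyond \<open>exp s\<close> is at most \<open>exp s + 1\<close>.\<close>
  have "((\<lambda>s. s + d - ln (exp s + 1)) \<longlongrightarrow> d) at_top" by real_asymp
  then have "\<forall>\<^sub>F s in at_top. s + d - ln (exp s + 1) > d / 2"
    using d by (intro order_tendstoD(1)) auto
  then show "\<forall>\<^sub>F s in at_top. (\<Sum>n | s < ln (real n) \<and> ln (real n) \<le> s + d. 1 / real n) \<ge> d / 2"
    using eventually_ge_at_top[of 0]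
  proof eventually_elim
    case (elim s)
    define N1 N2 where "N1 = nat \<lfloor>exp s\<rfloor> + 1" and "N2 = nat \<lfloor>exp (s + d)\<rfloor>"
    have e1: "exp s < real N1" "real N1 \<le> exp s + 1" unfolding N1_def using exp_gt_zero[of s] by (simp_all add: of_nat_nat) linarith
    have e2: "real N2 \<le> exp (s + d)" "exp (s + d) < real N2 + 1" unfolding N2_def using exp_gt_zero[of "s + d"] by (simp_all add: of_nat_nat)
    have N1: "real N1 > 0" using e1(1) exp_gt_zero[of s] by linarith
    have sub: "{N1..N2} \<subseteq> {n. s < ln (real n) \<and> ln (real n) \<le> s + d}"
    proof
      fix n assume n: "n \<in> {N1..N2}"
      then have n': "exp s < real n" "real n \<le> exp (s + d)" using e1 e2 by (force, force)
      then have "real n > 0" using exp_gt_zero[of s] by linarith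
      then show "n \<in> {n. s < ln (real n) \<and> ln (real n) \<le> s + d}"
        using n' by (metis exp_le_cancel_iff exp_less_cancel_iff exp_ln mem_Collect_eq)
    qed
    have "s + d - ln (exp s + 1) \<le> ln (real N2 + 1) - ln (real N1)"
    proof -
      have "s + d = ln (exp (s + d))" by simp
      also have "\<dots> \<le> ln (real N2 + 1)" using e2 by (intro ln_mono) auto
      finally have "s + d \<le> ln (real N2 + 1)" .
      moreover have "ln (real N1) \<le> ln (exp s + 1)" using e1 N1 by (intro ln_mono) auto
      ultimately show ?thesis by simp
    qed
    also have "ln (real N2 + 1) - ln (real N1) \<le> (\<Sum>n\<in>{N1..N2}. 1 / real n)"
    proof (cases "N1 \<le> Suc N2")
      case True
      have "ln (real (Suc M)) - ln (real N1) \<le> (\<Sum>n\<in>{N1..M}. 1 / real n)" if "N1 \<le> Suc M" for M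
        using that
      proof (induction M)
        case 0
        then have "N1 = 1" using N1 by linarith
        then show ?case by simp
      next
        case (Suc M)
        show ?case
        proof (cases "N1 = Suc (Suc M)")
          case False
          then have le: "N1 \<le> Suc M" using Suc.prems by simp
          define x where "x = real (Suc M)"
          have x: "x > 0" by (simp add: x_def)
          have "ln (x + 1) - ln x = ln (1 + 1 / x)"
            using x by (simp add: ln_divide_pos[symmetric] add_divide_distrib)
          then have "ln (real (Suc (Suc M))) - ln (real (Suc M)) = ln (1 + 1 / real (Suc M))"
            by (simp add: x_def add_ac)
          also have "\<dots> \<le> 1 / real (Suc M)" by (intro ln_add_one_self_le_self) simp
          finally show ?thesis using Suc.IH[OF le] le by (simp del: of_nat_Suc)
        qed simp
      qed
      from this[OF True] show ?thesis by (simp add: add.commute)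
    next
      case False
      then have "real N2 + 1 < real N1" by linarith
      then have "ln (real N2 + 1) \<le> ln (real N1)" by (intro ln_mono) auto
      then show ?thesis using False by simp
    qed
    also have "\<dots> \<le> (\<Sum>n | s < ln (real n) \<and> ln (real n) \<le> s + d. 1 / real n)"
      using sub fin by (intro sum_mono2) auto
    finally show ?case using elim by linarith
  qed
qed

lemma fejer_harmonic_lower:
  assumes K: "K > 0" shows "\<forall>\<^sub>F s in at_top. fejer_sum (\<lambda>_. 1) K s \<ge> 1 / 4"
proof -
  have "\<forall>\<^sub>F s in at_top. (\<Sum>n | s < ln (real n) \<and> ln (real n) \<le> s + 1 / K. 1 / real n) \<ge> (1 / K) / 2"
    using K by (intro harmonic_window(1)) auto
  then show ?thesis
  proof eventually_elim
    case (elim s)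
    define A where "A = {n. s < ln (real n) \<and> ln (real n) \<le> s + 1 / K}"
    have fA: "finite A" unfolding A_def using K by (intro harmonic_window(2)) auto
    \<comment> \<open>The window has mass at least \<open>1 / (2 * K)\<close>, and the kernel is at
      least \<open>K / 2\<close> on it.\<close>
    have "1 / 4 = (K / 2) * ((1 / K) / 2)" using K by simp
    also have "\<dots> \<le> (K / 2) * (\<Sum>n\<in>A. 1 / real n)" using elim K by (intro mult_left_mono) (auto simp: A_def)
    also have "\<dots> = (\<Sum>n\<in>A. 1 / real n * (K / 2))" by (simp only: sum_distrib_left mult.commute)
    also have "\<dots> \<le> (\<Sum>n\<in>A. 1 / real n * fejer K (s - ln (real n)))"
      by (intro sum_mono mult_left_mono fejer_ge[OF K]) (auto simp: A_def)
    also have "\<dots> \<le> fejer_sum (\<lambda>_. 1) K s"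
      unfolding fejer_sum_def using fejer_nonneg[OF K] by (intro sum_le_suminf fejer_harmonic(1)[OF K] fA) auto
    finally show ?case .
  qed
qed

text \<open>A Tauberian theorem of Wiener--Ikehara type: only continuity up to the line \<open>Re s = 1\<close> is needed.\<close>
lemma fejer_sum_asymp:
  fixes a :: "nat \<Rightarrow> real" and \<rho> :: real
  assumes K: "K > 0" and a: "\<And>n. a n \<ge> 0" and \<rho>: "\<rho> \<ge> 0" and lb: "log_bounded (\<lambda>n. of_real (a n))"
    and g: "continuous_on {s. Re s \<ge> 1} g"
      "\<And>s. Re s > 1 \<Longrightarrow> dseries (\<lambda>n. of_real (a n)) s - of_real \<rho> * dseries (\<lambda>_. 1) s = g s"
  shows "summable (\<lambda>n. a n / real n * fejer K (s - ln (real n)))"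
    and "((\<lambda>s. fejer_sum a K s - \<rho> * fejer_sum (\<lambda>_. 1) K s) \<longlongrightarrow> 0) at_top"
proof -
  \<comment> \<open>The smoothed difference of the two series on the line Re s = 1 + \<kappa>;
    through the continuity of \<open>g\<close> it passes to the limit \<kappa> = 0.\<close>
  define G where "G \<kappa> s = Re (fejer_int K (\<lambda>t. g (of_real (1 + \<kappa>) + \<i> * of_real t)) s)" for \<kappa> s
  define w where "w s n = 1 / real n * fejer K (s - ln (real n))" for s n
  have w0: "w s n \<ge> 0" for s n using fejer_nonneg[OF K] by (simp add: w_def)
  define \<kappa> where "\<kappa> j = 1 / real (Suc j)" for j
  have \<kappa>: "\<kappa> j > 0" "\<kappa> j \<le> 1" for j by (auto simp: \<kappa>_def)
  have \<kappa>0: "\<kappa> \<longlonglongrightarrow> 0" unfolding \<kappa>_def by (rule LIMSEQ_Suc[OF lim_1_over_n])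
  have lb1: "log_bounded (\<lambda>_. 1)" by (rule bounded_imp_log_bounded[of _ 1]) simp
  have pw: "real n powr (-1 - k) * fejer K (s - ln (real n)) = real n powr (- k) * w s n" for n k s
    by (cases "n = 0") (simp_all add: w_def powr_diff powr_minus_divide)
  have powle: "real n powr (- \<kappa> j) * w s n \<le> w s n" for n j s
  proof (cases "n = 0")
    case False
    then have "real n powr (- \<kappa> j) \<le> real n powr 0" using \<kappa>[of j] by (intro powr_mono) auto
    then have "real n powr (- \<kappa> j) * w s n \<le> real n powr 0 * w s n" by (rule mult_right_mono[OF _ w0])
    then show ?thesis using False by simp
  qed (simp add: w_def)
  have pownn: "real n powr (- \<kappa> j) * w s n \<ge> 0" for n j s using w0 by simp
  have sa: "(\<lambda>n. a n * (real n powr (- k) * w s n)) sums Re (fejer_int K (\<lambda>t. dseries (\<lambda>n. of_real (a n)) (of_real (1 + k) + \<i> * of_real t)) s)"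
    if "k > 0" for k s
    using sums_Re[OF fejer_int_dseries[OF K lb that, of s]] unfolding pw by simp
  have s1: "(\<lambda>n. real n powr (- k) * w s n) sums Re (fejer_int K (\<lambda>t. dseries (\<lambda>_. 1) (of_real (1 + k) + \<i> * of_real t)) s)"
    if "k > 0" for k s
    using sums_Re[OF fejer_int_dseries[OF K lb1 that, of s]] unfolding pw by simp
  have s2: "(\<lambda>n. (a n - \<rho>) * (real n powr (- k) * w s n)) sums G k s" if k: "k > 0" for k s
  proof -
    have lb2: "log_bounded (\<lambda>n. of_real (a n) - of_real \<rho>)"
    proof -
      obtain C where C: "\<And>n. n \<ge> 1 \<Longrightarrow> norm (of_real (a n) :: complex) \<le> C * (1 + ln (real n))" using lb by (auto simp: log_bounded_def)
      show ?thesis unfolding log_bounded_def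
      proof (intro exI[of _ "C + \<bar>\<rho>\<bar>"] allI impI)
        fix n :: nat assume n: "n \<ge> 1"
        have "norm (of_real (a n) - of_real \<rho> :: complex) \<le> norm (of_real (a n) :: complex) + norm (of_real \<rho> :: complex)"
          by (rule norm_triangle_ineq4)
        also have "\<dots> \<le> C * (1 + ln (real n)) + \<bar>\<rho>\<bar> * (1 + ln (real n))"
          using C[OF n] n by (intro add_mono) (auto simp: algebra_simps)
        finally show "norm (of_real (a n) - of_real \<rho> :: complex) \<le> (C + \<bar>\<rho>\<bar>) * (1 + ln (real n))" by (simp add: distrib_right)
      qed
    qed
    have eq: "dseries (\<lambda>n. of_real (a n) - of_real \<rho>) z = g z" if z: "Re z > 1" for z
    proof -
      have "(\<lambda>n. dterm (\<lambda>n. of_real (a n)) z n - of_real \<rho> * dterm (\<lambda>_. 1) z n) sums g z"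
        unfolding g(2)[OF z, symmetric] by (intro sums_diff sums_mult dseries_sums lb lb1 z)
      moreover have "(\<lambda>n. dterm (\<lambda>n. of_real (a n)) z n - of_real \<rho> * dterm (\<lambda>_. 1) z n) = dterm (\<lambda>n. of_real (a n) - of_real \<rho>) z"
        by (simp add: dterm_def fun_eq_iff algebra_simps)
      ultimately show ?thesis by (simp add: dseries_def sums_iff)
    qed
    have "fejer_int K (\<lambda>t. dseries (\<lambda>n. of_real (a n) - of_real \<rho>) (of_real (1 + k) + \<i> * of_real t)) s
        = fejer_int K (\<lambda>t. g (of_real (1 + k) + \<i> * of_real t)) s"
      using k by (subst eq) auto
    then show ?thesis
      using sums_Re[OF fejer_int_dseries[OF K lb2 k, of s]] unfolding pw G_def by (simp del: of_real_add)
  qed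
  have Glim: "(\<lambda>j. G (\<kappa> j) s) \<longlonglongrightarrow> G 0 s" for s
    unfolding G_def
  proof (intro tendsto_Re uniform_limit_fejer_int[OF K])
    have cg: "continuous_on ({0..1} \<times> {-K..K}) (\<lambda>(k, t). g (of_real (1 + k) + \<i> * of_real t))"
      unfolding case_prod_unfold
      by (rule continuous_on_compose2[OF g(1)]) (auto intro!: continuous_intros)
    show "continuous_on {-K..K} (\<lambda>t. g (of_real (1 + \<kappa> j) + \<i> * of_real t))" for j
      by (rule continuous_on_compose2[OF g(1)]) (use \<kappa>[of j] in \<open>auto intro!: continuous_intros\<close>)
    have uc: "uniformly_continuous_on ({0..1} \<times> {-K..K}) (\<lambda>(k, t). g (of_real (1 + k) + \<i> * of_real t))"
      by (intro compact_uniformly_continuous cg compact_Times) auto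
    show "uniform_limit {-K..K} (\<lambda>j t. g (of_real (1 + \<kappa> j) + \<i> * of_real t)) (\<lambda>t. g (of_real (1 + 0) + \<i> * of_real t)) sequentially"
    proof (rule uniform_limitI)
      fix e :: real assume "e > 0"
      then obtain d where d: "d > 0" "\<And>x y. x \<in> {0..1} \<times> {-K..K} \<Longrightarrow> y \<in> {0..1} \<times> {-K..K} \<Longrightarrow> dist y x < d \<Longrightarrow>
          dist (case y of (k, t) \<Rightarrow> g (of_real (1 + k) + \<i> * of_real t)) (case x of (k, t) \<Rightarrow> g (of_real (1 + k) + \<i> * of_real t)) < e"
        using uc unfolding uniformly_continuous_on_def by meson
      have "\<forall>\<^sub>F j in sequentially. \<kappa> j < d" using \<kappa>0 d(1) by (rule order_tendstoD)
      then show "\<forall>\<^sub>F j in sequentially. \<forall>t\<in>{-K..K}. dist (g (of_real (1 + \<kappa> j) + \<i> * of_real t)) (g (of_real (1 + 0) + \<i> * of_real t)) < e"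
      proof eventually_elim
        case (elim j)
        show ?case
        proof
          fix t assume t: "t \<in> {-K..K}"
          have "dist (\<kappa> j, t) (0, t) < d" using elim \<kappa>[of j] by (simp add: dist_prod_def)
          then show "dist (g (of_real (1 + \<kappa> j) + \<i> * of_real t)) (g (of_real (1 + 0) + \<i> * of_real t)) < e"
            using d(2)[of "(0, t)" "(\<kappa> j, t)"] t \<kappa>[of j] by auto
        qed
      qed
    qed
  qed
  define A where "A s j = (\<Sum>n. a n * (real n powr (- \<kappa> j) * w s n))" for s j
  define B where "B s j = (\<Sum>n. real n powr (- \<kappa> j) * w s n)" for s j
  have AB: "A s j = \<rho> * B s j + G (\<kappa> j) s" for s j
  proof -
    have "(\<lambda>n. \<rho> * (real n powr (- \<kappa> j) * w s n) + (a n - \<rho>) * (real n powr (- \<kappa> j) * w s n)) sums (\<rho> * B s j + G (\<kappa> j) s)"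
      unfolding B_def using s1[OF \<kappa>(1)] s2[OF \<kappa>(1)] by (intro sums_add sums_mult) (auto simp: sums_iff)
    then have "(\<lambda>n. a n * (real n powr (- \<kappa> j) * w s n)) sums (\<rho> * B s j + G (\<kappa> j) s)" by (simp add: algebra_simps)
    then show ?thesis by (simp add: A_def sums_iff)
  qed
  have sumw: "summable (w s)" for s using fejer_harmonic(1)[OF K] by (simp add: w_def[abs_def])
  have Ble: "B s j \<le> (\<Sum>n. w s n)" for s j
    unfolding B_def using s1[OF \<kappa>(1)] by (intro suminf_le powle sumw) (auto simp: sums_iff)
  have pt: "(\<lambda>j. real n powr (- \<kappa> j) * w s n) \<longlonglongrightarrow> w s n" for n s
  proof (cases "n = 0")
    case False
    have "(\<lambda>j. real n powr (- \<kappa> j) * w s n) \<longlonglongrightarrow> real n powr (- 0) * w s n"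
      using False by (intro tendsto_intros \<kappa>0) auto
    then show ?thesis using False by simp
  qed (simp add: w_def)
  \<comment> \<open>Since \<open>a\<close> is nonnegative, every partial sum at \<kappa> = 0 is a
    limit of quantities below the bound; this also yields summability at \<kappa> = 0.\<close>
  have upper: "(\<Sum>n<N. a n * w s n) \<le> \<rho> * (\<Sum>n. w s n) + G 0 s" for N s
  proof (rule tendsto_le[OF sequentially_bot])
    show "(\<lambda>j. \<Sum>n<N. a n * (real n powr (- \<kappa> j) * w s n)) \<longlonglongrightarrow> (\<Sum>n<N. a n * w s n)"
      by (intro tendsto_sum tendsto_mult tendsto_const pt)
    show "(\<lambda>j. \<rho> * (\<Sum>n. w s n) + G (\<kappa> j) s) \<longlonglongrightarrow> \<rho> * (\<Sum>n. w s n) + G 0 s"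
      by (intro tendsto_add tendsto_const Glim)
    show "\<forall>\<^sub>F j in sequentially. (\<Sum>n<N. a n * (real n powr (- \<kappa> j) * w s n)) \<le> \<rho> * (\<Sum>n. w s n) + G (\<kappa> j) s"
    proof (intro always_eventually allI)
      fix j
      have "(\<Sum>n<N. a n * (real n powr (- \<kappa> j) * w s n)) \<le> A s j"
        unfolding A_def using sa[OF \<kappa>(1)] a pownn by (intro sum_le_suminf) (auto simp: sums_iff)
      also have "\<dots> \<le> \<rho> * (\<Sum>n. w s n) + G (\<kappa> j) s" unfolding AB using \<rho> Ble by (intro add_right_mono mult_left_mono)
      finally show "(\<Sum>n<N. a n * (real n powr (- \<kappa> j) * w s n)) \<le> \<rho> * (\<Sum>n. w s n) + G (\<kappa> j) s" .
    qed
  qed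
  have suma: "summable (\<lambda>n. a n * w s n)" for s
  proof (rule bounded_imp_summable)
    show "a n * w s n \<ge> 0" for n using a w0 by simp
    show "(\<Sum>k\<le>n. a k * w s k) \<le> \<rho> * (\<Sum>n. w s n) + G 0 s" for n
      using upper[of s "Suc n"] by (simp add: lessThan_Suc_atMost)
  qed
  then show "summable (\<lambda>n. a n / real n * fejer K (s - ln (real n)))" by (simp add: w_def)
  have le1: "(\<Sum>n. a n * w s n) \<le> \<rho> * (\<Sum>n. w s n) + G 0 s" for s
    by (intro suminf_le_const suma upper)
  \<comment> \<open>For the reverse bound the harmonic side is truncated instead, and the damping
    factor is dropped on the side of \<open>a\<close>.\<close>
  have lower: "\<rho> * (\<Sum>n<N. w s n) + G 0 s \<le> (\<Sum>n. a n * w s n)" for N s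
  proof (rule tendsto_upperbound[OF _ _ sequentially_bot])
    show "(\<lambda>j. \<rho> * (\<Sum>n<N. real n powr (- \<kappa> j) * w s n) + G (\<kappa> j) s) \<longlonglongrightarrow> \<rho> * (\<Sum>n<N. w s n) + G 0 s"
      by (intro tendsto_add tendsto_mult tendsto_const tendsto_sum pt Glim)
    show "\<forall>\<^sub>F j in sequentially. \<rho> * (\<Sum>n<N. real n powr (- \<kappa> j) * w s n) + G (\<kappa> j) s \<le> (\<Sum>n. a n * w s n)"
    proof (intro always_eventually allI)
      fix j
      have "(\<Sum>n<N. real n powr (- \<kappa> j) * w s n) \<le> B s j"
        unfolding B_def using s1[OF \<kappa>(1)] pownn by (intro sum_le_suminf) (auto simp: sums_iff)
      then have "\<rho> * (\<Sum>n<N. real n powr (- \<kappa> j) * w s n) + G (\<kappa> j) s \<le> A s j"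
        unfolding AB using \<rho> by (intro add_right_mono mult_left_mono)
      also have "\<dots> \<le> (\<Sum>n. a n * w s n)"
        unfolding A_def using sa[OF \<kappa>(1)] suma a powle by (intro suminf_le mult_left_mono) (auto simp: sums_iff)
      finally show "\<rho> * (\<Sum>n<N. real n powr (- \<kappa> j) * w s n) + G (\<kappa> j) s \<le> (\<Sum>n. a n * w s n)" .
    qed
  qed
  have le2: "\<rho> * (\<Sum>n. w s n) + G 0 s \<le> (\<Sum>n. a n * w s n)" for s
  proof (rule tendsto_upperbound[OF _ _ sequentially_bot])
    show "(\<lambda>N. \<rho> * (\<Sum>n<N. w s n) + G 0 s) \<longlonglongrightarrow> \<rho> * (\<Sum>n. w s n) + G 0 s"
      by (intro tendsto_add tendsto_mult tendsto_const summable_LIMSEQ sumw)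
  qed (simp add: lower)
  have "fejer_sum a K s - \<rho> * fejer_sum (\<lambda>_. 1) K s = G 0 s" for s
    using le1[of s] le2[of s] by (simp add: fejer_sum_def w_def)
  moreover have "((\<lambda>s. G 0 s) \<longlongrightarrow> Re 0) at_top"
    unfolding G_def
  proof (intro tendsto_Re fejer_int_tendsto_0[OF K])
    show "continuous_on {-K..K} (\<lambda>t. g (of_real (1 + 0) + \<i> * of_real t))"
      by (rule continuous_on_compose2[OF g(1)]) (auto intro!: continuous_intros)
  qed
  ultimately show "((\<lambda>s. fejer_sum a K s - \<rho> * fejer_sum (\<lambda>_. 1) K s) \<longlongrightarrow> 0) at_top" by simp
qed

section \<open>Primes congruent to one\<close>

text \<open>Inside the window the kernel, centred at the midpoint, is at most \<open>K\<close>;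
  outside, its argument has size at least \<open>d / 2\<close> and \<open>fejer_tail\<close>
  applies. The tail carries \<open>1 / K\<close>, so a large \<open>K\<close> leaves mass in the
  window.\<close>

lemma fejer_sum_window:
  fixes a :: "nat \<Rightarrow> real"
  assumes K: "K > 0" and d: "d > 0" and a: "\<And>n. a n \<ge> 0"
    and sm: "\<And>K s. K > 0 \<Longrightarrow> summable (\<lambda>n. a n / real n * fejer K (s - ln (real n)))"
  shows "fejer_sum a K (s + d / 2) \<le> K * (\<Sum>n | s < ln (real n) \<and> ln (real n) \<le> s + d. a n / real n)
      + (1 + pi / (d / 2))\<^sup>2 / K * (fejer_sum a 1 (s + d / 2) + fejer_sum a 1 (s + d / 2 + pi))"
proof -
  define A where "A = {n. s < ln (real n) \<and> ln (real n) \<le> s + d}"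
  have fA: "finite A" unfolding A_def by (rule harmonic_window(2)[OF d])
  define C where "C = (1 + pi / (d / 2))\<^sup>2 / K"
  define s' where "s' = s + d / 2"
  have C: "C \<ge> 0" using K by (simp add: C_def)
  have 1: "(\<lambda>n. if n \<in> A then K * (a n / real n) else 0) sums (\<Sum>n\<in>A. K * (a n / real n))"
    by (rule sums_If_finite_set[OF fA])
  have 2: "(\<lambda>n. C * (a n / real n * fejer 1 (s' - ln (real n)) + a n / real n * fejer 1 (s' + pi - ln (real n)))) sums
      (C * (fejer_sum a 1 s' + fejer_sum a 1 (s' + pi)))"
    unfolding fejer_sum_def by (intro sums_mult sums_add summable_sums sm) auto
  have 3: "(\<lambda>n. a n / real n * fejer K (s' - ln (real n))) sums fejer_sum a K s'"
    unfolding fejer_sum_def by (intro summable_sums sm K)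
  have "fejer_sum a K s' \<le> (\<Sum>n\<in>A. K * (a n / real n)) + C * (fejer_sum a 1 s' + fejer_sum a 1 (s' + pi))"
  proof (rule sums_le[OF _ 3 sums_add[OF 1 2]])
    fix n
    have an: "a n / real n \<ge> 0" using a by simp
    have sp: "C * (a n / real n * fejer 1 (s' - ln (real n)) + a n / real n * fejer 1 (s' + pi - ln (real n)))
       = a n / real n * (C * (fejer 1 (s' - ln (real n)) + fejer 1 (s' - ln (real n) + pi)))"
      by (simp add: algebra_simps)
    show "a n / real n * fejer K (s' - ln (real n)) \<le> (if n \<in> A then K * (a n / real n) else 0)
        + C * (a n / real n * fejer 1 (s' - ln (real n)) + a n / real n * fejer 1 (s' + pi - ln (real n)))"
    proof (cases "n \<in> A")
      case True
      have "a n / real n * fejer K (s' - ln (real n)) \<le> a n / real n * K"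
        by (intro mult_left_mono fejer_le(1)[OF K] an)
      moreover have "C * (a n / real n * fejer 1 (s' - ln (real n)) + a n / real n * fejer 1 (s' + pi - ln (real n))) \<ge> 0"
        using C an by (intro mult_nonneg_nonneg add_nonneg_nonneg fejer_nonneg) auto
      ultimately show ?thesis using True by (simp add: mult.commute)
    next
      case False
      then have "ln (real n) \<le> s \<or> s + d < ln (real n)" by (auto simp: A_def)
      then have "\<bar>s' - ln (real n)\<bar> \<ge> d / 2" unfolding s'_def by linarith
      then have "fejer K (s' - ln (real n)) \<le> C * (fejer 1 (s' - ln (real n)) + fejer 1 (s' - ln (real n) + pi))"
        unfolding C_def using d by (intro fejer_tail K) auto
      then have "a n / real n * fejer K (s' - ln (real n)) \<le> a n / real n * (C * (fejer 1 (s' - ln (real n)) + fejer 1 (s' - ln (real n) + pi)))"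
        by (rule mult_left_mono[OF _ an])
      then show ?thesis using False unfolding sp by simp
    qed
  qed
  then show ?thesis by (simp only: A_def C_def s'_def sum_distrib_left)
qed

text \<open>A proper prime power has exponent at least 2, so its base is at most
  \<open>exp (y / 2)\<close>, while its exponent is at most \<open>y / ln 2\<close>.\<close>

lemma nonprime_primepow_count:
  fixes y :: real
  assumes y: "y > 0"
  shows "real (card {n. primepow n \<and> \<not> prime n \<and> ln (real n) \<le> y}) \<le> (exp (y / 2) + 1) * (y / ln 2 + 1)"
    and "finite {n. primepow n \<and> \<not> prime n \<and> ln (real n) \<le> y}"
proof -
  let ?S = "{n :: nat. primepow n \<and> \<not> prime n \<and> ln (real n) \<le> y}"
  let ?P = "{..nat \<lfloor>exp (y / 2)\<rfloor>} \<times> {..nat \<lfloor>y / ln 2\<rfloor>}"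
  have sub: "?S \<subseteq> (\<lambda>(p, k). p ^ k) ` ?P"
  proof
    fix n assume n: "n \<in> ?S"
    then obtain p k where pk: "prime p" "k > 0" "n = p ^ k" by (auto simp: primepow_def)
    have k2: "k \<ge> 2"
    proof (rule ccontr)
      assume "\<not> k \<ge> 2"
      then have "k = 1" using pk(2) by simp
      then show False using n pk by simp
    qed
    have p2: "real p \<ge> 2" using prime_ge_2_nat[OF pk(1)] by simp
    have lnn: "ln (real n) = real k * ln (real p)" using p2 by (simp add: pk(3) ln_realpow)
    have lp: "ln (real p) > 0" using p2 by simp
    have "2 * ln (real p) \<le> real k * ln (real p)" using k2 lp by (intro mult_right_mono) auto
    also have "\<dots> \<le> y" using n lnn by simp
    finally have "ln (real p) \<le> y / 2" by simp
    then have "exp (ln (real p)) \<le> exp (y / 2)" by simp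
    then have "real p \<le> exp (y / 2)" using p2 by simp
    then have "p \<in> {..nat \<lfloor>exp (y / 2)\<rfloor>}" by (simp add: le_nat_floor)
    moreover have "real k * ln 2 \<le> real k * ln (real p)" using p2 by (intro mult_left_mono) auto
    then have "real k * ln 2 \<le> y" using n lnn by simp
    then have "real k \<le> y / ln 2" by (simp add: field_simps)
    then have "k \<in> {..nat \<lfloor>y / ln 2\<rfloor>}" by (simp add: le_nat_floor)
    ultimately show "n \<in> (\<lambda>(p, k). p ^ k) ` ?P" using pk(3) by auto
  qed
  then show "finite ?S" by (rule finite_subset) auto
  have "card ?S \<le> card ((\<lambda>(p, k). p ^ k) ` ?P)" using sub by (intro card_mono) auto
  also have "\<dots> \<le> card ?P" by (rule card_image_le) auto
  also have "\<dots> = (nat \<lfloor>exp (y / 2)\<rfloor> + 1) * (nat \<lfloor>y / ln 2\<rfloor> + 1)" by simp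
  finally have "real (card ?S) \<le> real ((nat \<lfloor>exp (y / 2)\<rfloor> + 1) * (nat \<lfloor>y / ln 2\<rfloor> + 1))" by (simp only: of_nat_le_iff)
  also have "\<dots> = (real (nat \<lfloor>exp (y / 2)\<rfloor>) + 1) * (real (nat \<lfloor>y / ln 2\<rfloor>) + 1)"
    by (simp only: of_nat_mult of_nat_add of_nat_1)
  also have "\<dots> \<le> (exp (y / 2) + 1) * (y / ln 2 + 1)"
    using y by (intro mult_mono add_right_mono) auto
  finally show "real (card ?S) \<le> (exp (y / 2) + 1) * (y / ln 2 + 1)" .
qed

text \<open>There are about \<open>exp (s / 2)\<close> proper prime powers, up to a factor linear in
  \<open>s\<close>, each of weight at most \<open>(s + d) / exp s\<close>.\<close>

lemma prime_power_window:
  assumes d: "d > 0"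
  shows "((\<lambda>s. \<Sum>n | s < ln (real n) \<and> ln (real n) \<le> s + d. if prime n then 0 else mangoldt n / real n) \<longlongrightarrow> (0::real)) at_top"
proof (rule Lim_null_comparison)
  show "((\<lambda>s. ((s + d) / exp s) * ((exp ((s + d) / 2) + 1) * ((s + d) / ln 2 + 1))) \<longlongrightarrow> 0) at_top"
    by real_asymp
  show "\<forall>\<^sub>F s in at_top. norm (\<Sum>n | s < ln (real n) \<and> ln (real n) \<le> s + d. if prime n then 0 else mangoldt n / real n :: real)
      \<le> ((s + d) / exp s) * ((exp ((s + d) / 2) + 1) * ((s + d) / ln 2 + 1))"
    using eventually_gt_at_top[of 0]
  proof eventually_elim
    case (elim s)
    define A where "A = {n. s < ln (real n) \<and> ln (real n) \<le> s + d}"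
    have fA: "finite A" unfolding A_def by (rule harmonic_window(2)[OF d])
    define Q where "Q = {n. primepow n \<and> \<not> prime n \<and> ln (real n) \<le> s + d}"
    have sd: "s + d > 0" using elim d by simp
    have Q: "finite Q" "real (card Q) \<le> (exp ((s + d) / 2) + 1) * ((s + d) / ln 2 + 1)"
      unfolding Q_def using nonprime_primepow_count[OF sd] by auto
    have le: "(if prime n then 0 else mangoldt n / real n) \<le> (if n \<in> Q then (s + d) / exp s else 0)" if n: "n \<in> A" for n
    proof (cases "n \<in> Q")
      case True
      have n0: "real n > 0" using True primepow_gt_0_nat[of n] by (simp add: Q_def)
      have "exp s < exp (ln (real n))" using n by (subst exp_less_cancel_iff) (simp add: A_def)
      then have es: "exp s < real n" using n0 by simp
      have "mangoldt n \<le> ln (real n)" using n0 by (intro mangoldt_le) simp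
      also have "\<dots> \<le> s + d" using n by (simp add: A_def)
      finally have "mangoldt n / real n \<le> (s + d) / exp s"
        using es sd by (intro frac_le) auto
      then show ?thesis using True by (simp add: Q_def)
    next
      case False
      then have "prime n \<or> \<not> primepow n" using n by (auto simp: Q_def A_def)
      then show ?thesis using False by (auto simp: mangoldt_def)
    qed
    have nn: "0 \<le> (\<Sum>n\<in>A. if prime n then 0 else mangoldt n / real n :: real)"
      by (intro sum_nonneg) (auto simp: mangoldt_nonneg)
    have "(\<Sum>n\<in>A. if prime n then 0 else mangoldt n / real n) \<le> (\<Sum>n\<in>A. if n \<in> Q then (s + d) / exp s else 0)"
      by (intro sum_mono le)
    also have "\<dots> = (\<Sum>n\<in>A \<inter> Q. (s + d) / exp s)" by (rule sum.inter_restrict[OF fA, symmetric])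
    also have "\<dots> = (s + d) / exp s * real (card (A \<inter> Q))" by simp
    also have "\<dots> \<le> (s + d) / exp s * real (card Q)"
      using sd Q(1) by (intro mult_left_mono) (auto intro: card_mono)
    also have "\<dots> \<le> ((s + d) / exp s) * ((exp ((s + d) / 2) + 1) * ((s + d) / ln 2 + 1))"
      using sd Q(2) by (intro mult_left_mono) auto
    finally show ?case using nn unfolding A_def by simp
  qed
qed

text \<open>The smoothed sum of \<open>a n / n\<close> stays near \<open>\<rho>\<close> times the
  harmonic one, which is bounded above and below. A large fixed \<open>K\<close> makes the tail at
  most half of the lower bound, so the window keeps positive mass; prime powers are negligible, and
  \<open>ln p \<le> s + d\<close> turns the mass into order \<open>1 / s\<close>.\<close>

theorem primes_dense_pos:
  assumes m: "m > 0" shows "primes_dense m"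
  unfolding primes_dense_def log_cell_def
proof (intro allI impI)
  fix d :: real assume d: "d > 0"
  define f :: "nat \<Rightarrow> complex" where "f n = (if [n = 1] (mod m) then 1 else 0)" for n
  define a :: "nat \<Rightarrow> real" where "a n = (if [n = 1] (mod m) then mangoldt n else 0)" for n
  define \<rho> where "\<rho> = 1 / real (totient m)"
  have \<rho>: "\<rho> > 0" using m by (simp add: \<rho>_def)
  have a0: "a n \<ge> 0" for n by (simp add: a_def mangoldt_nonneg)
  have af: "of_real (a n) = mangoldt n * f n" for n by (simp add: a_def f_def)
  have uf: "unit_fun m f"
    unfolding unit_fun_def
  proof (intro conjI allI impI)
    show "f x = f y" if "[x = y] (mod m)" for x y using that by (simp add: f_def cong_def)
    show "f n = 0" if "\<not> coprime n m" for n using that coprime_cong_iff[of n 1 m] by (auto simp: f_def)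
  qed
  have sf: "(\<Sum>a<m. f a) = 1"
  proof -
    have "(\<Sum>a<m. f a) = (\<Sum>a<m. if a = 1 mod m then 1 else 0)"
      by (intro sum.cong) (auto simp: f_def cong_def)
    also have "\<dots> = 1" using m by (simp add: sum.delta)
    finally show ?thesis .
  qed
  obtain g where g: "continuous_on {s. Re s \<ge> 1} g"
    "\<And>s. Re s > 1 \<Longrightarrow> Lambda_series f s - (\<Sum>a<m. f a) / of_nat (totient m) * dseries (\<lambda>_. 1) s = g s"
    using Lambda_series_extension[OF m uf] by blast
  have g2: "dseries (\<lambda>n. of_real (a n)) s - of_real \<rho> * dseries (\<lambda>_. 1) s = g s" if "Re s > 1" for s
    using g(2)[OF that] unfolding af sf by (simp add: \<rho>_def)
  have lb: "log_bounded (\<lambda>n. of_real (a n))"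
    unfolding af by (rule log_bounded_mangoldt[of _ 1]) (simp add: f_def)
  note asymp = fejer_sum_asymp[OF _ a0 less_imp_le[OF \<rho>] lb g(1) g2]
  \<comment> \<open>\<open>5 * (6 * pi)\<close> is the bound of \<open>fejer_harmonic\<close> at
    \<open>K = 1\<close>, and 1 absorbs the error.\<close>
  define M where "M = \<rho> * (5 * (6 * pi)) + 1"
  have M: "M > 0" using \<rho> pi_gt_zero by (simp add: M_def add_nonneg_pos)
  define C where "C = (1 + pi / (d / 2))\<^sup>2"
  have C: "C > 0" unfolding C_def using d by (intro zero_less_power add_pos_pos divide_pos_pos) auto
  \<comment> \<open>Chosen so that the two tail terms, each at most \<open>M\<close>, cost
    \<open>C / K * (2 * M) = \<rho> / 16\<close>, half of the lower bound \<open>\<rho> / 8\<close>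
    obtained below.\<close>
  define K where "K = C * (2 * M) * 16 / \<rho>"
  have K: "K > 0" using C M \<rho> by (simp add: K_def)
  have up: "\<forall>\<^sub>F s in at_top. fejer_sum a 1 s \<le> M"
  proof -
    have "\<forall>\<^sub>F s in at_top. fejer_sum a 1 s - \<rho> * fejer_sum (\<lambda>_. 1) 1 s < 1"
      by (rule order_tendstoD(2)[OF asymp(2)]) auto
    then show ?thesis
    proof eventually_elim
      case (elim s)
      have "\<rho> * fejer_sum (\<lambda>_. 1) 1 s \<le> \<rho> * (5 * (6 * pi))"
        using fejer_harmonic(2)[of 1 s] \<rho> by (intro mult_left_mono) auto
      then show ?case using elim by (simp add: M_def)
    qed
  qed
  have low: "\<forall>\<^sub>F s in at_top. \<rho> / 8 \<le> fejer_sum a K s"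
  proof -
    have "\<forall>\<^sub>F s in at_top. - (\<rho> / 8) < fejer_sum a K s - \<rho> * fejer_sum (\<lambda>_. 1) K s"
      by (rule order_tendstoD(1)[OF asymp(2)[OF K]]) (use \<rho> in auto)
    then show ?thesis using fejer_harmonic_lower[OF K]
    proof eventually_elim
      case (elim s)
      have "\<rho> * (1 / 4) \<le> \<rho> * fejer_sum (\<lambda>_. 1) K s" using elim(2) \<rho> by (intro mult_left_mono) auto
      then show ?case using elim(1) by simp
    qed
  qed
  have shift: "\<forall>\<^sub>F s in at_top. P (s + b)" if P: "\<forall>\<^sub>F s in at_top. P s" for P and b :: real
  proof -
    obtain s1 where "\<And>s. s \<ge> s1 \<Longrightarrow> P s" using P by (auto simp: eventually_at_top_linorder)
    then show ?thesis unfolding eventually_at_top_linorder by (intro exI[of _ "s1 - b"]) simp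
  qed
  \<comment> \<open>What remains of \<open>\<rho> / 8\<close> after the tail, divided by
    \<open>K\<close>. Prime powers take at most half of it and \<open>s + d \<le> 2 * s\<close>
    costs another factor 2, whence \<open>c1 / 4\<close> in the end.\<close>
  define c1 where "c1 = \<rho> / (16 * K)"
  have c1: "c1 > 0" using \<rho> K by (simp add: c1_def)
  have "\<forall>\<^sub>F s in at_top. (c1 / 4) / s \<le> (\<Sum>p | prime p \<and> [p = 1] (mod m) \<and> s < ln (real p) \<and> ln (real p) \<le> s + d. 1 / real p)"
    using shift[OF up, of "d / 2"] shift[OF up, of "d / 2 + pi"] shift[OF low, of "d / 2"]
      order_tendstoD(2)[OF prime_power_window[OF d] half_gt_zero[OF c1]] eventually_ge_at_top[of d]
  proof eventually_elim
    case (elim s)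
    define A where "A = {n. s < ln (real n) \<and> ln (real n) \<le> s + d}"
    have fA: "finite A" unfolding A_def by (rule harmonic_window(2)[OF d])
    have s0: "s > 0" using elim(5) d by linarith
    have "\<rho> / 8 \<le> K * (\<Sum>n\<in>A. a n / real n) + C / K * (fejer_sum a 1 (s + d / 2) + fejer_sum a 1 (s + d / 2 + pi))"
      unfolding A_def C_def by (rule order_trans[OF elim(3) fejer_sum_window[OF K d a0 asymp(1)]])
    also have "\<dots> \<le> K * (\<Sum>n\<in>A. a n / real n) + C / K * (M + M)"
      using elim(1,2) C K by (intro add_left_mono mult_left_mono add_mono) (auto simp: add.assoc)
    also have "C / K * (M + M) = \<rho> / 16" using C M \<rho> by (simp add: K_def field_simps)
    finally have "\<rho> / 16 \<le> K * (\<Sum>n\<in>A. a n / real n)" by simp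
    then have c1le: "c1 \<le> (\<Sum>n\<in>A. a n / real n)" using K by (simp add: c1_def field_simps)
    define P where "P = {p. prime p \<and> [p = 1] (mod m) \<and> s < ln (real p) \<and> ln (real p) \<le> s + d}"
    have PA: "P \<subseteq> A" by (auto simp: P_def A_def)
    have "(\<Sum>n\<in>A. a n / real n) \<le> (\<Sum>n\<in>A. (if n \<in> P then (s + d) * (1 / real n) else 0) + (if prime n then 0 else mangoldt n / real n))"
    proof (rule sum_mono)
      fix n assume n: "n \<in> A"
      show "a n / real n \<le> (if n \<in> P then (s + d) * (1 / real n) else 0) + (if prime n then 0 else mangoldt n / real n)"
      proof (cases "prime n \<and> [n = 1] (mod m)")
        case True
        then have "n \<in> P" using n by (auto simp: P_def A_def)
        moreover have "a n / real n \<le> (s + d) / real n"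
          using True n by (intro divide_right_mono) (auto simp: a_def A_def)
        ultimately show ?thesis using True by simp
      next
        case False
        then have "n \<notin> P" by (auto simp: P_def)
        then show ?thesis using False by (auto simp: a_def mangoldt_nonneg)
      qed
    qed
    also have "\<dots> = (\<Sum>n\<in>P. (s + d) * (1 / real n)) + (\<Sum>n\<in>A. if prime n then 0 else mangoldt n / real n)"
      unfolding sum.distrib using fA PA by (simp add: sum.inter_restrict[symmetric] Int_absorb1)
    also have "(\<Sum>n\<in>P. (s + d) * (1 / real n)) = (s + d) * (\<Sum>n\<in>P. 1 / real n)" by (simp only: sum_distrib_left)
    finally have "c1 \<le> (s + d) * (\<Sum>n\<in>P. 1 / real n) + c1 / 2"
      using c1le elim(4) unfolding A_def by linarith
    then have "c1 / 2 \<le> (s + d) * (\<Sum>n\<in>P. 1 / real n)" by simp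
    also have "\<dots> \<le> (2 * s) * (\<Sum>n\<in>P. 1 / real n)"
      using elim(5) by (intro mult_right_mono) (auto intro: sum_nonneg)
    finally have "(c1 / 4) / s \<le> (\<Sum>n\<in>P. 1 / real n)" using s0 by (simp add: field_simps)
    then show ?case unfolding P_def .
  qed
  then obtain s1 where s1: "\<And>s. s \<ge> s1 \<Longrightarrow> (c1 / 4) / s \<le> (\<Sum>p | prime p \<and> [p = 1] (mod m) \<and> s < ln (real p) \<and> ln (real p) \<le> s + d. 1 / real p)"
    by (auto simp: eventually_at_top_linorder)
  show "\<exists>c>0. \<exists>s0>0. \<forall>s\<ge>s0. c / s \<le> (\<Sum>p | prime p \<and> [p = 1] (mod m) \<and> s < ln (real p) \<and> ln (real p) \<le> s + d. 1 / real p)"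
    using c1 s1 by (intro exI[of _ "c1 / 4"] conjI exI[of _ "max 1 s1"]) auto
qed

section \<open>Averages along the number of prime factors\<close>

text \<open>\<open>prog_sum\<close> starts at 1, so the index 0 of the progression contributes only
  for \<open>r > 0\<close>; this is the extra term.\<close>

lemma prog_sum_affine:
  assumes m: "m \<ge> 1" and r: "r < m"
  shows "prog_sum m r a k (m * N + r) = (if r = 0 then 0 else a (big_Omega r + k)) + (\<Sum>n=1..N. a (big_Omega (m * n + r) + k))"
proof -
  have "prog_sum m r a k (m * N + r) = (\<Sum>n\<in>{n\<in>{1..m * N + r}. [n = r] (mod m)}. a (big_Omega n + k))"
    unfolding prog_sum_def by (rule sum.inter_filter[symmetric]) simp
  also have "\<dots> = (\<Sum>j\<in>{j\<in>{0..N}. m * j + r > 0}. a (big_Omega (m * j + r) + k))"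
  proof (rule sum.reindex_bij_witness[where i = "\<lambda>j. m * j + r" and j = "\<lambda>n. n div m"])
    fix n assume n: "n \<in> {n\<in>{1..m * N + r}. [n = r] (mod m)}"
    then have "n mod m = r" using r by (simp add: cong_def)
    then have eq: "m * (n div m) + r = n" using mult_div_mod_eq[of m n] by simp
    then show "m * (n div m) + r = n" .
    have "n div m \<le> (m * N + r) div m" using n by (intro div_le_mono) auto
    then have "n div m \<le> N" using r by simp
    moreover have "m * (n div m) + r > 0" unfolding eq using n by simp
    ultimately show "n div m \<in> {j\<in>{0..N}. m * j + r > 0}" by simp
    show "a (big_Omega (m * (n div m) + r) + k) = a (big_Omega n + k)" using eq by simp
  next
    fix j assume "j \<in> {j\<in>{0..N}. m * j + r > 0}"
    then show "m * j + r \<in> {n\<in>{1..m * N + r}. [n = r] (mod m)}" by (auto simp: cong_def Suc_le_eq)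
    show "(m * j + r) div m = j" using r by simp
  qed
  also have "{j\<in>{0..N}. m * j + r > 0} = (if r = 0 then {} else {0}) \<union> {1..N}"
    using m by (auto simp: Suc_le_eq)
  also have "(\<Sum>j\<in>(if r = 0 then {} else {0}) \<union> {1..N}. a (big_Omega (m * j + r) + k)) =
      (if r = 0 then 0 else a (big_Omega r + k)) + (\<Sum>n=1..N. a (big_Omega (m * n + r) + k))"
    by (subst sum.union_disjoint) auto
  finally show ?thesis .
qed

lemma big_Omega_shift_average:
  fixes a :: "nat \<Rightarrow> real"
  assumes dense: "primes_dense m" and m: "m \<ge> 1" and r: "r < m" and a: "\<And>n. \<bar>a n\<bar> \<le> B"
  shows "(\<lambda>N. (\<Sum>n=1..N. a (Suc (big_Omega (m * n + r))) - a (big_Omega (m * n + r))) / real N) \<longlonglongrightarrow> 0"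
proof -
  \<comment> \<open>Adding 1 keeps the scaling constant positive when \<open>B = 0\<close>.\<close>
  define C where "C = B + 1"
  have C: "C > 0" using order_trans[OF abs_ge_zero a[of 0]] by (simp add: C_def)
  define b where "b n = a n / C" for n
  have b: "\<bar>b n\<bar> \<le> 1" for n using a[of n] C by (simp add: b_def C_def)
  define D where "D N = (prog_sum m r b 0 N - prog_sum m r b 1 N) / real N" for N
  have D: "D \<longlonglongrightarrow> 0" unfolding D_def using prog_sum_shift[OF dense b] by simp
  have sub: "filterlim (\<lambda>N. m * N + r) sequentially sequentially"
    using m by (intro filterlim_at_top_mono[OF filterlim_ident]) (auto intro!: always_eventually trans_le_add1)
  have D': "(\<lambda>N. D (m * N + r)) \<longlonglongrightarrow> 0" by (rule filterlim_compose[OF D sub])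
  \<comment> \<open>The boundary term of \<open>prog_sum_affine\<close>: a constant, hence harmless
    after division by \<open>N\<close>.\<close>
  define e where "e = (if r = 0 then 0 else b (big_Omega r) - b (big_Omega r + 1))"
  have eq: "(\<Sum>n=1..N. a (Suc (big_Omega (m * n + r))) - a (big_Omega (m * n + r))) / real N
      = C * (e / real N - D (m * N + r) * (real m + real r / real N))" if N: "N > 0" for N
  proof -
    have "D (m * N + r) * real (m * N + r) = prog_sum m r b 0 (m * N + r) - prog_sum m r b 1 (m * N + r)"
    proof -
      have "m * N + r > 0" using N m by simp
      then have "real (m * N + r) \<noteq> 0" by (simp only: of_nat_eq_0_iff)
      then show ?thesis unfolding D_def by (simp del: of_nat_add of_nat_mult)
    qed
    also have "\<dots> = e - (\<Sum>n=1..N. b (Suc (big_Omega (m * n + r))) - b (big_Omega (m * n + r)))"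
      unfolding prog_sum_affine[OF m r] by (simp add: e_def sum_subtractf)
    also have "(\<Sum>n=1..N. b (Suc (big_Omega (m * n + r))) - b (big_Omega (m * n + r)))
        = (\<Sum>n=1..N. a (Suc (big_Omega (m * n + r))) - a (big_Omega (m * n + r))) / C"
      by (simp add: b_def sum_divide_distrib diff_divide_distrib)
    finally have "(\<Sum>n=1..N. a (Suc (big_Omega (m * n + r))) - a (big_Omega (m * n + r)))
       = C * (e - D (m * N + r) * real (m * N + r))" using C by (simp add: field_simps)
    then have "(\<Sum>n=1..N. a (Suc (big_Omega (m * n + r))) - a (big_Omega (m * n + r))) / real N
       = C * (e - D (m * N + r) * real (m * N + r)) / real N" by simp
    also have "\<dots> = C * (e / real N - D (m * N + r) * (real m + real r / real N))"
      using N by (simp add: field_simps)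
    finally show ?thesis .
  qed
  have "(\<lambda>N. C * (e / real N - D (m * N + r) * (real m + real r / real N))) \<longlonglongrightarrow> C * (0 - 0 * (real m + 0))"
    by (intro tendsto_mult tendsto_diff tendsto_const D' tendsto_add lim_const_over_n)
  then have "(\<lambda>N. C * (e / real N - D (m * N + r) * (real m + real r / real N))) \<longlonglongrightarrow> 0" by simp
  then show ?thesis
    by (rule Lim_transform_eventually) (use eq in \<open>auto intro!: eventually_mono[OF eventually_gt_at_top[of 0]]\<close>)
qed

theorem corollary1p16:
  fixes X :: "'a::metric_space set" and T :: "'a \<Rightarrow> 'a" and \<mu> :: "'a measure"
    and f :: "'a \<Rightarrow> complex" and x :: 'a and m r :: nat
  assumes "compact X"
    and "T ` X \<subseteq> X" and "continuous_on X T"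
    and "uniquely_ergodic X T" and "invariant_borel_prob X T \<mu>"
    and "x \<in> X"
    and "continuous_on X f"
    and "m \<ge> 1" and "r < m"
  shows "(\<lambda>N::nat. 1 / of_nat N * (\<Sum>n=1..N. f ((T ^^ big_Omega (m * n + r)) x)))
           \<longlonglongrightarrow> integral\<^sup>L \<mu> f"
proof -
  have orbit: "(T ^^ k) x \<in> X" for k
    using assms by (induction k) auto
  define y where "y n = (T ^^ big_Omega (m * n + r)) x" for n
  have avg: "(\<lambda>N. (\<Sum>n=1..N. g (y n)) / real N) \<longlonglongrightarrow> integral\<^sup>L \<mu> g" if g: "continuous_on X g" for g :: "'a \<Rightarrow> real"
  proof (rule uniquely_ergodic_average[OF \<open>compact X\<close> \<open>T ` X \<subseteq> X\<close> \<open>continuous_on X T\<close>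
        \<open>uniquely_ergodic X T\<close> \<open>invariant_borel_prob X T \<mu>\<close> _ _ g])
    show "y n \<in> X" for n by (simp add: y_def orbit)
    fix h :: "'a \<Rightarrow> real" assume "continuous_on X h"
    then have "bounded (h ` X)" using \<open>compact X\<close> compact_continuous_image compact_imp_bounded by blast
    then obtain B where "\<And>z. z \<in> X \<Longrightarrow> \<bar>h z\<bar> \<le> B" by (auto simp: bounded_iff)
    then have "\<bar>h ((T ^^ k) x)\<bar> \<le> B" for k using orbit by blast
    from big_Omega_shift_average[where a = "\<lambda>k. h ((T ^^ k) x)", OF primes_dense_pos _ _ this, of m r] assms(8,9)
    show "(\<lambda>N. (\<Sum>n=1..N. h (T (y n)) - h (y n)) / real N) \<longlonglongrightarrow> 0" by (simp add: y_def)
  qed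
  interpret prob_space \<mu> using \<open>invariant_borel_prob X T \<mu>\<close> by (simp add: invariant_borel_prob_def)
  have sets: "sets \<mu> = sets (restrict_space borel X)"
    using \<open>invariant_borel_prob X T \<mu>\<close> by (simp add: invariant_borel_prob_def)
  have sp: "space \<mu> = X" using sets_eq_imp_space_eq[OF sets] by (simp add: space_restrict_space)
  have meas: "f \<in> borel_measurable \<mu>"
    using borel_measurable_continuous_on_restrict[OF \<open>continuous_on X f\<close>] measurable_cong_sets[OF sets refl] by blast
  have "bounded (f ` X)" using \<open>compact X\<close> \<open>continuous_on X f\<close> compact_continuous_image compact_imp_bounded by blast
  then obtain B where B: "\<And>z. z \<in> X \<Longrightarrow> norm (f z) \<le> B" by (auto simp: bounded_iff)
  have int: "integrable \<mu> f"
    by (rule integrable_const_bound[of _ B]) (auto simp: sp B meas intro!: AE_I2)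
  have "(\<lambda>N. (\<Sum>n=1..N. f (y n)) / of_nat N) \<longlonglongrightarrow> integral\<^sup>L \<mu> f"
  \<comment> \<open>The measure argument is about real functions; \<open>f\<close> is split into
    real and imaginary part.\<close>
  proof (rule tendsto_complex_iff[THEN iffD2], rule conjI)
    have "continuous_on X (\<lambda>z. Re (f z))" "continuous_on X (\<lambda>z. Im (f z))"
      using \<open>continuous_on X f\<close> by (auto intro!: continuous_intros)
    from this[THEN avg] show "(\<lambda>N. Re ((\<Sum>n=1..N. f (y n)) / of_nat N)) \<longlonglongrightarrow> Re (integral\<^sup>L \<mu> f)"
      "(\<lambda>N. Im ((\<Sum>n=1..N. f (y n)) / of_nat N)) \<longlonglongrightarrow> Im (integral\<^sup>L \<mu> f)"
      using int by (simp_all add: integral_Re integral_Im Re_divide_of_nat Im_divide_of_nat)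
  qed
  then show ?thesis by (simp add: y_def)
qed

end
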